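(* Let $\mathcal M$ be any Green 2-functor for a spannable pair $(\mathbb G;\mathbb J)$. Let $i\colon H\to G$ be in $\mathbb J$ and write $A:=i_!(\mathbf 1_H)=i_*(\mathbf 1_H)$. Then the canonical monoid and comonoid structures on $A$ obtained from the adjunctions $i_!\dashv i^*\dashv i_*$ turn $A$ into a special Frobenius object in the monoidal category $\mathcal M(G)$, which is commutative as soon as $\mathcal M$ is braided. In particular, $A$ is a separable algebra.
   Context: Fix a commutative ring $\Bbbk$. $\mathbb A$ denotes either $\mathsf{ADD}_\Bbbk$, the 2-category of (possibly large) additive $\Bbbk$-linear categories, $\Bbbk$-linear functors and natural transformations, or its full 2-subcategory $\mathsf{ADD}_\Bbbk^{ic}$ of idempotent complete ones. A spannable pair $(\mathbb G;\mathbb J)$ consists of: (1) an essentially small $(2,1)$-category $\mathbb G$ (Hom categories are small groupoids; up to equivalence only a small set of objects), which (2) is extensive (it has finite coproducts and for all $G,H$ the pseudofunctor $\mathbb G/G\times\mathbb G/H\to\mathbb G/(G\sqcup H)$, $(u,v)\mapsto u\sqcup v$, is a biequivalence); (3) a 2-full 2-subcategory $\mathbb J\subseteq\mathbb G$ containing all equivalences and closed under isomorphic 1-cells, such that (4) for $i\colon H\to G$ in $\mathbb J$ and any $u\colon K\to G$ there is a pseudopullback ("Mackey square") $p\colon P\to H$, $q\colon P\to K$, $\gamma\colon ip\overset{\sim}{\Rightarrow}uq$, with $q\in\mathbb J$; and (5) for every finite family $u_\ell\colon H_\ell\to G$, the induced $\sqcup_\ell H_\ell\to G$ is in $\mathbb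 J$ iff every $u_\ell$ is. A Mackey 2-functor for $(\mathbb G;\mathbb J)$ is a 2-functor $\mathcal M\colon\mathbb G^{op}\to\mathbb A$ (write $u^*=\mathcal M(u)$) such that: (1) it sends finite coproducts to direct sums; (2) for $i\in\mathbb J$, $i^*$ has a left adjoint $i_!$ and a right adjoint $i_*$; (3) for every Mackey square with $i,q\in\mathbb J$ the mates $\gamma_!\colon q_!p^*\Rightarrow u^*i_!$ and $(\gamma^{-1})_*\colon u^*i_*\Rightarrow q_*p^*$ are invertible; (4) $i_!\simeq i_*$ for $i\in\mathbb J$. Standing assumption: all Mackey 2-functors are rectified, i.e. come with chosen adjunctions $(i_!\dashv i^*,{}^\ell\eta,{}^\ell\varepsilon)$ and $(i^*\dashv i_*,{}^r\eta,{}^r\varepsilon)$ for $i\in\mathbb J$ with $i_!=i_*$ as functors, the pseudofunctors $i\mapsto i_!$ and $i\mapsto i_*$ on $\mathbb J$ equal, $(\gamma_!)^{-1}=(\gamma^{-1})_*$ for all Mackey squares, and ${}^r\varepsilon\circ{}^\ell\eta=\mathrm{id}$. A Green 2-functor for $(\mathbb G;\mathbb J)$ is a Mackey 2-functor $\mathcal M$ together with a lift of $\mathcal M$ to a 2-functor into monoidal categories in $\mathbb A$ (tensor product $\otimes$ $\Bbbk$-bilinear, unit $\mathbf 1_G$), $\Bbbk$-linear strong monoidal functors $u^*$ (write $\otimes_u\colon u^*(X\otimes X')\xrightarrow{\sim}u^*X\otimes u^*X'$) and monoidal transformations, satisfying the projection formulas: for all $i\in\mathbb J$, the maps $\mathrm{Rp}^1_{X,Y}=i_*(i^*X\otimes{}^r\varepsilon)\circ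 i_*(\otimes_i)\circ{}^r\eta\colon X\otimes i_*Y\to i_*(i^*X\otimes Y)$ and $\mathrm{Rp}^2_{Y,X}=i_*({}^r\varepsilon\otimes i^*X)\circ i_*(\otimes_i)\circ{}^r\eta\colon i_*Y\otimes X\to i_*(Y\otimes i^*X)$ are inverse to $\mathrm{Lp}^1_{X,Y}={}^\ell\varepsilon\circ i_!(\otimes_i^{-1})\circ i_!(i^*X\otimes{}^\ell\eta)$ and $\mathrm{Lp}^2_{Y,X}={}^\ell\varepsilon\circ i_!(\otimes_i^{-1})\circ i_!({}^\ell\eta\otimes i^*X)$ respectively. It is braided (symmetric) if the lift is to braided (symmetric) monoidal categories and braided strong monoidal functors. Canonical structures on $A$: the right adjoint $i_*$ of the strong monoidal functor $i^*$ is lax monoidal via $i_*X\otimes i_*Y\xrightarrow{{}^r\eta}i_*i^*(i_*X\otimes i_*Y)\cong i_*(i^*i_*X\otimes i^*i_*Y)\xrightarrow{i_*({}^r\varepsilon\otimes{}^r\varepsilon)}i_*(X\otimes Y)$ and $\mathbf 1_G\xrightarrow{{}^r\eta}i_*i^*\mathbf 1_G\cong i_*\mathbf 1_H$; dually the left adjoint $i_!$ is colax monoidal. At $\mathbf 1_H$ (with $\mathbf 1_H\otimes\mathbf 1_H\cong\mathbf 1_H$) these give the multiplication $\mu$ and unit $\iota$, resp. the comultiplication $\delta$ and counit $\epsilon$, of $A$. A Frobenius object is an object with a monoid and a comonoid structure such that $(A\otimes\mu)(\delta\otimes A)=\delta\mu=(\mu\otimes A)(A\otimes\delta)$; it is special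 if $\mu\delta=\mathrm{id}_A$. A monoid is separable if its multiplication has a bimodule section. *)

theory Defs
  imports "HOL-Algebra.Module"
begin

section \<open>Categories, functors, natural transformations\<close>

record ('o, 'a) cat =
  Obj :: "'o set"
  Arr :: "'a set"
  Dom :: "'a \<Rightarrow> 'o"
  Cod :: "'a \<Rightarrow> 'o"
  Ide :: "'o \<Rightarrow> 'a"
  Cmp :: "'a \<Rightarrow> 'a \<Rightarrow> 'a"  (infixr "\<cdot>\<index>" 70)

definition arrows :: "('o, 'a, 'z) cat_scheme \<Rightarrow> 'o \<Rightarrow> 'o \<Rightarrow> 'a set" where
  "arrows C X Y = {f \<in> Arr C. Dom C f = X \<and> Cod C f = Y}"

locale category =
  fixes C :: "('o, 'a, 'z) cat_scheme" (structure)
  assumes Dom_closed: "f \<in> Arr C \<Longrightarrow> Dom C f \<in> Obj C"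
    and Cod_closed: "f \<in> Arr C \<Longrightarrow> Cod C f \<in> Obj C"
    and Ide_closed: "X \<in> Obj C \<Longrightarrow> Ide C X \<in> arrows C X X"
    and Cmp_closed: "f \<in> arrows C X Y \<Longrightarrow> g \<in> arrows C Y Z \<Longrightarrow> g \<cdot> f \<in> arrows C X Z"
    and Cmp_Ide: "f \<in> arrows C X Y \<Longrightarrow> f \<cdot> Ide C X = f"
    and Ide_Cmp: "f \<in> arrows C X Y \<Longrightarrow> Ide C Y \<cdot> f = f"
    and Cmp_assoc: "f \<in> arrows C W X \<Longrightarrow> g \<in> arrows C X Y \<Longrightarrow> h \<in> arrows C Y Z
      \<Longrightarrow> (h \<cdot> g) \<cdot> f = h \<cdot> (g \<cdot> f)"

definition inverse_arrows :: "('o, 'a, 'z) cat_scheme \<Rightarrow> 'a \<Rightarrow> 'a \<Rightarrow> bool" where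
  "inverse_arrows C f g \<longleftrightarrow> f \<in> Arr C \<and> g \<in> arrows C (Cod C f) (Dom C f)
     \<and> g \<cdot>\<^bsub>C\<^esub> f = Ide C (Dom C f) \<and> f \<cdot>\<^bsub>C\<^esub> g = Ide C (Cod C f)"

definition iso_arrow :: "('o, 'a, 'z) cat_scheme \<Rightarrow> 'a \<Rightarrow> bool" where
  "iso_arrow C f \<longleftrightarrow> (\<exists>g. inverse_arrows C f g)"

definition inv_arr :: "('o, 'a, 'z) cat_scheme \<Rightarrow> 'a \<Rightarrow> 'a" where
  "inv_arr C f = (THE g. inverse_arrows C f g)"

record ('o, 'a, 'p, 'b) ftr =
  FO :: "'o \<Rightarrow> 'p"
  FA :: "'a \<Rightarrow> 'b"

definition id_ftr :: "('o, 'a, 'o, 'a) ftr" where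
  "id_ftr = \<lparr>FO = \<lambda>X. X, FA = \<lambda>f. f\<rparr>"

definition comp_ftr :: "('p, 'b, 'q, 'c) ftr \<Rightarrow> ('o, 'a, 'p, 'b) ftr \<Rightarrow> ('o, 'a, 'q, 'c) ftr" where
  "comp_ftr G F = \<lparr>FO = \<lambda>X. FO G (FO F X), FA = \<lambda>f. FA G (FA F f)\<rparr>"

locale cat_functor = C: category C + D: category D
  for C :: "('o, 'a, 'z) cat_scheme" and D :: "('p, 'b, 'w) cat_scheme" +
  fixes F :: "('o, 'a, 'p, 'b) ftr"
  assumes FO_closed: "X \<in> Obj C \<Longrightarrow> FO F X \<in> Obj D"
    and FA_closed: "f \<in> arrows C X Y \<Longrightarrow> FA F f \<in> arrows D (FO F X) (FO F Y)"
    and FA_Ide: "X \<in> Obj C \<Longrightarrow> FA F (Ide C X) = Ide D (FO F X)"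
    and FA_Cmp: "f \<in> arrows C X Y \<Longrightarrow> g \<in> arrows C Y Z
      \<Longrightarrow> FA F (g \<cdot>\<^bsub>C\<^esub> f) = FA F g \<cdot>\<^bsub>D\<^esub> FA F f"

text \<open>Functors are total functions on the ambient types, so they are only ever compared on
  the objects and arrows of their source category.\<close>

definition ftr_eq :: "('o, 'a, 'z) cat_scheme \<Rightarrow> ('o, 'a, 'p, 'b) ftr \<Rightarrow> ('o, 'a, 'p, 'b) ftr \<Rightarrow> bool" where
  "ftr_eq C F G \<longleftrightarrow> (\<forall>X\<in>Obj C. FO F X = FO G X) \<and> (\<forall>f\<in>Arr C. FA F f = FA G f)"

locale natural_transformation = F: cat_functor C D F + G: cat_functor C D G
  for C :: "('o, 'a, 'z) cat_scheme" and D :: "('p, 'b, 'w) cat_scheme"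
    and F :: "('o, 'a, 'p, 'b) ftr" and G :: "('o, 'a, 'p, 'b) ftr" +
  fixes \<alpha> :: "'o \<Rightarrow> 'b"
  assumes component: "X \<in> Obj C \<Longrightarrow> \<alpha> X \<in> arrows D (FO F X) (FO G X)"
    and naturality: "f \<in> arrows C X Y \<Longrightarrow> \<alpha> Y \<cdot>\<^bsub>D\<^esub> FA F f = FA G f \<cdot>\<^bsub>D\<^esub> \<alpha> X"

locale natural_isomorphism = natural_transformation +
  assumes component_iso: "X \<in> Obj C \<Longrightarrow> iso_arrow D (\<alpha> X)"

definition cat_equivalence ::
    "('o, 'a, 'z) cat_scheme \<Rightarrow> ('p, 'b, 'w) cat_scheme \<Rightarrow> ('o, 'a, 'p, 'b) ftr \<Rightarrow> bool" where
  "cat_equivalence C D F \<longleftrightarrow> cat_functor C D F \<and>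
     (\<exists>G \<eta> \<epsilon>. cat_functor D C G \<and> natural_isomorphism C C id_ftr (comp_ftr G F) \<eta>
        \<and> natural_isomorphism D D (comp_ftr F G) id_ftr \<epsilon>)"

text \<open>\<open>F : C \<rightarrow> D\<close> is left adjoint to \<open>U : D \<rightarrow> C\<close>.\<close>

locale adjunction =
  unit: natural_transformation C C id_ftr "comp_ftr U F" \<eta> +
  counit: natural_transformation D D "comp_ftr F U" id_ftr \<epsilon> +
  left: cat_functor C D F + right: cat_functor D C U
  for C :: "('o, 'a, 'z) cat_scheme" and D :: "('p, 'b, 'w) cat_scheme"
    and F :: "('o, 'a, 'p, 'b) ftr" and U :: "('p, 'b, 'o, 'a) ftr"
    and \<eta> :: "'o \<Rightarrow> 'a" and \<epsilon> :: "'p \<Rightarrow> 'b" +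
  assumes triangle_left: "X \<in> Obj C \<Longrightarrow> \<epsilon> (FO F X) \<cdot>\<^bsub>D\<^esub> FA F (\<eta> X) = Ide D (FO F X)"
    and triangle_right: "Y \<in> Obj D \<Longrightarrow> FA U (\<epsilon> Y) \<cdot>\<^bsub>C\<^esub> \<eta> (FO U Y) = Ide C (FO U Y)"

text \<open>Product of a finite family of categories indexed by \<open>{..<n}\<close>.\<close>

definition prod_cat :: "nat \<Rightarrow> (nat \<Rightarrow> ('o, 'a, 'z) cat_scheme) \<Rightarrow> (nat \<Rightarrow> 'o, nat \<Rightarrow> 'a) cat" where
  "prod_cat n C = \<lparr>
     Obj = Pi\<^sub>E {..<n} (\<lambda>l. Obj (C l)),
     Arr = Pi\<^sub>E {..<n} (\<lambda>l. Arr (C l)),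
     Dom = \<lambda>f. \<lambda>l\<in>{..<n}. Dom (C l) (f l),
     Cod = \<lambda>f. \<lambda>l\<in>{..<n}. Cod (C l) (f l),
     Ide = \<lambda>X. \<lambda>l\<in>{..<n}. Ide (C l) (X l),
     Cmp = \<lambda>g f. \<lambda>l\<in>{..<n}. g l \<cdot>\<^bsub>C l\<^esub> f l\<rparr>"

definition tuple_ftr :: "nat \<Rightarrow> (nat \<Rightarrow> ('o, 'a, 'p, 'b) ftr) \<Rightarrow> ('o, 'a, nat \<Rightarrow> 'p, nat \<Rightarrow> 'b) ftr" where
  "tuple_ftr n F = \<lparr>
     FO = \<lambda>X. \<lambda>l\<in>{..<n}. FO (F l) X,
     FA = \<lambda>f. \<lambda>l\<in>{..<n}. FA (F l) f\<rparr>"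

text \<open>The pseudopullback of categories \<open>F : A \<rightarrow> C \<leftarrow> B : G\<close>: objects are triples
  \<open>(X, Y, \<phi> : F X \<cong> G Y)\<close>. An arrow carries its source and target object.\<close>

definition isocomma_cat ::
    "('o, 'a, 'z) cat_scheme \<Rightarrow> ('p, 'b, 'w) cat_scheme \<Rightarrow> ('q, 'c, 'v) cat_scheme
      \<Rightarrow> ('o, 'a, 'q, 'c) ftr \<Rightarrow> ('p, 'b, 'q, 'c) ftr
      \<Rightarrow> ('o \<times> 'p \<times> 'c, ('o \<times> 'p \<times> 'c) \<times> ('o \<times> 'p \<times> 'c) \<times> 'a \<times> 'b) cat" where
  "isocomma_cat A B C F G =
    (let Ob = {(X, Y, \<phi>). X \<in> Obj A \<and> Y \<in> Obj B
                 \<and> \<phi> \<in> arrows C (FO F X) (FO G Y) \<and> iso_arrow C \<phi>}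
     in \<lparr>Obj = Ob,
         Arr = {((X, Y, \<phi>), (X', Y', \<phi>'), a, b). (X, Y, \<phi>) \<in> Ob \<and> (X', Y', \<phi>') \<in> Ob
                 \<and> a \<in> arrows A X X' \<and> b \<in> arrows B Y Y'
                 \<and> \<phi>' \<cdot>\<^bsub>C\<^esub> FA F a = FA G b \<cdot>\<^bsub>C\<^esub> \<phi>},
         Dom = \<lambda>(x, y, a, b). x,
         Cod = \<lambda>(x, y, a, b). y,
         Ide = \<lambda>(X, Y, \<phi>). ((X, Y, \<phi>), (X, Y, \<phi>), Ide A X, Ide B Y),
         Cmp = \<lambda>(x', y', a', b') (x, y, a, b). (x, y', a' \<cdot>\<^bsub>A\<^esub> a, b' \<cdot>\<^bsub>B\<^esub> b)\<rparr>)"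


section \<open>Strict 2-categories\<close>

record ('o, 'f, 't) two_cat =
  Ob0 :: "'o set"
  Cell1 :: "'f set"
  Src :: "'f \<Rightarrow> 'o"
  Trg :: "'f \<Rightarrow> 'o"
  Id1 :: "'o \<Rightarrow> 'f"
  Cmp1 :: "'f \<Rightarrow> 'f \<Rightarrow> 'f"  (infixr "\<diamondop>\<index>" 75)
  Cell2 :: "'t set"
  Dom2 :: "'t \<Rightarrow> 'f"
  Cod2 :: "'t \<Rightarrow> 'f"
  Id2 :: "'f \<Rightarrow> 't"
  VCmp :: "'t \<Rightarrow> 't \<Rightarrow> 't"  (infixr "\<bullet>\<index>" 65)
  HCmp :: "'t \<Rightarrow> 't \<Rightarrow> 't"  (infixr "\<star>\<index>" 70)

definition cells1 :: "('o, 'f, 't, 'z) two_cat_scheme \<Rightarrow> 'o \<Rightarrow> 'o \<Rightarrow> 'f set" where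
  "cells1 B X Y = {f \<in> Cell1 B. Src B f = X \<and> Trg B f = Y}"

definition cells2 :: "('o, 'f, 't, 'z) two_cat_scheme \<Rightarrow> 'f \<Rightarrow> 'f \<Rightarrow> 't set" where
  "cells2 B f g = {\<alpha> \<in> Cell2 B. Dom2 B \<alpha> = f \<and> Cod2 B \<alpha> = g}"

definition hom_cat :: "('o, 'f, 't, 'z) two_cat_scheme \<Rightarrow> 'o \<Rightarrow> 'o \<Rightarrow> ('f, 't) cat" where
  "hom_cat B X Y = \<lparr>
     Obj = cells1 B X Y,
     Arr = {\<alpha> \<in> Cell2 B. Dom2 B \<alpha> \<in> cells1 B X Y \<and> Cod2 B \<alpha> \<in> cells1 B X Y},
     Dom = Dom2 B, Cod = Cod2 B, Ide = Id2 B, Cmp = VCmp B\<rparr>"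

locale two_category =
  fixes B :: "('o, 'f, 't, 'z) two_cat_scheme" (structure)
  assumes Src_closed: "f \<in> Cell1 B \<Longrightarrow> Src B f \<in> Ob0 B"
    and Trg_closed: "f \<in> Cell1 B \<Longrightarrow> Trg B f \<in> Ob0 B"
    and Dom2_closed: "\<alpha> \<in> Cell2 B \<Longrightarrow> Dom2 B \<alpha> \<in> Cell1 B"
    and Cod2_parallel: "\<alpha> \<in> Cell2 B \<Longrightarrow> Cod2 B \<alpha> \<in> cells1 B (Src B (Dom2 B \<alpha>)) (Trg B (Dom2 B \<alpha>))"
    and hom_category: "X \<in> Ob0 B \<Longrightarrow> Y \<in> Ob0 B \<Longrightarrow> category (hom_cat B X Y)"
    and Id1_closed: "X \<in> Ob0 B \<Longrightarrow> Id1 B X \<in> cells1 B X X"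
    and Cmp1_closed: "f \<in> cells1 B X Y \<Longrightarrow> g \<in> cells1 B Y Z \<Longrightarrow> g \<diamondop> f \<in> cells1 B X Z"
    and Cmp1_Id1: "f \<in> cells1 B X Y \<Longrightarrow> f \<diamondop> Id1 B X = f"
    and Id1_Cmp1: "f \<in> cells1 B X Y \<Longrightarrow> Id1 B Y \<diamondop> f = f"
    and Cmp1_assoc: "f \<in> cells1 B W X \<Longrightarrow> g \<in> cells1 B X Y \<Longrightarrow> h \<in> cells1 B Y Z
      \<Longrightarrow> (h \<diamondop> g) \<diamondop> f = h \<diamondop> (g \<diamondop> f)"
    and HCmp_closed: "f \<in> cells1 B X Y \<Longrightarrow> g \<in> cells1 B Y Z \<Longrightarrow> \<alpha> \<in> cells2 B f f' \<Longrightarrow> \<beta> \<in> cells2 B g g'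
      \<Longrightarrow> \<beta> \<star> \<alpha> \<in> cells2 B (g \<diamondop> f) (g' \<diamondop> f')"
    and HCmp_Id2: "f \<in> cells1 B X Y \<Longrightarrow> g \<in> cells1 B Y Z \<Longrightarrow> Id2 B g \<star> Id2 B f = Id2 B (g \<diamondop> f)"
    and interchange: "f \<in> cells1 B X Y \<Longrightarrow> g \<in> cells1 B Y Z
      \<Longrightarrow> \<alpha> \<in> cells2 B f f' \<Longrightarrow> \<alpha>' \<in> cells2 B f' f'' \<Longrightarrow> \<beta> \<in> cells2 B g g' \<Longrightarrow> \<beta>' \<in> cells2 B g' g''
      \<Longrightarrow> (\<beta>' \<bullet> \<beta>) \<star> (\<alpha>' \<bullet> \<alpha>) = (\<beta>' \<star> \<alpha>') \<bullet> (\<beta> \<star> \<alpha>)"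
    and HCmp_unit_right: "f \<in> cells1 B X Y \<Longrightarrow> \<alpha> \<in> cells2 B f f' \<Longrightarrow> \<alpha> \<star> Id2 B (Id1 B X) = \<alpha>"
    and HCmp_unit_left: "f \<in> cells1 B X Y \<Longrightarrow> \<alpha> \<in> cells2 B f f' \<Longrightarrow> Id2 B (Id1 B Y) \<star> \<alpha> = \<alpha>"
    and HCmp_assoc: "f \<in> cells1 B W X \<Longrightarrow> g \<in> cells1 B X Y \<Longrightarrow> h \<in> cells1 B Y Z
      \<Longrightarrow> \<alpha> \<in> cells2 B f f' \<Longrightarrow> \<beta> \<in> cells2 B g g' \<Longrightarrow> \<gamma> \<in> cells2 B h h'
      \<Longrightarrow> (\<gamma> \<star> \<beta>) \<star> \<alpha> = \<gamma> \<star> (\<beta> \<star> \<alpha>)"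

definition invertible2 :: "('o, 'f, 't, 'z) two_cat_scheme \<Rightarrow> 't \<Rightarrow> bool" where
  "invertible2 B \<alpha> \<longleftrightarrow> iso_arrow (hom_cat B (Src B (Dom2 B \<alpha>)) (Trg B (Dom2 B \<alpha>))) \<alpha>"

definition inverse2 :: "('o, 'f, 't, 'z) two_cat_scheme \<Rightarrow> 't \<Rightarrow> 't" where
  "inverse2 B \<alpha> = inv_arr (hom_cat B (Src B (Dom2 B \<alpha>)) (Trg B (Dom2 B \<alpha>))) \<alpha>"

locale two_one_category = two_category +
  assumes all_invertible: "\<alpha> \<in> Cell2 B \<Longrightarrow> invertible2 B \<alpha>"

definition isomorphic1 :: "('o, 'f, 't, 'z) two_cat_scheme \<Rightarrow> 'f \<Rightarrow> 'f \<Rightarrow> bool" where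
  "isomorphic1 B f g \<longleftrightarrow> (\<exists>\<alpha> \<in> cells2 B f g. invertible2 B \<alpha>)"

definition equivalence1 :: "('o, 'f, 't, 'z) two_cat_scheme \<Rightarrow> 'f \<Rightarrow> bool" where
  "equivalence1 B f \<longleftrightarrow> f \<in> Cell1 B \<and> (\<exists>g \<in> cells1 B (Trg B f) (Src B f).
     isomorphic1 B (g \<diamondop>\<^bsub>B\<^esub> f) (Id1 B (Src B f)) \<and> isomorphic1 B (f \<diamondop>\<^bsub>B\<^esub> g) (Id1 B (Trg B f)))"

definition precomp_ftr :: "('o, 'f, 't, 'z) two_cat_scheme \<Rightarrow> 'f \<Rightarrow> ('f, 't, 'f, 't) ftr" where
  "precomp_ftr B i = \<lparr>FO = \<lambda>f. f \<diamondop>\<^bsub>B\<^esub> i, FA = \<lambda>\<alpha>. \<alpha> \<star>\<^bsub>B\<^esub> Id2 B i\<rparr>"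

definition postcomp_ftr :: "('o, 'f, 't, 'z) two_cat_scheme \<Rightarrow> 'f \<Rightarrow> ('f, 't, 'f, 't) ftr" where
  "postcomp_ftr B i = \<lparr>FO = \<lambda>f. i \<diamondop>\<^bsub>B\<^esub> f, FA = \<lambda>\<alpha>. Id2 B i \<star>\<^bsub>B\<^esub> \<alpha>\<rparr>"

text \<open>Coproducts and pseudopullbacks are bicategorical: the universal properties are
  equivalences, not isomorphisms, of Hom categories.\<close>

definition is_coproduct ::
    "('o, 'f, 't, 'z) two_cat_scheme \<Rightarrow> nat \<Rightarrow> (nat \<Rightarrow> 'o) \<Rightarrow> 'o \<Rightarrow> (nat \<Rightarrow> 'f) \<Rightarrow> bool" where
  "is_coproduct B n X S inc \<longleftrightarrow> S \<in> Ob0 B \<and> (\<forall>l<n. X l \<in> Ob0 B \<and> inc l \<in> cells1 B (X l) S)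
     \<and> (\<forall>Z \<in> Ob0 B. cat_equivalence (hom_cat B S Z) (prod_cat n (\<lambda>l. hom_cat B (X l) Z))
          (tuple_ftr n (\<lambda>l. precomp_ftr B (inc l))))"

definition is_coproduct2 :: "('o, 'f, 't, 'z) two_cat_scheme \<Rightarrow> 'o \<Rightarrow> 'o \<Rightarrow> 'o \<Rightarrow> 'f \<Rightarrow> 'f \<Rightarrow> bool" where
  "is_coproduct2 B X Y S i j \<longleftrightarrow>
     is_coproduct B 2 (\<lambda>l. if l = 0 then X else Y) S (\<lambda>l. if l = 0 then i else j)"

definition has_finite_coproducts :: "('o, 'f, 't, 'z) two_cat_scheme \<Rightarrow> bool" where
  "has_finite_coproducts B \<longleftrightarrow>
     (\<forall>n X. (\<forall>l<n. X l \<in> Ob0 B) \<longrightarrow> (\<exists>S inc. is_coproduct B n X S inc))"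

text \<open>The Mackey square with \<open>i : H \<rightarrow> G\<close>, \<open>u : K \<rightarrow> G\<close>, \<open>p : P \<rightarrow> H\<close>, \<open>q : P \<rightarrow> K\<close> and
  \<open>\<gamma> : i p \<Rightarrow> u q\<close>.\<close>

definition mackey_square ::
    "('o, 'f, 't, 'z) two_cat_scheme \<Rightarrow> 'f \<Rightarrow> 'f \<Rightarrow> 'f \<Rightarrow> 'f \<Rightarrow> 't \<Rightarrow> bool" where
  "mackey_square B i u p q \<gamma> \<longleftrightarrow>
     i \<in> Cell1 B \<and> u \<in> Cell1 B \<and> Trg B i = Trg B u
     \<and> p \<in> Cell1 B \<and> q \<in> Cell1 B \<and> Src B p = Src B q \<and> Trg B p = Src B i \<and> Trg B q = Src B u
     \<and> \<gamma> \<in> cells2 B (i \<diamondop>\<^bsub>B\<^esub> p) (u \<diamondop>\<^bsub>B\<^esub> q) \<and> invertible2 B \<gamma>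
     \<and> (\<forall>T \<in> Ob0 B.
          let obj = (\<lambda>t. (p \<diamondop>\<^bsub>B\<^esub> t, q \<diamondop>\<^bsub>B\<^esub> t, \<gamma> \<star>\<^bsub>B\<^esub> Id2 B t))
          in cat_equivalence (hom_cat B T (Src B p))
               (isocomma_cat (hom_cat B T (Src B i)) (hom_cat B T (Src B u)) (hom_cat B T (Trg B i))
                  (postcomp_ftr B i) (postcomp_ftr B u))
               \<lparr>FO = obj,
                FA = \<lambda>\<tau>. (obj (Dom2 B \<tau>), obj (Cod2 B \<tau>), Id2 B p \<star>\<^bsub>B\<^esub> \<tau>, Id2 B q \<star>\<^bsub>B\<^esub> \<tau>)\<rparr>)"


section \<open>Pseudofunctors and extensivity\<close>

record ('o, 'f, 't, 'p, 'g, 's) pseudo =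
  P0 :: "'o \<Rightarrow> 'p"
  P1 :: "'f \<Rightarrow> 'g"
  P2 :: "'t \<Rightarrow> 's"
  Pc :: "'f \<Rightarrow> 'f \<Rightarrow> 's"  \<comment> \<open>\<open>Pc g f : P1 g \<diamondop> P1 f \<Rightarrow> P1 (g \<diamondop> f)\<close>\<close>
  Pu :: "'o \<Rightarrow> 's"  \<comment> \<open>\<open>Pu X : Id1 (P0 X) \<Rightarrow> P1 (Id1 X)\<close>\<close>

locale pseudofunctor = B: two_category B + C: two_category C
  for B :: "('o, 'f, 't, 'z) two_cat_scheme" and C :: "('p, 'g, 's, 'w) two_cat_scheme" +
  fixes F :: "('o, 'f, 't, 'p, 'g, 's) pseudo"
  assumes P0_closed: "X \<in> Ob0 B \<Longrightarrow> P0 F X \<in> Ob0 C"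
    and local_functor: "X \<in> Ob0 B \<Longrightarrow> Y \<in> Ob0 B
      \<Longrightarrow> cat_functor (hom_cat B X Y) (hom_cat C (P0 F X) (P0 F Y)) \<lparr>FO = P1 F, FA = P2 F\<rparr>"
    and Pc_closed: "f \<in> cells1 B X Y \<Longrightarrow> g \<in> cells1 B Y Z
      \<Longrightarrow> Pc F g f \<in> cells2 C (P1 F g \<diamondop>\<^bsub>C\<^esub> P1 F f) (P1 F (g \<diamondop>\<^bsub>B\<^esub> f)) \<and> invertible2 C (Pc F g f)"
    and Pu_closed: "X \<in> Ob0 B
      \<Longrightarrow> Pu F X \<in> cells2 C (Id1 C (P0 F X)) (P1 F (Id1 B X)) \<and> invertible2 C (Pu F X)"
    and Pc_natural: "f \<in> cells1 B X Y \<Longrightarrow> g \<in> cells1 B Y Z \<Longrightarrow> \<alpha> \<in> cells2 B f f' \<Longrightarrow> \<beta> \<in> cells2 B g g'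
      \<Longrightarrow> Pc F g' f' \<bullet>\<^bsub>C\<^esub> (P2 F \<beta> \<star>\<^bsub>C\<^esub> P2 F \<alpha>) = P2 F (\<beta> \<star>\<^bsub>B\<^esub> \<alpha>) \<bullet>\<^bsub>C\<^esub> Pc F g f"
    and Pc_assoc: "f \<in> cells1 B W X \<Longrightarrow> g \<in> cells1 B X Y \<Longrightarrow> h \<in> cells1 B Y Z
      \<Longrightarrow> Pc F h (g \<diamondop>\<^bsub>B\<^esub> f) \<bullet>\<^bsub>C\<^esub> (Id2 C (P1 F h) \<star>\<^bsub>C\<^esub> Pc F g f)
        = Pc F (h \<diamondop>\<^bsub>B\<^esub> g) f \<bullet>\<^bsub>C\<^esub> (Pc F h g \<star>\<^bsub>C\<^esub> Id2 C (P1 F f))"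
    and Pc_unit_right: "f \<in> cells1 B X Y
      \<Longrightarrow> Pc F f (Id1 B X) \<bullet>\<^bsub>C\<^esub> (Id2 C (P1 F f) \<star>\<^bsub>C\<^esub> Pu F X) = Id2 C (P1 F f)"
    and Pc_unit_left: "f \<in> cells1 B X Y
      \<Longrightarrow> Pc F (Id1 B Y) f \<bullet>\<^bsub>C\<^esub> (Pu F Y \<star>\<^bsub>C\<^esub> Id2 C (P1 F f)) = Id2 C (P1 F f)"

definition biequivalence ::
    "('o, 'f, 't, 'z) two_cat_scheme \<Rightarrow> ('p, 'g, 's, 'w) two_cat_scheme
      \<Rightarrow> ('o, 'f, 't, 'p, 'g, 's) pseudo \<Rightarrow> bool" where
  "biequivalence B C F \<longleftrightarrow> pseudofunctor B C F
     \<and> (\<forall>X \<in> Ob0 B. \<forall>Y \<in> Ob0 B.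
          cat_equivalence (hom_cat B X Y) (hom_cat C (P0 F X) (P0 F Y)) \<lparr>FO = P1 F, FA = P2 F\<rparr>)
     \<and> (\<forall>Y \<in> Ob0 C. \<exists>X \<in> Ob0 B. \<exists>e \<in> cells1 C (P0 F X) Y. equivalence1 C e)"

record ('o, 'f, 'g, 's) pseudonat =
  N0 :: "'o \<Rightarrow> 'g"
  N1 :: "'f \<Rightarrow> 's"  \<comment> \<open>\<open>N1 f : G f \<diamondop> N0 X \<Rightarrow> N0 Y \<diamondop> F f\<close> for \<open>f : X \<rightarrow> Y\<close>\<close>

locale pseudonatural = F: pseudofunctor B C F + G: pseudofunctor B C G
  for B :: "('o, 'f, 't, 'z) two_cat_scheme" and C :: "('p, 'g, 's, 'w) two_cat_scheme"
    and F :: "('o, 'f, 't, 'p, 'g, 's) pseudo" and G :: "('o, 'f, 't, 'p, 'g, 's) pseudo" +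
  fixes \<sigma> :: "('o, 'f, 'g, 's) pseudonat"
  assumes N0_closed: "X \<in> Ob0 B \<Longrightarrow> N0 \<sigma> X \<in> cells1 C (P0 F X) (P0 G X)"
    and N1_closed: "f \<in> cells1 B X Y
      \<Longrightarrow> N1 \<sigma> f \<in> cells2 C (P1 G f \<diamondop>\<^bsub>C\<^esub> N0 \<sigma> X) (N0 \<sigma> Y \<diamondop>\<^bsub>C\<^esub> P1 F f) \<and> invertible2 C (N1 \<sigma> f)"
    and N1_natural: "f \<in> cells1 B X Y \<Longrightarrow> \<alpha> \<in> cells2 B f f'
      \<Longrightarrow> N1 \<sigma> f' \<bullet>\<^bsub>C\<^esub> (P2 G \<alpha> \<star>\<^bsub>C\<^esub> Id2 C (N0 \<sigma> X)) = (Id2 C (N0 \<sigma> Y) \<star>\<^bsub>C\<^esub> P2 F \<alpha>) \<bullet>\<^bsub>C\<^esub> N1 \<sigma> f"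
    and N1_Cmp1: "f \<in> cells1 B X Y \<Longrightarrow> g \<in> cells1 B Y Z
      \<Longrightarrow> N1 \<sigma> (g \<diamondop>\<^bsub>B\<^esub> f) \<bullet>\<^bsub>C\<^esub> (Pc G g f \<star>\<^bsub>C\<^esub> Id2 C (N0 \<sigma> X))
        = (Id2 C (N0 \<sigma> Z) \<star>\<^bsub>C\<^esub> Pc F g f) \<bullet>\<^bsub>C\<^esub> (N1 \<sigma> g \<star>\<^bsub>C\<^esub> Id2 C (P1 F f))
            \<bullet>\<^bsub>C\<^esub> (Id2 C (P1 G g) \<star>\<^bsub>C\<^esub> N1 \<sigma> f)"
    and N1_Id1: "X \<in> Ob0 B
      \<Longrightarrow> N1 \<sigma> (Id1 B X) \<bullet>\<^bsub>C\<^esub> (Pu G X \<star>\<^bsub>C\<^esub> Id2 C (N0 \<sigma> X)) = Id2 C (N0 \<sigma> X) \<star>\<^bsub>C\<^esub> Pu F X"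

definition prod2 ::
    "('o, 'f, 't, 'z) two_cat_scheme \<Rightarrow> ('p, 'g, 's, 'w) two_cat_scheme
      \<Rightarrow> ('o \<times> 'p, 'f \<times> 'g, 't \<times> 's) two_cat" where
  "prod2 B C = \<lparr>
     Ob0 = Ob0 B \<times> Ob0 C,
     Cell1 = Cell1 B \<times> Cell1 C,
     Src = map_prod (Src B) (Src C),
     Trg = map_prod (Trg B) (Trg C),
     Id1 = map_prod (Id1 B) (Id1 C),
     Cmp1 = \<lambda>(g, g') (f, f'). (g \<diamondop>\<^bsub>B\<^esub> f, g' \<diamondop>\<^bsub>C\<^esub> f'),
     Cell2 = Cell2 B \<times> Cell2 C,
     Dom2 = map_prod (Dom2 B) (Dom2 C),
     Cod2 = map_prod (Cod2 B) (Cod2 C),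
     Id2 = map_prod (Id2 B) (Id2 C),
     VCmp = \<lambda>(\<beta>, \<beta>') (\<alpha>, \<alpha>'). (\<beta> \<bullet>\<^bsub>B\<^esub> \<alpha>, \<beta>' \<bullet>\<^bsub>C\<^esub> \<alpha>'),
     HCmp = \<lambda>(\<beta>, \<beta>') (\<alpha>, \<alpha>'). (\<beta> \<star>\<^bsub>B\<^esub> \<alpha>, \<beta>' \<star>\<^bsub>C\<^esub> \<alpha>')\<rparr>"

text \<open>The pseudo-slice \<open>B/X\<close>. An object is a 1-cell \<open>u\<close> into \<open>X\<close>; a 1-cell \<open>u \<rightarrow> v\<close> is a tuple
  \<open>(u, v, f, \<phi>)\<close> with \<open>\<phi> : u \<Rightarrow> v f\<close> invertible; a 2-cell is a 2-cell \<open>\<alpha> : f \<Rightarrow> f'\<close> with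
  \<open>(v \<alpha>) \<phi> = \<phi>'\<close>, stored together with its source and target.\<close>

type_synonym ('f, 't) slice1 = "'f \<times> 'f \<times> 'f \<times> 't"
type_synonym ('f, 't) slice2 = "('f, 't) slice1 \<times> ('f, 't) slice1 \<times> 't"

definition slice_Cell1 :: "('o, 'f, 't, 'z) two_cat_scheme \<Rightarrow> 'o \<Rightarrow> ('f, 't) slice1 set" where
  "slice_Cell1 B X = {(u, v, f, \<phi>). u \<in> Cell1 B \<and> Trg B u = X \<and> v \<in> Cell1 B \<and> Trg B v = X
     \<and> f \<in> cells1 B (Src B u) (Src B v) \<and> \<phi> \<in> cells2 B u (v \<diamondop>\<^bsub>B\<^esub> f) \<and> invertible2 B \<phi>}"

definition slice_Cmp1 ::
    "('o, 'f, 't, 'z) two_cat_scheme \<Rightarrow> ('f, 't) slice1 \<Rightarrow> ('f, 't) slice1 \<Rightarrow> ('f, 't) slice1" where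
  "slice_Cmp1 B = (\<lambda>(v, w, g, \<psi>) (u, v', f, \<phi>).
     (u, w, g \<diamondop>\<^bsub>B\<^esub> f, (\<psi> \<star>\<^bsub>B\<^esub> Id2 B f) \<bullet>\<^bsub>B\<^esub> \<phi>))"

definition slice :: "('o, 'f, 't, 'z) two_cat_scheme \<Rightarrow> 'o
    \<Rightarrow> ('f, ('f, 't) slice1, ('f, 't) slice2) two_cat" where
  "slice B X = \<lparr>
     Ob0 = {u \<in> Cell1 B. Trg B u = X},
     Cell1 = slice_Cell1 B X,
     Src = \<lambda>(u, v, f, \<phi>). u,
     Trg = \<lambda>(u, v, f, \<phi>). v,
     Id1 = \<lambda>u. (u, u, Id1 B (Src B u), Id2 B u),
     Cmp1 = slice_Cmp1 B,
     Cell2 = {((u, v, f, \<phi>), (u', v', f', \<phi>'), \<alpha>).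
        (u, v, f, \<phi>) \<in> slice_Cell1 B X \<and> (u', v', f', \<phi>') \<in> slice_Cell1 B X
        \<and> u' = u \<and> v' = v \<and> \<alpha> \<in> cells2 B f f' \<and> (Id2 B v \<star>\<^bsub>B\<^esub> \<alpha>) \<bullet>\<^bsub>B\<^esub> \<phi> = \<phi>'},
     Dom2 = \<lambda>(a, b, \<alpha>). a,
     Cod2 = \<lambda>(a, b, \<alpha>). b,
     Id2 = \<lambda>(u, v, f, \<phi>). ((u, v, f, \<phi>), (u, v, f, \<phi>), Id2 B f),
     VCmp = \<lambda>(a', b', \<beta>) (a, b, \<alpha>). (a, b', \<beta> \<bullet>\<^bsub>B\<^esub> \<alpha>),
     HCmp = \<lambda>(a', b', \<beta>) (a, b, \<alpha>). (slice_Cmp1 B a' a, slice_Cmp1 B b' b, \<beta> \<star>\<^bsub>B\<^esub> \<alpha>)\<rparr>"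

definition slice_push1 :: "('o, 'f, 't, 'z) two_cat_scheme \<Rightarrow> 'f \<Rightarrow> ('f, 't) slice1 \<Rightarrow> ('f, 't) slice1" where
  "slice_push1 B j = (\<lambda>(u, v, f, \<phi>). (j \<diamondop>\<^bsub>B\<^esub> u, j \<diamondop>\<^bsub>B\<^esub> v, f, Id2 B j \<star>\<^bsub>B\<^esub> \<phi>))"

text \<open>The strict 2-functor \<open>D \<rightarrow> B/X \<rightarrow> B/S\<close> given by a strict 2-functor \<open>pr\<close> (applied on
  0-, 1- and 2-cells by \<open>pr0\<close>, \<open>pr1\<close>, \<open>pr2\<close>) followed by composition with \<open>j : X \<rightarrow> S\<close>.
  Only the two projections of \<open>B/X \<times> B/Y\<close> are used below.\<close>

definition slice_push :: "('o, 'f, 't, 'z) two_cat_scheme \<Rightarrow> 'f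
    \<Rightarrow> ('d0 \<Rightarrow> 'f) \<Rightarrow> ('d1 \<Rightarrow> ('f, 't) slice1) \<Rightarrow> ('d2 \<Rightarrow> ('f, 't) slice2)
    \<Rightarrow> ('d0, 'd1, 'd2, 'f, ('f, 't) slice1, ('f, 't) slice2) pseudo" where
  "slice_push B j pr0 pr1 pr2 =
    (let S = slice B (Trg B j);
         F0 = (\<lambda>x. j \<diamondop>\<^bsub>B\<^esub> pr0 x);
         F1 = (\<lambda>a. slice_push1 B j (pr1 a))
     in \<lparr>P0 = F0, P1 = F1,
         P2 = \<lambda>\<alpha>. (case pr2 \<alpha> of (a, b, \<alpha>') \<Rightarrow> (slice_push1 B j a, slice_push1 B j b, \<alpha>')),
         Pc = \<lambda>g f. Id2 S (F1 g \<diamondop>\<^bsub>S\<^esub> F1 f),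
         Pu = \<lambda>x. Id2 S (Id1 S (F0 x))\<rparr>)"

definition slice_underlying :: "('f, 't) slice1 \<Rightarrow> 'f" where
  "slice_underlying = (\<lambda>(u, v, f, \<phi>). f)"

text \<open>\<open>F\<close> is the pseudofunctor \<open>B/X \<times> B/Y \<rightarrow> B/S\<close>, \<open>(u, v) \<mapsto> u \<squnion> v\<close>, where \<open>S = X \<squnion> Y\<close> with
  coprojections \<open>i\<close>, \<open>j\<close>. It is pinned down (uniquely up to equivalence) by its coprojections
  \<open>i u \<rightarrow> u \<squnion> v \<leftarrow> j v\<close> in \<open>B/S\<close>, which are pseudonatural in \<open>(u, v)\<close> and exhibit the source
  of \<open>u \<squnion> v\<close> as a coproduct of the sources of \<open>u\<close> and \<open>v\<close>.\<close>

definition is_coproduct_pseudofunctor :: "('o, 'f, 't, 'z) two_cat_scheme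
    \<Rightarrow> 'o \<Rightarrow> 'o \<Rightarrow> 'o \<Rightarrow> 'f \<Rightarrow> 'f
    \<Rightarrow> ('f \<times> 'f, ('f, 't) slice1 \<times> ('f, 't) slice1, ('f, 't) slice2 \<times> ('f, 't) slice2,
        'f, ('f, 't) slice1, ('f, 't) slice2) pseudo \<Rightarrow> bool" where
  "is_coproduct_pseudofunctor B X Y S i j F \<longleftrightarrow>
    (\<exists>\<sigma> \<tau>. pseudonatural (prod2 (slice B X) (slice B Y)) (slice B S) (slice_push B i fst fst fst) F \<sigma>
      \<and> pseudonatural (prod2 (slice B X) (slice B Y)) (slice B S) (slice_push B j snd snd snd) F \<tau>
      \<and> (\<forall>u v. u \<in> Cell1 B \<and> Trg B u = X \<and> v \<in> Cell1 B \<and> Trg B v = Y \<longrightarrow>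
           is_coproduct2 B (Src B u) (Src B v) (Src B (P0 F (u, v)))
             (slice_underlying (N0 \<sigma> (u, v))) (slice_underlying (N0 \<tau> (u, v)))))"

definition extensive :: "('o, 'f, 't, 'z) two_cat_scheme \<Rightarrow> bool" where
  "extensive B \<longleftrightarrow> has_finite_coproducts B \<and>
    (\<forall>X Y S i j. is_coproduct2 B X Y S i j \<longrightarrow>
      (\<exists>F. is_coproduct_pseudofunctor B X Y S i j F
         \<and> biequivalence (prod2 (slice B X) (slice B Y)) (slice B S) F))"

text \<open>A 2-full 2-subcategory containing all equivalences is given by its set \<open>J\<close> of 1-cells.
  Essential smallness has no counterpart, since all carriers are sets in HOL.\<close>

locale spannable_pair = two_one_category B
  for B :: "('o, 'f, 't, 'z) two_cat_scheme" (structure) +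
  fixes J :: "'f set"
  assumes extensive: "extensive B"
    and J_sub: "J \<subseteq> Cell1 B"
    and J_Cmp1: "f \<in> J \<Longrightarrow> g \<in> J \<Longrightarrow> Trg B f = Src B g \<Longrightarrow> g \<diamondop> f \<in> J"
    and J_equivalence: "equivalence1 B e \<Longrightarrow> e \<in> J"
    and J_iso: "f \<in> J \<Longrightarrow> isomorphic1 B f g \<Longrightarrow> g \<in> J"
    and J_square: "i \<in> J \<Longrightarrow> u \<in> Cell1 B \<Longrightarrow> Trg B u = Trg B i
      \<Longrightarrow> \<exists>p q \<gamma>. mackey_square B i u p q \<gamma> \<and> q \<in> J"
    and J_coproduct: "is_coproduct B n X S inc \<Longrightarrow> (\<And>l. l < n \<Longrightarrow> us l \<in> cells1 B (X l) Y)
      \<Longrightarrow> w \<in> cells1 B S Y \<Longrightarrow> (\<And>l. l < n \<Longrightarrow> isomorphic1 B (w \<diamondop> inc l) (us l))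
      \<Longrightarrow> w \<in> J \<longleftrightarrow> (\<forall>l<n. us l \<in> J)"


section \<open>Additive \<open>k\<close>-linear categories\<close>

record ('k, 'o, 'a) lin_cat = "('o, 'a) cat" +
  HAdd :: "'a \<Rightarrow> 'a \<Rightarrow> 'a"
  HZero :: "'o \<Rightarrow> 'o \<Rightarrow> 'a"
  HScale :: "'k \<Rightarrow> 'a \<Rightarrow> 'a"

definition hom_module :: "('k, 'o, 'a, 'z) lin_cat_scheme \<Rightarrow> 'o \<Rightarrow> 'o \<Rightarrow> ('k, 'a) module" where
  "hom_module C X Y = \<lparr>carrier = arrows C X Y, mult = undefined, one = undefined,
     zero = HZero C X Y, add = HAdd C, smult = HScale C\<rparr>"

locale linear_category = category C + cring k
  for k :: "('k, 'r) ring_scheme" and C :: "('k, 'o, 'a, 'z) lin_cat_scheme" (structure) +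
  assumes hom_is_module: "X \<in> Obj C \<Longrightarrow> Y \<in> Obj C \<Longrightarrow> module k (hom_module C X Y)"
    and Cmp_HAdd_right: "f \<in> arrows C X Y \<Longrightarrow> f' \<in> arrows C X Y \<Longrightarrow> g \<in> arrows C Y Z
      \<Longrightarrow> g \<cdot> HAdd C f f' = HAdd C (g \<cdot> f) (g \<cdot> f')"
    and Cmp_HAdd_left: "f \<in> arrows C X Y \<Longrightarrow> g \<in> arrows C Y Z \<Longrightarrow> g' \<in> arrows C Y Z
      \<Longrightarrow> HAdd C g g' \<cdot> f = HAdd C (g \<cdot> f) (g' \<cdot> f)"
    and Cmp_HScale_right: "r \<in> carrier k \<Longrightarrow> f \<in> arrows C X Y \<Longrightarrow> g \<in> arrows C Y Z
      \<Longrightarrow> g \<cdot> HScale C r f = HScale C r (g \<cdot> f)"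
    and Cmp_HScale_left: "r \<in> carrier k \<Longrightarrow> f \<in> arrows C X Y \<Longrightarrow> g \<in> arrows C Y Z
      \<Longrightarrow> HScale C r g \<cdot> f = HScale C r (g \<cdot> f)"

definition zero_object :: "('o, 'a, 'z) cat_scheme \<Rightarrow> 'o \<Rightarrow> bool" where
  "zero_object C Z \<longleftrightarrow> Z \<in> Obj C
     \<and> (\<forall>X \<in> Obj C. (\<exists>!f. f \<in> arrows C X Z) \<and> (\<exists>!f. f \<in> arrows C Z X))"

definition biproduct ::
    "('k, 'o, 'a, 'z) lin_cat_scheme \<Rightarrow> 'o \<Rightarrow> 'o \<Rightarrow> 'o \<Rightarrow> 'a \<Rightarrow> 'a \<Rightarrow> 'a \<Rightarrow> 'a \<Rightarrow> bool" where
  "biproduct C X Y S i j p q \<longleftrightarrow> S \<in> Obj C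
     \<and> i \<in> arrows C X S \<and> j \<in> arrows C Y S \<and> p \<in> arrows C S X \<and> q \<in> arrows C S Y
     \<and> p \<cdot>\<^bsub>C\<^esub> i = Ide C X \<and> q \<cdot>\<^bsub>C\<^esub> j = Ide C Y \<and> p \<cdot>\<^bsub>C\<^esub> j = HZero C Y X \<and> q \<cdot>\<^bsub>C\<^esub> i = HZero C X Y
     \<and> HAdd C (i \<cdot>\<^bsub>C\<^esub> p) (j \<cdot>\<^bsub>C\<^esub> q) = Ide C S"

locale additive_category = linear_category +
  assumes has_zero_object: "\<exists>Z. zero_object C Z"
    and has_biproducts: "X \<in> Obj C \<Longrightarrow> Y \<in> Obj C \<Longrightarrow> \<exists>S i j p q. biproduct C X Y S i j p q"

definition idempotent_complete :: "('o, 'a, 'z) cat_scheme \<Rightarrow> bool" where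
  "idempotent_complete C \<longleftrightarrow> (\<forall>X \<in> Obj C. \<forall>e \<in> arrows C X X. e \<cdot>\<^bsub>C\<^esub> e = e \<longrightarrow>
     (\<exists>Y \<in> Obj C. \<exists>r \<in> arrows C X Y. \<exists>s \<in> arrows C Y X. s \<cdot>\<^bsub>C\<^esub> r = e \<and> r \<cdot>\<^bsub>C\<^esub> s = Ide C Y))"

locale linear_functor = cat_functor C D F
  for k :: "('k, 'r) ring_scheme" and C :: "('k, 'o, 'a, 'z) lin_cat_scheme"
    and D :: "('k, 'p, 'b, 'w) lin_cat_scheme" and F :: "('o, 'a, 'p, 'b) ftr" +
  assumes FA_HAdd: "f \<in> arrows C X Y \<Longrightarrow> f' \<in> arrows C X Y
      \<Longrightarrow> FA F (HAdd C f f') = HAdd D (FA F f) (FA F f')"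
    and FA_HScale: "r \<in> carrier k \<Longrightarrow> f \<in> arrows C X Y \<Longrightarrow> FA F (HScale C r f) = HScale D r (FA F f)"


section \<open>Mackey 2-functors\<close>

text \<open>The flag \<open>ic\<close> selects the target: additive \<open>k\<close>-linear categories, or the
  idempotent complete ones among them.\<close>

record ('k, 'o, 'f, 't, 'x, 'y) two_functor =
  MC :: "'o \<Rightarrow> ('k, 'x, 'y) lin_cat"
  Pull :: "'f \<Rightarrow> ('x, 'y, 'x, 'y) ftr"
  Pull2 :: "'t \<Rightarrow> 'x \<Rightarrow> 'y"

locale linear_two_functor = two_category B
  for k :: "('k, 'r) ring_scheme" and ic :: bool
    and B :: "('o, 'f, 't, 'z) two_cat_scheme" (structure) +
  fixes M :: "('k, 'o, 'f, 't, 'x, 'y, 'm) two_functor_scheme"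
  assumes MC_additive: "G \<in> Ob0 B \<Longrightarrow> additive_category k (MC M G)"
    and MC_ic: "ic \<Longrightarrow> G \<in> Ob0 B \<Longrightarrow> idempotent_complete (MC M G)"
    and Pull_functor: "u \<in> cells1 B H G \<Longrightarrow> linear_functor k (MC M G) (MC M H) (Pull M u)"
    and Pull_Id1: "G \<in> Ob0 B \<Longrightarrow> ftr_eq (MC M G) (Pull M (Id1 B G)) id_ftr"
    and Pull_Cmp1: "u \<in> cells1 B K H \<Longrightarrow> v \<in> cells1 B H G
      \<Longrightarrow> ftr_eq (MC M G) (Pull M (v \<diamondop> u)) (comp_ftr (Pull M u) (Pull M v))"
    and Pull2_natural: "u \<in> cells1 B H G \<Longrightarrow> \<alpha> \<in> cells2 B u v
      \<Longrightarrow> natural_transformation (MC M G) (MC M H) (Pull M u) (Pull M v) (Pull2 M \<alpha>)"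
    and Pull2_Id2: "u \<in> cells1 B H G \<Longrightarrow> X \<in> Obj (MC M G)
      \<Longrightarrow> Pull2 M (Id2 B u) X = Ide (MC M H) (FO (Pull M u) X)"
    and Pull2_VCmp: "u \<in> cells1 B H G \<Longrightarrow> \<alpha> \<in> cells2 B u v \<Longrightarrow> \<beta> \<in> cells2 B v w \<Longrightarrow> X \<in> Obj (MC M G)
      \<Longrightarrow> Pull2 M (\<beta> \<bullet> \<alpha>) X = Pull2 M \<beta> X \<cdot>\<^bsub>MC M H\<^esub> Pull2 M \<alpha> X"
    and Pull2_HCmp: "u \<in> cells1 B K H \<Longrightarrow> v \<in> cells1 B H G \<Longrightarrow> \<alpha> \<in> cells2 B u u' \<Longrightarrow> \<beta> \<in> cells2 B v v'
      \<Longrightarrow> X \<in> Obj (MC M G)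
      \<Longrightarrow> Pull2 M (\<beta> \<star> \<alpha>) X = Pull2 M \<alpha> (FO (Pull M v') X) \<cdot>\<^bsub>MC M K\<^esub> FA (Pull M u) (Pull2 M \<beta> X)"

text \<open>The chosen adjunctions \<open>i\<^sub>! \<stileturn> i\<^sup>* \<stileturn> i\<^sub>*\<close> for \<open>i\<close> in \<open>J\<close>.\<close>

record ('k, 'o, 'f, 't, 'x, 'y) mackey = "('k, 'o, 'f, 't, 'x, 'y) two_functor" +
  LSh :: "'f \<Rightarrow> ('x, 'y, 'x, 'y) ftr"
  l\<eta> :: "'f \<Rightarrow> 'x \<Rightarrow> 'y"
  l\<epsilon> :: "'f \<Rightarrow> 'x \<Rightarrow> 'y"
  RSt :: "'f \<Rightarrow> ('x, 'y, 'x, 'y) ftr"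
  r\<eta> :: "'f \<Rightarrow> 'x \<Rightarrow> 'y"
  r\<epsilon> :: "'f \<Rightarrow> 'x \<Rightarrow> 'y"

text \<open>The mate \<open>\<gamma>\<^sub>! : q\<^sub>! p\<^sup>* \<Rightarrow> q\<^sub>! p\<^sup>* i\<^sup>* i\<^sub>! \<Rightarrow> q\<^sub>! q\<^sup>* u\<^sup>* i\<^sub>! \<Rightarrow> u\<^sup>* i\<^sub>!\<close> of \<open>\<gamma> : i p \<Rightarrow> u q\<close>, and the mate
  \<open>\<theta>\<^sub>* : u\<^sup>* i\<^sub>* \<Rightarrow> q\<^sub>* q\<^sup>* u\<^sup>* i\<^sub>* \<Rightarrow> q\<^sub>* p\<^sup>* i\<^sup>* i\<^sub>* \<Rightarrow> q\<^sub>* p\<^sup>*\<close> of \<open>\<theta> : u q \<Rightarrow> i p\<close>.\<close>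

definition mate_l :: "('o, 'f, 't, 'z) two_cat_scheme \<Rightarrow> ('k, 'o, 'f, 't, 'x, 'y, 'm) mackey_scheme
    \<Rightarrow> 'f \<Rightarrow> 'f \<Rightarrow> 'f \<Rightarrow> 'f \<Rightarrow> 't \<Rightarrow> 'x \<Rightarrow> 'y" where
  "mate_l B M i u p q \<gamma> X =
    (let K = MC M (Src B u); iX = FO (LSh M i) X
     in l\<epsilon> M q (FO (Pull M u) iX) \<cdot>\<^bsub>K\<^esub> FA (LSh M q) (Pull2 M \<gamma> iX)
          \<cdot>\<^bsub>K\<^esub> FA (LSh M q) (FA (Pull M p) (l\<eta> M i X)))"

definition mate_r :: "('o, 'f, 't, 'z) two_cat_scheme \<Rightarrow> ('k, 'o, 'f, 't, 'x, 'y, 'm) mackey_scheme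
    \<Rightarrow> 'f \<Rightarrow> 'f \<Rightarrow> 'f \<Rightarrow> 'f \<Rightarrow> 't \<Rightarrow> 'x \<Rightarrow> 'y" where
  "mate_r B M i u p q \<theta> X =
    (let K = MC M (Src B u); iX = FO (RSt M i) X
     in FA (RSt M q) (FA (Pull M p) (r\<epsilon> M i X)) \<cdot>\<^bsub>K\<^esub> FA (RSt M q) (Pull2 M \<theta> iX)
          \<cdot>\<^bsub>K\<^esub> r\<eta> M q (FO (Pull M u) iX))"

locale mackey_two_functor = spannable_pair B J + linear_two_functor k ic B M
  for k :: "('k, 'r) ring_scheme" and ic :: bool
    and B :: "('o, 'f, 't, 'z) two_cat_scheme" (structure) and J :: "'f set"
    and M :: "('k, 'o, 'f, 't, 'x, 'y, 'm) mackey_scheme" +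
  assumes additivity: "is_coproduct B n X S inc
      \<Longrightarrow> cat_equivalence (MC M S) (prod_cat n (\<lambda>l. MC M (X l))) (tuple_ftr n (\<lambda>l. Pull M (inc l)))"
    and LSh_linear: "i \<in> J \<Longrightarrow> linear_functor k (MC M (Src B i)) (MC M (Trg B i)) (LSh M i)"
    and RSt_linear: "i \<in> J \<Longrightarrow> linear_functor k (MC M (Src B i)) (MC M (Trg B i)) (RSt M i)"
    and left_adjunction: "i \<in> J
      \<Longrightarrow> adjunction (MC M (Src B i)) (MC M (Trg B i)) (LSh M i) (Pull M i) (l\<eta> M i) (l\<epsilon> M i)"
    and right_adjunction: "i \<in> J
      \<Longrightarrow> adjunction (MC M (Trg B i)) (MC M (Src B i)) (Pull M i) (RSt M i) (r\<eta> M i) (r\<epsilon> M i)"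
    and base_change_left: "mackey_square B i u p q \<gamma> \<Longrightarrow> i \<in> J \<Longrightarrow> q \<in> J
      \<Longrightarrow> natural_isomorphism (MC M (Src B i)) (MC M (Src B u))
            (comp_ftr (LSh M q) (Pull M p)) (comp_ftr (Pull M u) (LSh M i)) (mate_l B M i u p q \<gamma>)"
    and base_change_right: "mackey_square B i u p q \<gamma> \<Longrightarrow> i \<in> J \<Longrightarrow> q \<in> J
      \<Longrightarrow> natural_isomorphism (MC M (Src B i)) (MC M (Src B u))
            (comp_ftr (Pull M u) (RSt M i)) (comp_ftr (RSt M q) (Pull M p))
            (mate_r B M i u p q (inverse2 B \<gamma>))"
    and ambidexterity: "i \<in> J
      \<Longrightarrow> \<exists>\<theta>. natural_isomorphism (MC M (Src B i)) (MC M (Trg B i)) (LSh M i) (RSt M i) \<theta>"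

text \<open>Taking left (right) adjoints makes \<open>i \<mapsto> i\<^sub>!\<close> (\<open>i \<mapsto> i\<^sub>*\<close>) a pseudofunctor on \<open>J\<close>, reversing
  2-cells. A 2-cell \<open>\<alpha> : i \<Rightarrow> j\<close> goes to the mate \<open>j\<^sub>! \<Rightarrow> i\<^sub>!\<close> (\<open>j\<^sub>* \<Rightarrow> i\<^sub>*\<close>) of \<open>\<alpha>\<^sup>* : i\<^sup>* \<Rightarrow> j\<^sup>*\<close>;
  the constraints \<open>i\<^sub>! j\<^sub>! \<Rightarrow> (i j)\<^sub>!\<close> and \<open>i\<^sub>* j\<^sub>* \<Rightarrow> (i j)\<^sub>*\<close> are the mates of \<open>(i j)\<^sup>* = j\<^sup>* i\<^sup>*\<close>;
  the constraints \<open>Id \<Rightarrow> 1\<^sub>!\<close> and \<open>Id \<Rightarrow> 1\<^sub>*\<close> are the units of adjunction, as \<open>1\<^sup>* = Id\<close>.\<close>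

definition shriek2 :: "('o, 'f, 't, 'z) two_cat_scheme \<Rightarrow> ('k, 'o, 'f, 't, 'x, 'y, 'm) mackey_scheme
    \<Rightarrow> 'f \<Rightarrow> 'f \<Rightarrow> 't \<Rightarrow> 'x \<Rightarrow> 'y" where
  "shriek2 B M i j \<alpha> X =
    (let C = MC M (Trg B i); iX = FO (LSh M i) X
     in l\<epsilon> M j iX \<cdot>\<^bsub>C\<^esub> FA (LSh M j) (Pull2 M \<alpha> iX) \<cdot>\<^bsub>C\<^esub> FA (LSh M j) (l\<eta> M i X))"

definition star2 :: "('o, 'f, 't, 'z) two_cat_scheme \<Rightarrow> ('k, 'o, 'f, 't, 'x, 'y, 'm) mackey_scheme
    \<Rightarrow> 'f \<Rightarrow> 'f \<Rightarrow> 't \<Rightarrow> 'x \<Rightarrow> 'y" where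
  "star2 B M i j \<alpha> X =
    (let C = MC M (Trg B i); jX = FO (RSt M j) X
     in FA (RSt M i) (r\<epsilon> M j X) \<cdot>\<^bsub>C\<^esub> FA (RSt M i) (Pull2 M \<alpha> jX) \<cdot>\<^bsub>C\<^esub> r\<eta> M i jX)"

definition shriek_comp :: "('o, 'f, 't, 'z) two_cat_scheme \<Rightarrow> ('k, 'o, 'f, 't, 'x, 'y, 'm) mackey_scheme
    \<Rightarrow> 'f \<Rightarrow> 'f \<Rightarrow> 'x \<Rightarrow> 'y" where
  "shriek_comp B M i j X =
    (let C = MC M (Trg B i); ijX = FO (LSh M (i \<diamondop>\<^bsub>B\<^esub> j)) X
     in l\<epsilon> M i ijX \<cdot>\<^bsub>C\<^esub> FA (LSh M i) (l\<epsilon> M j (FO (Pull M i) ijX))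
          \<cdot>\<^bsub>C\<^esub> FA (LSh M i) (FA (LSh M j) (l\<eta> M (i \<diamondop>\<^bsub>B\<^esub> j) X)))"

definition star_comp :: "('o, 'f, 't, 'z) two_cat_scheme \<Rightarrow> ('k, 'o, 'f, 't, 'x, 'y, 'm) mackey_scheme
    \<Rightarrow> 'f \<Rightarrow> 'f \<Rightarrow> 'x \<Rightarrow> 'y" where
  "star_comp B M i j X =
    (let C = MC M (Trg B i); ijX = FO (RSt M i) (FO (RSt M j) X)
     in FA (RSt M (i \<diamondop>\<^bsub>B\<^esub> j)) (r\<epsilon> M j X)
          \<cdot>\<^bsub>C\<^esub> FA (RSt M (i \<diamondop>\<^bsub>B\<^esub> j)) (FA (Pull M j) (r\<epsilon> M i (FO (RSt M j) X)))
          \<cdot>\<^bsub>C\<^esub> r\<eta> M (i \<diamondop>\<^bsub>B\<^esub> j) ijX)"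

locale rectified_mackey_two_functor = mackey_two_functor +
  assumes LSh_eq_RSt: "i \<in> J \<Longrightarrow> ftr_eq (MC M (Src B i)) (LSh M i) (RSt M i)"
    and shriek2_eq_star2: "i \<in> J \<Longrightarrow> j \<in> J \<Longrightarrow> \<alpha> \<in> cells2 B i j \<Longrightarrow> X \<in> Obj (MC M (Src B i))
      \<Longrightarrow> shriek2 B M i j \<alpha> X = star2 B M i j \<alpha> X"
    and shriek_comp_eq_star_comp: "i \<in> J \<Longrightarrow> j \<in> J \<Longrightarrow> Trg B j = Src B i \<Longrightarrow> X \<in> Obj (MC M (Src B j))
      \<Longrightarrow> shriek_comp B M i j X = star_comp B M i j X"
    and shriek_unit_eq_star_unit: "G \<in> Ob0 B \<Longrightarrow> X \<in> Obj (MC M G)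
      \<Longrightarrow> l\<eta> M (Id1 B G) X = r\<eta> M (Id1 B G) X"
    and strict_mackey_formula: "mackey_square B i u p q \<gamma> \<Longrightarrow> i \<in> J \<Longrightarrow> q \<in> J
      \<Longrightarrow> X \<in> Obj (MC M (Src B i))
      \<Longrightarrow> inverse_arrows (MC M (Src B u)) (mate_l B M i u p q \<gamma> X) (mate_r B M i u p q (inverse2 B \<gamma>) X)"
    and special_adjunctions: "i \<in> J \<Longrightarrow> X \<in> Obj (MC M (Src B i))
      \<Longrightarrow> r\<epsilon> M i X \<cdot>\<^bsub>MC M (Src B i)\<^esub> l\<eta> M i X = Ide (MC M (Src B i)) X"


section \<open>Monoidal categories\<close>

record ('x, 'y) monoidal =
  TO :: "'x \<Rightarrow> 'x \<Rightarrow> 'x"  (infixr "\<otimes>\<^sub>o\<index>" 75)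
  TA :: "'y \<Rightarrow> 'y \<Rightarrow> 'y"  (infixr "\<otimes>\<^sub>a\<index>" 75)
  Unit :: "'x"
  Asc :: "'x \<Rightarrow> 'x \<Rightarrow> 'x \<Rightarrow> 'y"  \<comment> \<open>\<open>(X \<otimes> Y) \<otimes> Z \<rightarrow> X \<otimes> (Y \<otimes> Z)\<close>\<close>
  Lun :: "'x \<Rightarrow> 'y"  \<comment> \<open>\<open>1 \<otimes> X \<rightarrow> X\<close>\<close>
  Run :: "'x \<Rightarrow> 'y"  \<comment> \<open>\<open>X \<otimes> 1 \<rightarrow> X\<close>\<close>

locale monoidal_category = category C
  for C :: "('x, 'y, 'z) cat_scheme" +
  fixes T :: "('x, 'y) monoidal"
  assumes TO_closed: "X \<in> Obj C \<Longrightarrow> Y \<in> Obj C \<Longrightarrow> X \<otimes>\<^sub>o\<^bsub>T\<^esub> Y \<in> Obj C"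
    and TA_closed: "f \<in> arrows C X X' \<Longrightarrow> g \<in> arrows C Y Y'
      \<Longrightarrow> f \<otimes>\<^sub>a\<^bsub>T\<^esub> g \<in> arrows C (X \<otimes>\<^sub>o\<^bsub>T\<^esub> Y) (X' \<otimes>\<^sub>o\<^bsub>T\<^esub> Y')"
    and TA_Ide: "X \<in> Obj C \<Longrightarrow> Y \<in> Obj C \<Longrightarrow> Ide C X \<otimes>\<^sub>a\<^bsub>T\<^esub> Ide C Y = Ide C (X \<otimes>\<^sub>o\<^bsub>T\<^esub> Y)"
    and TA_Cmp: "f \<in> arrows C X X' \<Longrightarrow> f' \<in> arrows C X' X'' \<Longrightarrow> g \<in> arrows C Y Y' \<Longrightarrow> g' \<in> arrows C Y' Y''
      \<Longrightarrow> (f' \<cdot>\<^bsub>C\<^esub> f) \<otimes>\<^sub>a\<^bsub>T\<^esub> (g' \<cdot>\<^bsub>C\<^esub> g) = (f' \<otimes>\<^sub>a\<^bsub>T\<^esub> g') \<cdot>\<^bsub>C\<^esub> (f \<otimes>\<^sub>a\<^bsub>T\<^esub> g)"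
    and Unit_closed: "Unit T \<in> Obj C"
    and Asc_closed: "X \<in> Obj C \<Longrightarrow> Y \<in> Obj C \<Longrightarrow> Z \<in> Obj C
      \<Longrightarrow> Asc T X Y Z \<in> arrows C ((X \<otimes>\<^sub>o\<^bsub>T\<^esub> Y) \<otimes>\<^sub>o\<^bsub>T\<^esub> Z) (X \<otimes>\<^sub>o\<^bsub>T\<^esub> (Y \<otimes>\<^sub>o\<^bsub>T\<^esub> Z)) \<and> iso_arrow C (Asc T X Y Z)"
    and Lun_closed: "X \<in> Obj C \<Longrightarrow> Lun T X \<in> arrows C (Unit T \<otimes>\<^sub>o\<^bsub>T\<^esub> X) X \<and> iso_arrow C (Lun T X)"
    and Run_closed: "X \<in> Obj C \<Longrightarrow> Run T X \<in> arrows C (X \<otimes>\<^sub>o\<^bsub>T\<^esub> Unit T) X \<and> iso_arrow C (Run T X)"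
    and Asc_natural: "f \<in> arrows C X X' \<Longrightarrow> g \<in> arrows C Y Y' \<Longrightarrow> h \<in> arrows C Z Z'
      \<Longrightarrow> Asc T X' Y' Z' \<cdot>\<^bsub>C\<^esub> ((f \<otimes>\<^sub>a\<^bsub>T\<^esub> g) \<otimes>\<^sub>a\<^bsub>T\<^esub> h) = (f \<otimes>\<^sub>a\<^bsub>T\<^esub> (g \<otimes>\<^sub>a\<^bsub>T\<^esub> h)) \<cdot>\<^bsub>C\<^esub> Asc T X Y Z"
    and Lun_natural: "f \<in> arrows C X X' \<Longrightarrow> Lun T X' \<cdot>\<^bsub>C\<^esub> (Ide C (Unit T) \<otimes>\<^sub>a\<^bsub>T\<^esub> f) = f \<cdot>\<^bsub>C\<^esub> Lun T X"
    and Run_natural: "f \<in> arrows C X X' \<Longrightarrow> Run T X' \<cdot>\<^bsub>C\<^esub> (f \<otimes>\<^sub>a\<^bsub>T\<^esub> Ide C (Unit T)) = f \<cdot>\<^bsub>C\<^esub> Run T X"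
    and pentagon: "W \<in> Obj C \<Longrightarrow> X \<in> Obj C \<Longrightarrow> Y \<in> Obj C \<Longrightarrow> Z \<in> Obj C
      \<Longrightarrow> Asc T W X (Y \<otimes>\<^sub>o\<^bsub>T\<^esub> Z) \<cdot>\<^bsub>C\<^esub> Asc T (W \<otimes>\<^sub>o\<^bsub>T\<^esub> X) Y Z
        = (Ide C W \<otimes>\<^sub>a\<^bsub>T\<^esub> Asc T X Y Z) \<cdot>\<^bsub>C\<^esub> Asc T W (X \<otimes>\<^sub>o\<^bsub>T\<^esub> Y) Z \<cdot>\<^bsub>C\<^esub> (Asc T W X Y \<otimes>\<^sub>a\<^bsub>T\<^esub> Ide C Z)"
    and triangle: "X \<in> Obj C \<Longrightarrow> Y \<in> Obj C
      \<Longrightarrow> (Ide C X \<otimes>\<^sub>a\<^bsub>T\<^esub> Lun T Y) \<cdot>\<^bsub>C\<^esub> Asc T X (Unit T) Y = Run T X \<otimes>\<^sub>a\<^bsub>T\<^esub> Ide C Y"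

locale linear_monoidal_category = linear_category k C + monoidal_category C T
  for k :: "('k, 'r) ring_scheme" and C :: "('k, 'x, 'y, 'z) lin_cat_scheme"
    and T :: "('x, 'y) monoidal" +
  assumes TA_HAdd_left: "f \<in> arrows C X X' \<Longrightarrow> f' \<in> arrows C X X' \<Longrightarrow> g \<in> arrows C Y Y'
      \<Longrightarrow> HAdd C f f' \<otimes>\<^sub>a\<^bsub>T\<^esub> g = HAdd C (f \<otimes>\<^sub>a\<^bsub>T\<^esub> g) (f' \<otimes>\<^sub>a\<^bsub>T\<^esub> g)"
    and TA_HAdd_right: "f \<in> arrows C X X' \<Longrightarrow> g \<in> arrows C Y Y' \<Longrightarrow> g' \<in> arrows C Y Y'
      \<Longrightarrow> f \<otimes>\<^sub>a\<^bsub>T\<^esub> HAdd C g g' = HAdd C (f \<otimes>\<^sub>a\<^bsub>T\<^esub> g) (f \<otimes>\<^sub>a\<^bsub>T\<^esub> g')"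
    and TA_HScale_left: "r \<in> carrier k \<Longrightarrow> f \<in> arrows C X X' \<Longrightarrow> g \<in> arrows C Y Y'
      \<Longrightarrow> HScale C r f \<otimes>\<^sub>a\<^bsub>T\<^esub> g = HScale C r (f \<otimes>\<^sub>a\<^bsub>T\<^esub> g)"
    and TA_HScale_right: "r \<in> carrier k \<Longrightarrow> f \<in> arrows C X X' \<Longrightarrow> g \<in> arrows C Y Y'
      \<Longrightarrow> f \<otimes>\<^sub>a\<^bsub>T\<^esub> HScale C r g = HScale C r (f \<otimes>\<^sub>a\<^bsub>T\<^esub> g)"

text \<open>Strong monoidal functors, with constraints \<open>\<Phi> X Y : F (X \<otimes> Y) \<rightarrow> F X \<otimes> F Y\<close> and
  \<open>\<Phi>1 : F 1 \<rightarrow> 1\<close> pointing out of \<open>F\<close>.\<close>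

locale strong_monoidal_functor = cat_functor C D F + C: monoidal_category C T + D: monoidal_category D U
  for C :: "('x, 'y, 'z) cat_scheme" and T :: "('x, 'y) monoidal"
    and D :: "('p, 'b, 'w) cat_scheme" and U :: "('p, 'b) monoidal"
    and F :: "('x, 'y, 'p, 'b) ftr" +
  fixes \<Phi> :: "'x \<Rightarrow> 'x \<Rightarrow> 'b" and \<Phi>1 :: "'b"
  assumes \<Phi>_closed: "X \<in> Obj C \<Longrightarrow> Y \<in> Obj C
      \<Longrightarrow> \<Phi> X Y \<in> arrows D (FO F (X \<otimes>\<^sub>o\<^bsub>T\<^esub> Y)) (FO F X \<otimes>\<^sub>o\<^bsub>U\<^esub> FO F Y) \<and> iso_arrow D (\<Phi> X Y)"
    and \<Phi>1_closed: "\<Phi>1 \<in> arrows D (FO F (Unit T)) (Unit U) \<and> iso_arrow D \<Phi>1"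
    and \<Phi>_natural: "f \<in> arrows C X X' \<Longrightarrow> g \<in> arrows C Y Y'
      \<Longrightarrow> \<Phi> X' Y' \<cdot>\<^bsub>D\<^esub> FA F (f \<otimes>\<^sub>a\<^bsub>T\<^esub> g) = (FA F f \<otimes>\<^sub>a\<^bsub>U\<^esub> FA F g) \<cdot>\<^bsub>D\<^esub> \<Phi> X Y"
    and \<Phi>_assoc: "X \<in> Obj C \<Longrightarrow> Y \<in> Obj C \<Longrightarrow> Z \<in> Obj C
      \<Longrightarrow> Asc U (FO F X) (FO F Y) (FO F Z) \<cdot>\<^bsub>D\<^esub> (\<Phi> X Y \<otimes>\<^sub>a\<^bsub>U\<^esub> Ide D (FO F Z)) \<cdot>\<^bsub>D\<^esub> \<Phi> (X \<otimes>\<^sub>o\<^bsub>T\<^esub> Y) Z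
        = (Ide D (FO F X) \<otimes>\<^sub>a\<^bsub>U\<^esub> \<Phi> Y Z) \<cdot>\<^bsub>D\<^esub> \<Phi> X (Y \<otimes>\<^sub>o\<^bsub>T\<^esub> Z) \<cdot>\<^bsub>D\<^esub> FA F (Asc T X Y Z)"
    and \<Phi>_unit_left: "X \<in> Obj C
      \<Longrightarrow> Lun U (FO F X) \<cdot>\<^bsub>D\<^esub> (\<Phi>1 \<otimes>\<^sub>a\<^bsub>U\<^esub> Ide D (FO F X)) \<cdot>\<^bsub>D\<^esub> \<Phi> (Unit T) X = FA F (Lun T X)"
    and \<Phi>_unit_right: "X \<in> Obj C
      \<Longrightarrow> Run U (FO F X) \<cdot>\<^bsub>D\<^esub> (Ide D (FO F X) \<otimes>\<^sub>a\<^bsub>U\<^esub> \<Phi>1) \<cdot>\<^bsub>D\<^esub> \<Phi> X (Unit T) = FA F (Run T X)"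

locale braided_monoidal_category = monoidal_category C T
  for C :: "('x, 'y, 'z) cat_scheme" and T :: "('x, 'y) monoidal" +
  fixes \<beta> :: "'x \<Rightarrow> 'x \<Rightarrow> 'y"
  assumes \<beta>_closed: "X \<in> Obj C \<Longrightarrow> Y \<in> Obj C
      \<Longrightarrow> \<beta> X Y \<in> arrows C (X \<otimes>\<^sub>o\<^bsub>T\<^esub> Y) (Y \<otimes>\<^sub>o\<^bsub>T\<^esub> X) \<and> iso_arrow C (\<beta> X Y)"
    and \<beta>_natural: "f \<in> arrows C X X' \<Longrightarrow> g \<in> arrows C Y Y'
      \<Longrightarrow> \<beta> X' Y' \<cdot>\<^bsub>C\<^esub> (f \<otimes>\<^sub>a\<^bsub>T\<^esub> g) = (g \<otimes>\<^sub>a\<^bsub>T\<^esub> f) \<cdot>\<^bsub>C\<^esub> \<beta> X Y"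
    and hexagon1: "X \<in> Obj C \<Longrightarrow> Y \<in> Obj C \<Longrightarrow> Z \<in> Obj C
      \<Longrightarrow> Asc T Y Z X \<cdot>\<^bsub>C\<^esub> \<beta> X (Y \<otimes>\<^sub>o\<^bsub>T\<^esub> Z) \<cdot>\<^bsub>C\<^esub> Asc T X Y Z
        = (Ide C Y \<otimes>\<^sub>a\<^bsub>T\<^esub> \<beta> X Z) \<cdot>\<^bsub>C\<^esub> Asc T Y X Z \<cdot>\<^bsub>C\<^esub> (\<beta> X Y \<otimes>\<^sub>a\<^bsub>T\<^esub> Ide C Z)"
    and hexagon2: "X \<in> Obj C \<Longrightarrow> Y \<in> Obj C \<Longrightarrow> Z \<in> Obj C
      \<Longrightarrow> inv_arr C (Asc T Z X Y) \<cdot>\<^bsub>C\<^esub> \<beta> (X \<otimes>\<^sub>o\<^bsub>T\<^esub> Y) Z \<cdot>\<^bsub>C\<^esub> inv_arr C (Asc T X Y Z)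
        = (\<beta> X Z \<otimes>\<^sub>a\<^bsub>T\<^esub> Ide C Y) \<cdot>\<^bsub>C\<^esub> inv_arr C (Asc T X Z Y) \<cdot>\<^bsub>C\<^esub> (Ide C X \<otimes>\<^sub>a\<^bsub>T\<^esub> \<beta> Y Z)"

locale monoid_object = monoidal_category C T
  for C :: "('x, 'y, 'z) cat_scheme" and T :: "('x, 'y) monoidal" +
  fixes A :: 'x and \<mu> \<iota> :: 'y
  assumes A_closed: "A \<in> Obj C"
    and \<mu>_closed: "\<mu> \<in> arrows C (A \<otimes>\<^sub>o\<^bsub>T\<^esub> A) A"
    and \<iota>_closed: "\<iota> \<in> arrows C (Unit T) A"
    and \<mu>_assoc: "\<mu> \<cdot>\<^bsub>C\<^esub> (\<mu> \<otimes>\<^sub>a\<^bsub>T\<^esub> Ide C A) = \<mu> \<cdot>\<^bsub>C\<^esub> (Ide C A \<otimes>\<^sub>a\<^bsub>T\<^esub> \<mu>) \<cdot>\<^bsub>C\<^esub> Asc T A A A"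
    and \<mu>_unit_left: "\<mu> \<cdot>\<^bsub>C\<^esub> (\<iota> \<otimes>\<^sub>a\<^bsub>T\<^esub> Ide C A) = Lun T A"
    and \<mu>_unit_right: "\<mu> \<cdot>\<^bsub>C\<^esub> (Ide C A \<otimes>\<^sub>a\<^bsub>T\<^esub> \<iota>) = Run T A"

locale comonoid_object = monoidal_category C T
  for C :: "('x, 'y, 'z) cat_scheme" and T :: "('x, 'y) monoidal" +
  fixes A :: 'x and \<delta> \<epsilon> :: 'y
  assumes A_closed: "A \<in> Obj C"
    and \<delta>_closed: "\<delta> \<in> arrows C A (A \<otimes>\<^sub>o\<^bsub>T\<^esub> A)"
    and \<epsilon>_closed: "\<epsilon> \<in> arrows C A (Unit T)"
    and \<delta>_assoc: "Asc T A A A \<cdot>\<^bsub>C\<^esub> (\<delta> \<otimes>\<^sub>a\<^bsub>T\<^esub> Ide C A) \<cdot>\<^bsub>C\<^esub> \<delta> = (Ide C A \<otimes>\<^sub>a\<^bsub>T\<^esub> \<delta>) \<cdot>\<^bsub>C\<^esub> \<delta>"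
    and \<delta>_counit_left: "Lun T A \<cdot>\<^bsub>C\<^esub> (\<epsilon> \<otimes>\<^sub>a\<^bsub>T\<^esub> Ide C A) \<cdot>\<^bsub>C\<^esub> \<delta> = Ide C A"
    and \<delta>_counit_right: "Run T A \<cdot>\<^bsub>C\<^esub> (Ide C A \<otimes>\<^sub>a\<^bsub>T\<^esub> \<epsilon>) \<cdot>\<^bsub>C\<^esub> \<delta> = Ide C A"

locale frobenius_object = monoid_object C T A \<mu> \<iota> + comonoid_object C T A \<delta> \<epsilon>
  for C :: "('x, 'y, 'z) cat_scheme" and T :: "('x, 'y) monoidal"
    and A :: 'x and \<mu> \<iota> \<delta> \<epsilon> :: 'y +
  assumes frobenius_left: "(Ide C A \<otimes>\<^sub>a\<^bsub>T\<^esub> \<mu>) \<cdot>\<^bsub>C\<^esub> Asc T A A A \<cdot>\<^bsub>C\<^esub> (\<delta> \<otimes>\<^sub>a\<^bsub>T\<^esub> Ide C A) = \<delta> \<cdot>\<^bsub>C\<^esub> \<mu>"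
    and frobenius_right:
      "\<delta> \<cdot>\<^bsub>C\<^esub> \<mu> = (\<mu> \<otimes>\<^sub>a\<^bsub>T\<^esub> Ide C A) \<cdot>\<^bsub>C\<^esub> inv_arr C (Asc T A A A) \<cdot>\<^bsub>C\<^esub> (Ide C A \<otimes>\<^sub>a\<^bsub>T\<^esub> \<delta>)"

locale special_frobenius_object = frobenius_object +
  assumes special: "\<mu> \<cdot>\<^bsub>C\<^esub> \<delta> = Ide C A"

definition left_linear ::
    "('x, 'y, 'z) cat_scheme \<Rightarrow> ('x, 'y) monoidal \<Rightarrow> 'x \<Rightarrow> 'y \<Rightarrow> 'y \<Rightarrow> 'y \<Rightarrow> bool" where
  "left_linear C T A act act' s \<longleftrightarrow> s \<cdot>\<^bsub>C\<^esub> act = act' \<cdot>\<^bsub>C\<^esub> (Ide C A \<otimes>\<^sub>a\<^bsub>T\<^esub> s)"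

definition right_linear ::
    "('x, 'y, 'z) cat_scheme \<Rightarrow> ('x, 'y) monoidal \<Rightarrow> 'x \<Rightarrow> 'y \<Rightarrow> 'y \<Rightarrow> 'y \<Rightarrow> bool" where
  "right_linear C T A act act' s \<longleftrightarrow> s \<cdot>\<^bsub>C\<^esub> act = act' \<cdot>\<^bsub>C\<^esub> (s \<otimes>\<^sub>a\<^bsub>T\<^esub> Ide C A)"

text \<open>\<open>A\<close> and \<open>A \<otimes> A\<close> are \<open>A\<close>-bimodules by multiplication on the outer factors.\<close>

definition separable_monoid ::
    "('x, 'y, 'z) cat_scheme \<Rightarrow> ('x, 'y) monoidal \<Rightarrow> 'x \<Rightarrow> 'y \<Rightarrow> 'y \<Rightarrow> bool" where
  "separable_monoid C T A \<mu> \<iota> \<longleftrightarrow> monoid_object C T A \<mu> \<iota> \<and>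
    (\<exists>\<sigma> \<in> arrows C A (A \<otimes>\<^sub>o\<^bsub>T\<^esub> A). \<mu> \<cdot>\<^bsub>C\<^esub> \<sigma> = Ide C A
       \<and> left_linear C T A \<mu> ((\<mu> \<otimes>\<^sub>a\<^bsub>T\<^esub> Ide C A) \<cdot>\<^bsub>C\<^esub> inv_arr C (Asc T A A A)) \<sigma>
       \<and> right_linear C T A \<mu> ((Ide C A \<otimes>\<^sub>a\<^bsub>T\<^esub> \<mu>) \<cdot>\<^bsub>C\<^esub> Asc T A A A) \<sigma>)"

definition commutative_monoid ::
    "('x, 'y, 'z) cat_scheme \<Rightarrow> ('x, 'y) monoidal \<Rightarrow> ('x \<Rightarrow> 'x \<Rightarrow> 'y) \<Rightarrow> 'x \<Rightarrow> 'y \<Rightarrow> 'y \<Rightarrow> bool" where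
  "commutative_monoid C T \<beta> A \<mu> \<iota> \<longleftrightarrow> monoid_object C T A \<mu> \<iota> \<and> \<mu> \<cdot>\<^bsub>C\<^esub> \<beta> A A = \<mu>"


section \<open>Green 2-functors\<close>

record ('k, 'o, 'f, 't, 'x, 'y) green = "('k, 'o, 'f, 't, 'x, 'y) mackey" +
  Mon :: "'o \<Rightarrow> ('x, 'y) monoidal"
  PullT :: "'f \<Rightarrow> 'x \<Rightarrow> 'x \<Rightarrow> 'y"  \<comment> \<open>\<open>u\<^sup>* (X \<otimes> Y) \<rightarrow> u\<^sup>* X \<otimes> u\<^sup>* Y\<close>\<close>
  PullU :: "'f \<Rightarrow> 'y"  \<comment> \<open>\<open>u\<^sup>* 1 \<rightarrow> 1\<close>\<close>

definition Rp1 :: "('o, 'f, 't, 'z) two_cat_scheme \<Rightarrow> ('k, 'o, 'f, 't, 'x, 'y, 'm) green_scheme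
    \<Rightarrow> 'f \<Rightarrow> 'x \<Rightarrow> 'x \<Rightarrow> 'y" where
  "Rp1 B M i X Y =
    (let C = MC M (Trg B i); D = MC M (Src B i); iY = FO (RSt M i) Y
     in FA (RSt M i) (Ide D (FO (Pull M i) X) \<otimes>\<^sub>a\<^bsub>Mon M (Src B i)\<^esub> r\<epsilon> M i Y)
          \<cdot>\<^bsub>C\<^esub> FA (RSt M i) (PullT M i X iY)
          \<cdot>\<^bsub>C\<^esub> r\<eta> M i (X \<otimes>\<^sub>o\<^bsub>Mon M (Trg B i)\<^esub> iY))"

definition Rp2 :: "('o, 'f, 't, 'z) two_cat_scheme \<Rightarrow> ('k, 'o, 'f, 't, 'x, 'y, 'm) green_scheme
    \<Rightarrow> 'f \<Rightarrow> 'x \<Rightarrow> 'x \<Rightarrow> 'y" where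
  "Rp2 B M i Y X =
    (let C = MC M (Trg B i); D = MC M (Src B i); iY = FO (RSt M i) Y
     in FA (RSt M i) (r\<epsilon> M i Y \<otimes>\<^sub>a\<^bsub>Mon M (Src B i)\<^esub> Ide D (FO (Pull M i) X))
          \<cdot>\<^bsub>C\<^esub> FA (RSt M i) (PullT M i iY X)
          \<cdot>\<^bsub>C\<^esub> r\<eta> M i (iY \<otimes>\<^sub>o\<^bsub>Mon M (Trg B i)\<^esub> X))"

definition Lp1 :: "('o, 'f, 't, 'z) two_cat_scheme \<Rightarrow> ('k, 'o, 'f, 't, 'x, 'y, 'm) green_scheme
    \<Rightarrow> 'f \<Rightarrow> 'x \<Rightarrow> 'x \<Rightarrow> 'y" where
  "Lp1 B M i X Y =
    (let C = MC M (Trg B i); D = MC M (Src B i); iY = FO (LSh M i) Y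
     in l\<epsilon> M i (X \<otimes>\<^sub>o\<^bsub>Mon M (Trg B i)\<^esub> iY)
          \<cdot>\<^bsub>C\<^esub> FA (LSh M i) (inv_arr D (PullT M i X iY))
          \<cdot>\<^bsub>C\<^esub> FA (LSh M i) (Ide D (FO (Pull M i) X) \<otimes>\<^sub>a\<^bsub>Mon M (Src B i)\<^esub> l\<eta> M i Y))"

definition Lp2 :: "('o, 'f, 't, 'z) two_cat_scheme \<Rightarrow> ('k, 'o, 'f, 't, 'x, 'y, 'm) green_scheme
    \<Rightarrow> 'f \<Rightarrow> 'x \<Rightarrow> 'x \<Rightarrow> 'y" where
  "Lp2 B M i Y X =
    (let C = MC M (Trg B i); D = MC M (Src B i); iY = FO (LSh M i) Y
     in l\<epsilon> M i (iY \<otimes>\<^sub>o\<^bsub>Mon M (Trg B i)\<^esub> X)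
          \<cdot>\<^bsub>C\<^esub> FA (LSh M i) (inv_arr D (PullT M i iY X))
          \<cdot>\<^bsub>C\<^esub> FA (LSh M i) (l\<eta> M i Y \<otimes>\<^sub>a\<^bsub>Mon M (Src B i)\<^esub> Ide D (FO (Pull M i) X)))"

locale green_two_functor = rectified_mackey_two_functor k ic B J M
  for k :: "('k, 'r) ring_scheme" and ic :: bool
    and B :: "('o, 'f, 't, 'z) two_cat_scheme" (structure) and J :: "'f set"
    and M :: "('k, 'o, 'f, 't, 'x, 'y, 'm) green_scheme" +
  assumes Mon_monoidal: "G \<in> Ob0 B \<Longrightarrow> linear_monoidal_category k (MC M G) (Mon M G)"
    and Pull_monoidal: "u \<in> cells1 B H G
      \<Longrightarrow> strong_monoidal_functor (MC M G) (Mon M G) (MC M H) (Mon M H) (Pull M u) (PullT M u) (PullU M u)"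
    and PullT_Id1: "G \<in> Ob0 B \<Longrightarrow> X \<in> Obj (MC M G) \<Longrightarrow> Y \<in> Obj (MC M G)
      \<Longrightarrow> PullT M (Id1 B G) X Y = Ide (MC M G) (X \<otimes>\<^sub>o\<^bsub>Mon M G\<^esub> Y)"
    and PullU_Id1: "G \<in> Ob0 B \<Longrightarrow> PullU M (Id1 B G) = Ide (MC M G) (Unit (Mon M G))"
    and PullT_Cmp1: "u \<in> cells1 B K H \<Longrightarrow> v \<in> cells1 B H G \<Longrightarrow> X \<in> Obj (MC M G) \<Longrightarrow> Y \<in> Obj (MC M G)
      \<Longrightarrow> PullT M (v \<diamondop> u) X Y
        = PullT M u (FO (Pull M v) X) (FO (Pull M v) Y) \<cdot>\<^bsub>MC M K\<^esub> FA (Pull M u) (PullT M v X Y)"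
    and PullU_Cmp1: "u \<in> cells1 B K H \<Longrightarrow> v \<in> cells1 B H G
      \<Longrightarrow> PullU M (v \<diamondop> u) = PullU M u \<cdot>\<^bsub>MC M K\<^esub> FA (Pull M u) (PullU M v)"
    and Pull2_monoidal: "u \<in> cells1 B H G \<Longrightarrow> \<alpha> \<in> cells2 B u v \<Longrightarrow> X \<in> Obj (MC M G) \<Longrightarrow> Y \<in> Obj (MC M G)
      \<Longrightarrow> PullT M v X Y \<cdot>\<^bsub>MC M H\<^esub> Pull2 M \<alpha> (X \<otimes>\<^sub>o\<^bsub>Mon M G\<^esub> Y)
        = (Pull2 M \<alpha> X \<otimes>\<^sub>a\<^bsub>Mon M H\<^esub> Pull2 M \<alpha> Y) \<cdot>\<^bsub>MC M H\<^esub> PullT M u X Y"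
    and Pull2_monoidal_unit: "u \<in> cells1 B H G \<Longrightarrow> \<alpha> \<in> cells2 B u v
      \<Longrightarrow> PullU M v \<cdot>\<^bsub>MC M H\<^esub> Pull2 M \<alpha> (Unit (Mon M G)) = PullU M u"
    and projection1: "i \<in> J \<Longrightarrow> X \<in> Obj (MC M (Trg B i)) \<Longrightarrow> Y \<in> Obj (MC M (Src B i))
      \<Longrightarrow> inverse_arrows (MC M (Trg B i)) (Rp1 B M i X Y) (Lp1 B M i X Y)"
    and projection2: "i \<in> J \<Longrightarrow> X \<in> Obj (MC M (Trg B i)) \<Longrightarrow> Y \<in> Obj (MC M (Src B i))
      \<Longrightarrow> inverse_arrows (MC M (Trg B i)) (Rp2 B M i Y X) (Lp2 B M i Y X)"

locale braided_green_two_functor = green_two_functor k ic B J M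
  for k :: "('k, 'r) ring_scheme" and ic :: bool
    and B :: "('o, 'f, 't, 'z) two_cat_scheme" (structure) and J :: "'f set"
    and M :: "('k, 'o, 'f, 't, 'x, 'y, 'm) green_scheme" +
  fixes \<beta> :: "'o \<Rightarrow> 'x \<Rightarrow> 'x \<Rightarrow> 'y"
  assumes Mon_braided: "G \<in> Ob0 B \<Longrightarrow> braided_monoidal_category (MC M G) (Mon M G) (\<beta> G)"
    and Pull_braided: "u \<in> cells1 B H G \<Longrightarrow> X \<in> Obj (MC M G) \<Longrightarrow> Y \<in> Obj (MC M G)
      \<Longrightarrow> \<beta> H (FO (Pull M u) X) (FO (Pull M u) Y) \<cdot>\<^bsub>MC M H\<^esub> PullT M u X Y
        = PullT M u Y X \<cdot>\<^bsub>MC M H\<^esub> FA (Pull M u) (\<beta> G X Y)"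

text \<open>The lax structure of \<open>i\<^sub>*\<close> and the colax structure of \<open>i\<^sub>!\<close>.\<close>

definition star_lax :: "('o, 'f, 't, 'z) two_cat_scheme \<Rightarrow> ('k, 'o, 'f, 't, 'x, 'y, 'm) green_scheme
    \<Rightarrow> 'f \<Rightarrow> 'x \<Rightarrow> 'x \<Rightarrow> 'y" where
  "star_lax B M i X Y =
    (let C = MC M (Trg B i); iX = FO (RSt M i) X; iY = FO (RSt M i) Y
     in FA (RSt M i) (r\<epsilon> M i X \<otimes>\<^sub>a\<^bsub>Mon M (Src B i)\<^esub> r\<epsilon> M i Y)
          \<cdot>\<^bsub>C\<^esub> FA (RSt M i) (PullT M i iX iY)
          \<cdot>\<^bsub>C\<^esub> r\<eta> M i (iX \<otimes>\<^sub>o\<^bsub>Mon M (Trg B i)\<^esub> iY))"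

definition shriek_colax :: "('o, 'f, 't, 'z) two_cat_scheme \<Rightarrow> ('k, 'o, 'f, 't, 'x, 'y, 'm) green_scheme
    \<Rightarrow> 'f \<Rightarrow> 'x \<Rightarrow> 'x \<Rightarrow> 'y" where
  "shriek_colax B M i X Y =
    (let C = MC M (Trg B i); iX = FO (LSh M i) X; iY = FO (LSh M i) Y
     in l\<epsilon> M i (iX \<otimes>\<^sub>o\<^bsub>Mon M (Trg B i)\<^esub> iY)
          \<cdot>\<^bsub>C\<^esub> FA (LSh M i) (inv_arr (MC M (Src B i)) (PullT M i iX iY))
          \<cdot>\<^bsub>C\<^esub> FA (LSh M i) (l\<eta> M i X \<otimes>\<^sub>a\<^bsub>Mon M (Src B i)\<^esub> l\<eta> M i Y))"

definition can_obj :: "('o, 'f, 't, 'z) two_cat_scheme \<Rightarrow> ('k, 'o, 'f, 't, 'x, 'y, 'm) green_scheme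
    \<Rightarrow> 'f \<Rightarrow> 'x" where
  "can_obj B M i = FO (LSh M i) (Unit (Mon M (Src B i)))"

text \<open>The identification \<open>1 \<otimes> 1 \<cong> 1\<close> is the left unitor, which agrees with the right one at \<open>1\<close>.\<close>

definition can_mult :: "('o, 'f, 't, 'z) two_cat_scheme \<Rightarrow> ('k, 'o, 'f, 't, 'x, 'y, 'm) green_scheme
    \<Rightarrow> 'f \<Rightarrow> 'y" where
  "can_mult B M i = (let I = Unit (Mon M (Src B i))
     in FA (RSt M i) (Lun (Mon M (Src B i)) I) \<cdot>\<^bsub>MC M (Trg B i)\<^esub> star_lax B M i I I)"

definition can_unit :: "('o, 'f, 't, 'z) two_cat_scheme \<Rightarrow> ('k, 'o, 'f, 't, 'x, 'y, 'm) green_scheme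
    \<Rightarrow> 'f \<Rightarrow> 'y" where
  "can_unit B M i =
     FA (RSt M i) (PullU M i) \<cdot>\<^bsub>MC M (Trg B i)\<^esub> r\<eta> M i (Unit (Mon M (Trg B i)))"

definition can_comult :: "('o, 'f, 't, 'z) two_cat_scheme \<Rightarrow> ('k, 'o, 'f, 't, 'x, 'y, 'm) green_scheme
    \<Rightarrow> 'f \<Rightarrow> 'y" where
  "can_comult B M i = (let I = Unit (Mon M (Src B i))
     in shriek_colax B M i I I
          \<cdot>\<^bsub>MC M (Trg B i)\<^esub> FA (LSh M i) (inv_arr (MC M (Src B i)) (Lun (Mon M (Src B i)) I)))"

definition can_counit :: "('o, 'f, 't, 'z) two_cat_scheme \<Rightarrow> ('k, 'o, 'f, 't, 'x, 'y, 'm) green_scheme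
    \<Rightarrow> 'f \<Rightarrow> 'y" where
  "can_counit B M i = l\<epsilon> M i (Unit (Mon M (Trg B i)))
     \<cdot>\<^bsub>MC M (Trg B i)\<^esub> FA (LSh M i) (inv_arr (MC M (Src B i)) (PullU M i))"

end

theory Submission
  imports Defs
begin

text \<open>Write \<open>F = i\<^sup>*\<close> and \<open>S = i\<^sub>! = i\<^sub>*\<close>, so that \<open>S\<close> is right adjoint to \<open>F\<close> through \<open>(\<eta>, \<epsilon>)\<close> and left
  adjoint to \<open>F\<close> through \<open>(\<eta>', \<epsilon>')\<close>, and \<open>\<epsilon> \<eta>' = 1\<close>. As \<open>F\<close> is strong monoidal, the first adjunction
  gives \<open>S\<close> a lax structure \<open>\<lambda>\<close> (\<open>lax\<close>), the second a colax structure \<open>\<kappa>\<close> (\<open>colax\<close>). The theorem holds because \<open>\<lambda>\<close> and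
  \<open>\<kappa>\<close> make \<open>S\<close> a Frobenius monoidal functor with \<open>\<lambda> \<kappa> = 1\<close>: such functors preserve special
  Frobenius objects, and \<open>A = S 1\<close> is the image of the unit object, which is one.

  Both facts come from the projection formula. Let \<open>P : X \<otimes> S Y \<rightarrow> S (F X \<otimes> Y)\<close> be the projection map
  (\<open>proj\<close>). It has the inverse built from the left adjunction, and
  \<open>\<lambda> = S (\<epsilon> \<otimes> 1) P\<close>, \<open>\<kappa> = P\<inverse> S (\<eta>' \<otimes> 1)\<close>. Hence \<open>\<lambda> \<kappa> = S (\<epsilon> \<eta>' \<otimes> 1) = 1\<close> (\<open>lax_colax\<close>).
  Also \<open>P = \<lambda> (\<eta> \<otimes> 1)\<close>, so associativity of \<open>\<lambda>\<close> gives an associativity law for \<open>P\<close>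
  (\<open>proj_assoc\<close>); cancelling \<open>P\<close> from that law leaves the Frobenius law
  \<open>(1 \<otimes> \<lambda>) (\<kappa> \<otimes> 1) = \<kappa> \<lambda>\<close> (\<open>lax_colax_frobenius\<close>).

  Passing to opposite categories exchanges the two adjunctions, hence \<open>\<lambda>\<close> with \<open>\<kappa>\<close> and monoids with
  comonoids, and it turns one Frobenius law into the other. So the laws of \<open>\<lambda>\<close>, proved by
  transposition along \<open>F \<stileturn> S\<close>, and one Frobenius law suffice (\<open>ambidextrous_op\<close>). A braided \<open>F\<close> makes
  \<open>\<lambda>\<close> compatible with the braidings, so \<open>S\<close> preserves commutativity as well. That \<open>1\<close> is a commutative
  special Frobenius object is the coherence of unitors, associators and braidings at \<open>1\<close>.\<close>

section \<open>Composites and inverses\<close>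

text \<open>Typing is phrased through \<open>Dom\<close> and \<open>Cod\<close> throughout, so that rewriting can check
  composability without guessing intermediate objects.\<close>

context category
begin

lemma Obj_simps [simp]:
  "f \<in> Arr C \<Longrightarrow> Dom C f \<in> Obj C" "f \<in> Arr C \<Longrightarrow> Cod C f \<in> Obj C"
  using Dom_closed Cod_closed by auto

lemma Ide_simps [simp]:
  assumes "X \<in> Obj C"
  shows "Ide C X \<in> Arr C" "Dom C (Ide C X) = X" "Cod C (Ide C X) = X"
  using Ide_closed[OF assms] by (auto simp: arrows_def)

lemma Cmp_simps [simp]:
  assumes "f \<in> Arr C" "g \<in> Arr C" "Dom C g = Cod C f"
  shows "g \<cdot> f \<in> Arr C" "Dom C (g \<cdot> f) = Dom C f" "Cod C (g \<cdot> f) = Cod C g"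
  using Cmp_closed[of f "Dom C f" "Cod C f" g "Cod C g"] assms by (auto simp: arrows_def)

lemma Cmp_Ide_simp [simp]: "f \<in> Arr C \<Longrightarrow> X = Dom C f \<Longrightarrow> f \<cdot> Ide C X = f"
  using Cmp_Ide[of f "Dom C f" "Cod C f"] by (auto simp: arrows_def)

lemma Ide_Cmp_simp [simp]: "f \<in> Arr C \<Longrightarrow> X = Cod C f \<Longrightarrow> Ide C X \<cdot> f = f"
  using Ide_Cmp[of f "Dom C f" "Cod C f"] by (auto simp: arrows_def)

lemma Cmp_assoc_simp [simp]:
  assumes "f \<in> Arr C" "g \<in> Arr C" "h \<in> Arr C" "Dom C g = Cod C f" "Dom C h = Cod C g"
  shows "(h \<cdot> g) \<cdot> f = h \<cdot> g \<cdot> f"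
  using Cmp_assoc[of f "Dom C f" "Cod C f" g "Cod C g" h "Cod C h"] assms by (auto simp: arrows_def)

text \<open>Composites are kept bracketed to the right; this rewrites the first two factors of such a
  composite by a known equation.\<close>

lemma Cmp_prefix:
  assumes "h \<cdot> g = k" "f \<in> Arr C" "g \<in> Arr C" "h \<in> Arr C" "Dom C g = Cod C f" "Dom C h = Cod C g"
  shows "h \<cdot> g \<cdot> f = k \<cdot> f"
  using assms Cmp_assoc_simp[of f g h] by simp

lemma inverse_arrows_unique:
  assumes "inverse_arrows C f g" "inverse_arrows C f g'"
  shows "g = g'"
proof -
  have "g = g \<cdot> f \<cdot> g'" using assms by (auto simp: inverse_arrows_def arrows_def)
  also have "\<dots> = (g \<cdot> f) \<cdot> g'"
    using assms by (intro Cmp_assoc_simp[symmetric]) (auto simp: inverse_arrows_def arrows_def)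
  also have "\<dots> = g'" using assms by (auto simp: inverse_arrows_def arrows_def)
  finally show ?thesis .
qed

lemma inverse_arrows_sym: "inverse_arrows C f g \<Longrightarrow> inverse_arrows C g f"
  by (auto simp: inverse_arrows_def arrows_def)

lemma inv_arr_eqI: "inverse_arrows C f g \<Longrightarrow> inv_arr C f = g"
  unfolding inv_arr_def using inverse_arrows_unique by blast

lemma inverse_arrows_inv_arr: "iso_arrow C f \<Longrightarrow> inverse_arrows C f (inv_arr C f)"
  unfolding iso_arrow_def using inv_arr_eqI by blast

lemma inv_arr_simps [simp]:
  assumes "iso_arrow C f"
  shows "inv_arr C f \<in> Arr C" "Dom C (inv_arr C f) = Cod C f" "Cod C (inv_arr C f) = Dom C f"
    "inv_arr C f \<cdot> f = Ide C (Dom C f)" "f \<cdot> inv_arr C f = Ide C (Cod C f)"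
  using inverse_arrows_inv_arr[OF assms] by (auto simp: inverse_arrows_def arrows_def)

lemma iso_arrow_Arr: "iso_arrow C f \<Longrightarrow> f \<in> Arr C"
  by (auto simp: iso_arrow_def inverse_arrows_def)

lemma inv_arr_prefix [simp]:
  assumes "iso_arrow C f"
  shows "x \<in> Arr C \<Longrightarrow> Cod C x = Dom C f \<Longrightarrow> inv_arr C f \<cdot> f \<cdot> x = x"
    "y \<in> Arr C \<Longrightarrow> Cod C y = Cod C f \<Longrightarrow> f \<cdot> inv_arr C f \<cdot> y = y"
  using assms iso_arrow_Arr[OF assms]
    Cmp_prefix[OF inv_arr_simps(4), of f x] Cmp_prefix[OF inv_arr_simps(5), of f y]
  by auto

lemma iso_inv_arr [simp]: "iso_arrow C f \<Longrightarrow> iso_arrow C (inv_arr C f)"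
  and inv_inv_arr [simp]: "iso_arrow C f \<Longrightarrow> inv_arr C (inv_arr C f) = f"
proof -
  assume f: "iso_arrow C f"
  have "inverse_arrows C (inv_arr C f) f"
    using f iso_arrow_Arr[OF f] by (simp add: inverse_arrows_def arrows_def)
  thus "iso_arrow C (inv_arr C f)" "inv_arr C (inv_arr C f) = f"
    by (auto simp: iso_arrow_def intro: inv_arr_eqI)
qed

lemma iso_Ide [simp]: "X \<in> Obj C \<Longrightarrow> iso_arrow C (Ide C X)"
  and inv_Ide [simp]: "X \<in> Obj C \<Longrightarrow> inv_arr C (Ide C X) = Ide C X"
proof -
  assume X: "X \<in> Obj C"
  have "inverse_arrows C (Ide C X) (Ide C X)"
    using X by (simp add: inverse_arrows_def arrows_def)
  thus "iso_arrow C (Ide C X)" "inv_arr C (Ide C X) = Ide C X"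
    by (auto simp: iso_arrow_def intro: inv_arr_eqI)
qed

lemma
  assumes "iso_arrow C f" "iso_arrow C g" "Dom C g = Cod C f"
  shows iso_Cmp [simp]: "iso_arrow C (g \<cdot> f)"
    and inv_Cmp [simp]: "inv_arr C (g \<cdot> f) = inv_arr C f \<cdot> inv_arr C g"
proof -
  have "inverse_arrows C (g \<cdot> f) (inv_arr C f \<cdot> inv_arr C g)"
    using assms by (simp add: inverse_arrows_def arrows_def iso_arrow_Arr)
  thus "iso_arrow C (g \<cdot> f)" "inv_arr C (g \<cdot> f) = inv_arr C f \<cdot> inv_arr C g"
    by (auto simp: iso_arrow_def intro: inv_arr_eqI)
qed

lemma iso_cancel_left:
  assumes "f \<cdot> g = f \<cdot> h" "iso_arrow C f" "g \<in> Arr C" "h \<in> Arr C" "Cod C g = Dom C f" "Cod C h = Dom C f"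
  shows "g = h"
proof -
  have "g = inv_arr C f \<cdot> f \<cdot> g" using assms(2-) by simp
  also have "\<dots> = inv_arr C f \<cdot> f \<cdot> h" by (simp only: assms(1))
  also have "\<dots> = h" using assms(2-) by simp
  finally show ?thesis .
qed

lemma iso_cancel_right:
  assumes "g \<cdot> f = h \<cdot> f" "iso_arrow C f" "g \<in> Arr C" "h \<in> Arr C" "Dom C g = Cod C f" "Dom C h = Cod C f"
  shows "g = h"
proof -
  have "g = (g \<cdot> f) \<cdot> inv_arr C f" using assms(2-) iso_arrow_Arr[OF assms(2)] by simp
  also have "\<dots> = (h \<cdot> f) \<cdot> inv_arr C f" by (simp only: assms(1))
  also have "\<dots> = h" using assms(2-) iso_arrow_Arr[OF assms(2)] by simp
  finally show ?thesis .
qed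

lemma inv_square:
  assumes "b \<cdot> f = g \<cdot> a" "iso_arrow C a" "iso_arrow C b" "f \<in> Arr C" "g \<in> Arr C"
    "Cod C f = Dom C b" "Dom C f = Dom C a" "Dom C g = Cod C a" "Cod C g = Cod C b"
  shows "inv_arr C b \<cdot> g = f \<cdot> inv_arr C a"
proof -
  have *: "a \<in> Arr C" "b \<in> Arr C" using assms iso_arrow_Arr by auto
  have "inv_arr C b \<cdot> g = inv_arr C b \<cdot> (g \<cdot> a) \<cdot> inv_arr C a" using assms(2-) * by simp
  also have "\<dots> = inv_arr C b \<cdot> (b \<cdot> f) \<cdot> inv_arr C a" by (simp only: assms(1))
  also have "\<dots> = f \<cdot> inv_arr C a" using assms(2-) * by simp
  finally show ?thesis .
qed

end

context cat_functor
begin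

lemma FO_simp [simp]: "X \<in> Obj C \<Longrightarrow> FO F X \<in> Obj D"
  by (rule FO_closed)

lemma FA_simps [simp]:
  assumes "f \<in> Arr C"
  shows "FA F f \<in> Arr D" "Dom D (FA F f) = FO F (Dom C f)" "Cod D (FA F f) = FO F (Cod C f)"
  using FA_closed[of f "Dom C f" "Cod C f"] assms by (auto simp: arrows_def)

lemma FA_Ide_simp [simp]: "X \<in> Obj C \<Longrightarrow> FA F (Ide C X) = Ide D (FO F X)"
  by (rule FA_Ide)

lemma FA_Cmp_simp [simp]:
  assumes "f \<in> Arr C" "g \<in> Arr C" "Dom C g = Cod C f"
  shows "FA F (g \<cdot>\<^bsub>C\<^esub> f) = FA F g \<cdot>\<^bsub>D\<^esub> FA F f"
  using FA_Cmp[of f "Dom C f" "Cod C f" g "Cod C g"] assms by (auto simp: arrows_def)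

lemma FA_iso [simp]: "iso_arrow C f \<Longrightarrow> iso_arrow D (FA F f)"
  and FA_inv: "iso_arrow C f \<Longrightarrow> FA F (inv_arr C f) = inv_arr D (FA F f)"
proof -
  assume f: "iso_arrow C f"
  hence f': "f \<in> Arr C" by (rule C.iso_arrow_Arr)
  have "inverse_arrows D (FA F f) (FA F (inv_arr C f))"
    using f f' FA_Cmp_simp[of f "inv_arr C f"] FA_Cmp_simp[of "inv_arr C f" f]
    by (simp add: inverse_arrows_def arrows_def)
  thus "iso_arrow D (FA F f)" "FA F (inv_arr C f) = inv_arr D (FA F f)"
    by (auto simp: iso_arrow_def intro: D.inv_arr_eqI[symmetric])
qed

end

lemma (in natural_transformation) naturality_simp:
  assumes "f \<in> Arr C"
  shows "\<alpha> (Cod C f) \<cdot>\<^bsub>D\<^esub> FA F f = FA G f \<cdot>\<^bsub>D\<^esub> \<alpha> (Dom C f)"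
  using naturality[of f "Dom C f" "Cod C f"] assms by (auto simp: arrows_def)

section \<open>Coherence at the unit object\<close>

context monoidal_category
begin

lemma TO_simp [simp]: "X \<in> Obj C \<Longrightarrow> Y \<in> Obj C \<Longrightarrow> X \<otimes>\<^sub>o\<^bsub>T\<^esub> Y \<in> Obj C"
  by (rule TO_closed)

lemma Unit_simp [simp]: "Unit T \<in> Obj C"
  by (rule Unit_closed)

lemma TA_simps [simp]:
  assumes "f \<in> Arr C" "g \<in> Arr C"
  shows "f \<otimes>\<^sub>a\<^bsub>T\<^esub> g \<in> Arr C" "Dom C (f \<otimes>\<^sub>a\<^bsub>T\<^esub> g) = Dom C f \<otimes>\<^sub>o\<^bsub>T\<^esub> Dom C g"
    "Cod C (f \<otimes>\<^sub>a\<^bsub>T\<^esub> g) = Cod C f \<otimes>\<^sub>o\<^bsub>T\<^esub> Cod C g"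
  using TA_closed[of f "Dom C f" "Cod C f" g "Dom C g" "Cod C g"] assms by (auto simp: arrows_def)

lemma TA_Ide_simp [simp]:
  "X \<in> Obj C \<Longrightarrow> Y \<in> Obj C \<Longrightarrow> Ide C X \<otimes>\<^sub>a\<^bsub>T\<^esub> Ide C Y = Ide C (X \<otimes>\<^sub>o\<^bsub>T\<^esub> Y)"
  by (rule TA_Ide)

text \<open>Tensor products of arrows are merged rather than split, so that \<open>(f \<otimes> 1) (1 \<otimes> g)\<close> and
  \<open>(1 \<otimes> g) (f \<otimes> 1)\<close> have the common normal form \<open>f \<otimes> g\<close>.\<close>

lemma TA_Cmp_simp [simp]:
  assumes "f \<in> Arr C" "f' \<in> Arr C" "Dom C f' = Cod C f" "g \<in> Arr C" "g' \<in> Arr C" "Dom C g' = Cod C g"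
  shows "(f' \<otimes>\<^sub>a\<^bsub>T\<^esub> g') \<cdot>\<^bsub>C\<^esub> (f \<otimes>\<^sub>a\<^bsub>T\<^esub> g) = (f' \<cdot>\<^bsub>C\<^esub> f) \<otimes>\<^sub>a\<^bsub>T\<^esub> (g' \<cdot>\<^bsub>C\<^esub> g)"
  using TA_Cmp[of f "Dom C f" "Cod C f" f' "Cod C f'" g "Dom C g" "Cod C g" g' "Cod C g'"] assms
  by (auto simp: arrows_def)

lemma TA_Cmp_prefix [simp]:
  assumes "f \<in> Arr C" "f' \<in> Arr C" "Dom C f' = Cod C f" "g \<in> Arr C" "g' \<in> Arr C" "Dom C g' = Cod C g"
    "x \<in> Arr C" "Cod C x = Dom C f \<otimes>\<^sub>o\<^bsub>T\<^esub> Dom C g"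
  shows "(f' \<otimes>\<^sub>a\<^bsub>T\<^esub> g') \<cdot>\<^bsub>C\<^esub> (f \<otimes>\<^sub>a\<^bsub>T\<^esub> g) \<cdot>\<^bsub>C\<^esub> x = ((f' \<cdot>\<^bsub>C\<^esub> f) \<otimes>\<^sub>a\<^bsub>T\<^esub> (g' \<cdot>\<^bsub>C\<^esub> g)) \<cdot>\<^bsub>C\<^esub> x"
  using assms by (intro Cmp_prefix) simp_all

lemma Asc_simps [simp]:
  assumes "X \<in> Obj C" "Y \<in> Obj C" "Z \<in> Obj C"
  shows "Asc T X Y Z \<in> Arr C" "Dom C (Asc T X Y Z) = (X \<otimes>\<^sub>o\<^bsub>T\<^esub> Y) \<otimes>\<^sub>o\<^bsub>T\<^esub> Z"
    "Cod C (Asc T X Y Z) = X \<otimes>\<^sub>o\<^bsub>T\<^esub> Y \<otimes>\<^sub>o\<^bsub>T\<^esub> Z" "iso_arrow C (Asc T X Y Z)"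
  using Asc_closed[OF assms] by (auto simp: arrows_def)

lemma Lun_simps [simp]:
  assumes "X \<in> Obj C"
  shows "Lun T X \<in> Arr C" "Dom C (Lun T X) = Unit T \<otimes>\<^sub>o\<^bsub>T\<^esub> X" "Cod C (Lun T X) = X"
    "iso_arrow C (Lun T X)"
  using Lun_closed[OF assms] by (auto simp: arrows_def)

lemma Run_simps [simp]:
  assumes "X \<in> Obj C"
  shows "Run T X \<in> Arr C" "Dom C (Run T X) = X \<otimes>\<^sub>o\<^bsub>T\<^esub> Unit T" "Cod C (Run T X) = X"
    "iso_arrow C (Run T X)"
  using Run_closed[OF assms] by (auto simp: arrows_def)

lemma Asc_natural_simp:
  assumes "f \<in> Arr C" "g \<in> Arr C" "h \<in> Arr C"
  shows "Asc T (Cod C f) (Cod C g) (Cod C h) \<cdot>\<^bsub>C\<^esub> ((f \<otimes>\<^sub>a\<^bsub>T\<^esub> g) \<otimes>\<^sub>a\<^bsub>T\<^esub> h)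
    = (f \<otimes>\<^sub>a\<^bsub>T\<^esub> g \<otimes>\<^sub>a\<^bsub>T\<^esub> h) \<cdot>\<^bsub>C\<^esub> Asc T (Dom C f) (Dom C g) (Dom C h)"
  using Asc_natural[of f "Dom C f" "Cod C f" g "Dom C g" "Cod C g" h "Dom C h" "Cod C h"] assms
  by (auto simp: arrows_def)

lemma Lun_natural_simp:
  "f \<in> Arr C \<Longrightarrow> Lun T (Cod C f) \<cdot>\<^bsub>C\<^esub> (Ide C (Unit T) \<otimes>\<^sub>a\<^bsub>T\<^esub> f) = f \<cdot>\<^bsub>C\<^esub> Lun T (Dom C f)"
  using Lun_natural[of f "Dom C f" "Cod C f"] by (auto simp: arrows_def)

lemma Run_natural_simp:
  "f \<in> Arr C \<Longrightarrow> Run T (Cod C f) \<cdot>\<^bsub>C\<^esub> (f \<otimes>\<^sub>a\<^bsub>T\<^esub> Ide C (Unit T)) = f \<cdot>\<^bsub>C\<^esub> Run T (Dom C f)"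
  using Run_natural[of f "Dom C f" "Cod C f"] by (auto simp: arrows_def)

lemma
  assumes f: "iso_arrow C f" and g: "iso_arrow C g"
  shows iso_TA [simp]: "iso_arrow C (f \<otimes>\<^sub>a\<^bsub>T\<^esub> g)"
    and inv_TA [simp]: "inv_arr C (f \<otimes>\<^sub>a\<^bsub>T\<^esub> g) = inv_arr C f \<otimes>\<^sub>a\<^bsub>T\<^esub> inv_arr C g"
proof -
  have "inverse_arrows C (f \<otimes>\<^sub>a\<^bsub>T\<^esub> g) (inv_arr C f \<otimes>\<^sub>a\<^bsub>T\<^esub> inv_arr C g)"
    using assms by (simp add: inverse_arrows_def arrows_def iso_arrow_Arr)
  thus "iso_arrow C (f \<otimes>\<^sub>a\<^bsub>T\<^esub> g)" "inv_arr C (f \<otimes>\<^sub>a\<^bsub>T\<^esub> g) = inv_arr C f \<otimes>\<^sub>a\<^bsub>T\<^esub> inv_arr C g"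
    by (auto simp: iso_arrow_def intro: inv_arr_eqI)
qed

text \<open>Tensoring with the unit is faithful, being isomorphic to the identity functor.\<close>

lemma Unit_TA_cancel:
  assumes "Ide C (Unit T) \<otimes>\<^sub>a\<^bsub>T\<^esub> f = Ide C (Unit T) \<otimes>\<^sub>a\<^bsub>T\<^esub> g"
    and "f \<in> Arr C" "g \<in> Arr C" "Dom C f = Dom C g" "Cod C f = Cod C g"
  shows "f = g"
proof (rule iso_cancel_right)
  show "f \<cdot>\<^bsub>C\<^esub> Lun T (Dom C f) = g \<cdot>\<^bsub>C\<^esub> Lun T (Dom C f)"
    using assms Lun_natural_simp[of f] Lun_natural_simp[of g] by simp
qed (use assms in simp_all)

lemma TA_Unit_cancel:
  assumes "f \<otimes>\<^sub>a\<^bsub>T\<^esub> Ide C (Unit T) = g \<otimes>\<^sub>a\<^bsub>T\<^esub> Ide C (Unit T)"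
    and "f \<in> Arr C" "g \<in> Arr C" "Dom C f = Dom C g" "Cod C f = Cod C g"
  shows "f = g"
proof (rule iso_cancel_right)
  show "f \<cdot>\<^bsub>C\<^esub> Run T (Dom C f) = g \<cdot>\<^bsub>C\<^esub> Run T (Dom C f)"
    using assms Run_natural_simp[of f] Run_natural_simp[of g] by simp
qed (use assms in simp_all)

text \<open>Kelly's argument: after tensoring with \<open>1\<close> on the left, the pentagon at \<open>(1, 1, X, Y)\<close> and two
  instances of the triangle give the equation up to an invertible factor.\<close>

lemma Lun_TO:
  assumes X: "X \<in> Obj C" and Y: "Y \<in> Obj C"
  shows "Lun T (X \<otimes>\<^sub>o\<^bsub>T\<^esub> Y) \<cdot>\<^bsub>C\<^esub> Asc T (Unit T) X Y = Lun T X \<otimes>\<^sub>a\<^bsub>T\<^esub> Ide C Y"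
proof (rule Unit_TA_cancel)
  let ?I = "Unit T"
  let ?b = "Asc T ?I (?I \<otimes>\<^sub>o\<^bsub>T\<^esub> X) Y \<cdot>\<^bsub>C\<^esub> (Asc T ?I ?I X \<otimes>\<^sub>a\<^bsub>T\<^esub> Ide C Y)"
  show "Ide C ?I \<otimes>\<^sub>a\<^bsub>T\<^esub> (Lun T (X \<otimes>\<^sub>o\<^bsub>T\<^esub> Y) \<cdot>\<^bsub>C\<^esub> Asc T ?I X Y) = Ide C ?I \<otimes>\<^sub>a\<^bsub>T\<^esub> Lun T X \<otimes>\<^sub>a\<^bsub>T\<^esub> Ide C Y"
    (is "?l = ?r")
  proof (rule iso_cancel_right)
    have "?l \<cdot>\<^bsub>C\<^esub> ?b
        = (Ide C ?I \<otimes>\<^sub>a\<^bsub>T\<^esub> Lun T (X \<otimes>\<^sub>o\<^bsub>T\<^esub> Y)) \<cdot>\<^bsub>C\<^esub> (Ide C ?I \<otimes>\<^sub>a\<^bsub>T\<^esub> Asc T ?I X Y) \<cdot>\<^bsub>C\<^esub> ?b"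
      using X Y by simp
    also have "\<dots> = (Ide C ?I \<otimes>\<^sub>a\<^bsub>T\<^esub> Lun T (X \<otimes>\<^sub>o\<^bsub>T\<^esub> Y))
        \<cdot>\<^bsub>C\<^esub> Asc T ?I ?I (X \<otimes>\<^sub>o\<^bsub>T\<^esub> Y) \<cdot>\<^bsub>C\<^esub> Asc T (?I \<otimes>\<^sub>o\<^bsub>T\<^esub> ?I) X Y"
      using X Y pentagon[of ?I ?I X Y] by simp
    also have "\<dots> = (Run T ?I \<otimes>\<^sub>a\<^bsub>T\<^esub> Ide C (X \<otimes>\<^sub>o\<^bsub>T\<^esub> Y)) \<cdot>\<^bsub>C\<^esub> Asc T (?I \<otimes>\<^sub>o\<^bsub>T\<^esub> ?I) X Y"
      using X Y Cmp_prefix[OF triangle[of ?I "X \<otimes>\<^sub>o\<^bsub>T\<^esub> Y"]] by simp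
    also have "\<dots> = Asc T ?I X Y \<cdot>\<^bsub>C\<^esub> ((Run T ?I \<otimes>\<^sub>a\<^bsub>T\<^esub> Ide C X) \<otimes>\<^sub>a\<^bsub>T\<^esub> Ide C Y)"
      using X Y Asc_natural_simp[of "Run T ?I" "Ide C X" "Ide C Y"] by simp
    also have "\<dots> = Asc T ?I X Y \<cdot>\<^bsub>C\<^esub> ((Ide C ?I \<otimes>\<^sub>a\<^bsub>T\<^esub> Lun T X) \<otimes>\<^sub>a\<^bsub>T\<^esub> Ide C Y)
        \<cdot>\<^bsub>C\<^esub> (Asc T ?I ?I X \<otimes>\<^sub>a\<^bsub>T\<^esub> Ide C Y)"
      using X Y triangle[of ?I X] by simp
    also have "\<dots> = ?r \<cdot>\<^bsub>C\<^esub> ?b"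
      using X Y Asc_natural_simp[of "Ide C ?I" "Lun T X" "Ide C Y"]
        Cmp_prefix[OF Asc_natural_simp[of "Ide C ?I" "Lun T X" "Ide C Y"], of "Asc T ?I ?I X \<otimes>\<^sub>a\<^bsub>T\<^esub> Ide C Y"]
      by simp
    finally show "?l \<cdot>\<^bsub>C\<^esub> ?b = ?r \<cdot>\<^bsub>C\<^esub> ?b" .
  qed (use X Y in simp_all)
qed (use X Y in simp_all)

text \<open>Both unitors become \<open>(1 \<otimes> Lun 1) Asc\<close> after tensoring with \<open>1\<close> on the right: the left one by
  \<open>Lun_TO\<close> and naturality, the right one by the triangle.\<close>

lemma Lun_Unit_eq_Run_Unit: "Lun T (Unit T) = Run T (Unit T)"
proof (rule TA_Unit_cancel)
  let ?I = "Unit T"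
  have "Ide C ?I \<otimes>\<^sub>a\<^bsub>T\<^esub> Lun T ?I = Lun T (?I \<otimes>\<^sub>o\<^bsub>T\<^esub> ?I)"
    by (rule iso_cancel_left[OF _ Lun_simps(4)[of ?I]])
      (use Lun_natural_simp[of "Lun T ?I"] in simp_all)
  thus "Lun T ?I \<otimes>\<^sub>a\<^bsub>T\<^esub> Ide C ?I = Run T ?I \<otimes>\<^sub>a\<^bsub>T\<^esub> Ide C ?I"
    by (simp only: Lun_TO[OF Unit_simp Unit_simp, symmetric] triangle[OF Unit_simp Unit_simp, symmetric])
qed simp_all

lemma monoid_object_Unit: "monoid_object C T (Unit T) (Lun T (Unit T)) (Ide C (Unit T))"
proof (intro monoid_object.intro monoid_object_axioms.intro)
  let ?I = "Unit T"
  show "monoidal_category C T" ..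
  show "Lun T ?I \<cdot>\<^bsub>C\<^esub> (Lun T ?I \<otimes>\<^sub>a\<^bsub>T\<^esub> Ide C ?I)
    = Lun T ?I \<cdot>\<^bsub>C\<^esub> (Ide C ?I \<otimes>\<^sub>a\<^bsub>T\<^esub> Lun T ?I) \<cdot>\<^bsub>C\<^esub> Asc T ?I ?I ?I"
    by (subst triangle) (simp_all add: Lun_Unit_eq_Run_Unit)
qed (simp_all add: arrows_def Lun_Unit_eq_Run_Unit)

end

text \<open>The first hexagon at \<open>(X, 1, 1)\<close> is followed by the left unitor; what remains is the equation
  tensored with \<open>1\<close>, preceded by the invertible \<open>\<beta> X 1\<close>.\<close>

lemma (in braided_monoidal_category) Lun_braiding:
  assumes X: "X \<in> Obj C"
  shows "Lun T X \<cdot>\<^bsub>C\<^esub> \<beta> X (Unit T) = Run T X"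
proof (rule TA_Unit_cancel)
  let ?I = "Unit T" and ?b = "\<beta> X (Unit T)"
  note [simp] = X
  have b [simp]: "\<And>X Y. X \<in> Obj C \<Longrightarrow> Y \<in> Obj C \<Longrightarrow> \<beta> X Y \<in> Arr C \<and> Dom C (\<beta> X Y) = X \<otimes>\<^sub>o\<^bsub>T\<^esub> Y
      \<and> Cod C (\<beta> X Y) = Y \<otimes>\<^sub>o\<^bsub>T\<^esub> X \<and> iso_arrow C (\<beta> X Y)"
    using \<beta>_closed by (auto simp: arrows_def)
  show "(Lun T X \<cdot>\<^bsub>C\<^esub> ?b) \<otimes>\<^sub>a\<^bsub>T\<^esub> Ide C ?I = Run T X \<otimes>\<^sub>a\<^bsub>T\<^esub> Ide C ?I"
  proof (rule iso_cancel_left)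
    have "?b \<cdot>\<^bsub>C\<^esub> ((Lun T X \<cdot>\<^bsub>C\<^esub> ?b) \<otimes>\<^sub>a\<^bsub>T\<^esub> Ide C ?I)
        = ?b \<cdot>\<^bsub>C\<^esub> (Lun T X \<otimes>\<^sub>a\<^bsub>T\<^esub> Ide C ?I) \<cdot>\<^bsub>C\<^esub> (?b \<otimes>\<^sub>a\<^bsub>T\<^esub> Ide C ?I)"
      by simp
    also have "\<dots> = ?b \<cdot>\<^bsub>C\<^esub> (Lun T (X \<otimes>\<^sub>o\<^bsub>T\<^esub> ?I) \<cdot>\<^bsub>C\<^esub> Asc T ?I X ?I) \<cdot>\<^bsub>C\<^esub> (?b \<otimes>\<^sub>a\<^bsub>T\<^esub> Ide C ?I)"
      using Lun_TO[of X ?I] by simp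
    also have "\<dots> = (?b \<cdot>\<^bsub>C\<^esub> Lun T (X \<otimes>\<^sub>o\<^bsub>T\<^esub> ?I)) \<cdot>\<^bsub>C\<^esub> Asc T ?I X ?I \<cdot>\<^bsub>C\<^esub> (?b \<otimes>\<^sub>a\<^bsub>T\<^esub> Ide C ?I)"
      by simp
    also have "\<dots> = Lun T (?I \<otimes>\<^sub>o\<^bsub>T\<^esub> X) \<cdot>\<^bsub>C\<^esub> (Ide C ?I \<otimes>\<^sub>a\<^bsub>T\<^esub> ?b) \<cdot>\<^bsub>C\<^esub> Asc T ?I X ?I \<cdot>\<^bsub>C\<^esub> (?b \<otimes>\<^sub>a\<^bsub>T\<^esub> Ide C ?I)"
      using Lun_natural_simp[of ?b, symmetric] by simp
    also have "\<dots> = Lun T (?I \<otimes>\<^sub>o\<^bsub>T\<^esub> X) \<cdot>\<^bsub>C\<^esub> Asc T ?I ?I X \<cdot>\<^bsub>C\<^esub> \<beta> X (?I \<otimes>\<^sub>o\<^bsub>T\<^esub> ?I) \<cdot>\<^bsub>C\<^esub> Asc T X ?I ?I"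
      using hexagon1[of X ?I ?I] by simp
    also have "\<dots> = (Lun T ?I \<otimes>\<^sub>a\<^bsub>T\<^esub> Ide C X) \<cdot>\<^bsub>C\<^esub> \<beta> X (?I \<otimes>\<^sub>o\<^bsub>T\<^esub> ?I) \<cdot>\<^bsub>C\<^esub> Asc T X ?I ?I"
      using Cmp_prefix[OF Lun_TO[of ?I X]] by simp
    also have "\<dots> = (\<beta> X ?I \<cdot>\<^bsub>C\<^esub> (Ide C X \<otimes>\<^sub>a\<^bsub>T\<^esub> Lun T ?I)) \<cdot>\<^bsub>C\<^esub> Asc T X ?I ?I"
      using \<beta>_natural[of "Ide C X" X X "Lun T ?I" "?I \<otimes>\<^sub>o\<^bsub>T\<^esub> ?I" ?I] by (simp add: arrows_def)
    also have "\<dots> = ?b \<cdot>\<^bsub>C\<^esub> (Run T X \<otimes>\<^sub>a\<^bsub>T\<^esub> Ide C ?I)"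
      using triangle[of X ?I] by simp
    finally show "?b \<cdot>\<^bsub>C\<^esub> ((Lun T X \<cdot>\<^bsub>C\<^esub> ?b) \<otimes>\<^sub>a\<^bsub>T\<^esub> Ide C ?I) = ?b \<cdot>\<^bsub>C\<^esub> (Run T X \<otimes>\<^sub>a\<^bsub>T\<^esub> Ide C ?I)" .
  qed simp_all
qed (use X \<beta>_closed[of X "Unit T"] in \<open>simp_all add: arrows_def\<close>)

lemma (in braided_monoidal_category) commutative_monoid_Unit:
  "commutative_monoid C T \<beta> (Unit T) (Lun T (Unit T)) (Ide C (Unit T))"
  using Lun_braiding[of "Unit T"] monoid_object_Unit
  by (simp add: commutative_monoid_def Lun_Unit_eq_Run_Unit)


section \<open>The right adjoint of a strong monoidal functor\<close>

lemma (in strong_monoidal_functor) strong_simps [simp]: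
  assumes "X \<in> Obj C" "Y \<in> Obj C"
  shows "\<Phi> X Y \<in> Arr D" "Dom D (\<Phi> X Y) = FO F (X \<otimes>\<^sub>o\<^bsub>T\<^esub> Y)"
    "Cod D (\<Phi> X Y) = FO F X \<otimes>\<^sub>o\<^bsub>U\<^esub> FO F Y" "iso_arrow D (\<Phi> X Y)"
  using \<Phi>_closed[OF assms] by (auto simp: arrows_def)

lemma (in strong_monoidal_functor) strong_unit_simps [simp]:
  "\<Phi>1 \<in> Arr D" "Dom D \<Phi>1 = FO F (Unit T)" "Cod D \<Phi>1 = Unit U" "iso_arrow D \<Phi>1"
  using \<Phi>1_closed by (auto simp: arrows_def)

lemma (in strong_monoidal_functor) \<Phi>_natural_simp:
  assumes "f \<in> Arr C" "g \<in> Arr C"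
  shows "\<Phi> (Cod C f) (Cod C g) \<cdot>\<^bsub>D\<^esub> FA F (f \<otimes>\<^sub>a\<^bsub>T\<^esub> g)
    = (FA F f \<otimes>\<^sub>a\<^bsub>U\<^esub> FA F g) \<cdot>\<^bsub>D\<^esub> \<Phi> (Dom C f) (Dom C g)"
  using \<Phi>_natural[of f "Dom C f" "Cod C f" g "Dom C g" "Cod C g"] assms by (auto simp: arrows_def)

context adjunction
begin

lemma unit_simps [simp]:
  assumes "X \<in> Obj C"
  shows "\<eta> X \<in> Arr C" "Dom C (\<eta> X) = X" "Cod C (\<eta> X) = FO U (FO F X)"
  using unit.component[OF assms] by (auto simp: arrows_def id_ftr_def comp_ftr_def)

lemma counit_simps [simp]:
  assumes "Y \<in> Obj D"
  shows "\<epsilon> Y \<in> Arr D" "Dom D (\<epsilon> Y) = FO F (FO U Y)" "Cod D (\<epsilon> Y) = Y"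
  using counit.component[OF assms] by (auto simp: arrows_def id_ftr_def comp_ftr_def)

lemma unit_natural:
  "f \<in> Arr C \<Longrightarrow> \<eta> (Cod C f) \<cdot>\<^bsub>C\<^esub> f = FA U (FA F f) \<cdot>\<^bsub>C\<^esub> \<eta> (Dom C f)"
  using unit.naturality_simp[of f] by (simp add: id_ftr_def comp_ftr_def)

lemma counit_natural:
  "f \<in> Arr D \<Longrightarrow> \<epsilon> (Cod D f) \<cdot>\<^bsub>D\<^esub> FA F (FA U f) = f \<cdot>\<^bsub>D\<^esub> \<epsilon> (Dom D f)"
  using counit.naturality_simp[of f] by (simp add: id_ftr_def comp_ftr_def)

lemma transpose_cancel:
  assumes "f \<in> Arr D" "Z \<in> Obj C" "Dom D f = FO F Z"
  shows "\<epsilon> (Cod D f) \<cdot>\<^bsub>D\<^esub> FA F (FA U f \<cdot>\<^bsub>C\<^esub> \<eta> Z) = f"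
proof -
  have "\<epsilon> (Cod D f) \<cdot>\<^bsub>D\<^esub> FA F (FA U f \<cdot>\<^bsub>C\<^esub> \<eta> Z) = (\<epsilon> (Cod D f) \<cdot>\<^bsub>D\<^esub> FA F (FA U f)) \<cdot>\<^bsub>D\<^esub> FA F (\<eta> Z)"
    using assms by simp
  also have "\<dots> = f \<cdot>\<^bsub>D\<^esub> \<epsilon> (FO F Z) \<cdot>\<^bsub>D\<^esub> FA F (\<eta> Z)"
    using assms by (simp only: counit_natural) simp
  also have "\<dots> = f" using assms triangle_left[of Z] by simp
  finally show ?thesis .
qed

text \<open>An arrow \<open>f\<close> into \<open>U Y\<close> is recovered from its transpose \<open>t\<close> as \<open>U t \<eta>\<close>.\<close>

lemma transpose_inject:
  assumes "\<epsilon> Y \<cdot>\<^bsub>D\<^esub> FA F f = \<epsilon> Y \<cdot>\<^bsub>D\<^esub> FA F g" "f \<in> Arr C" "g \<in> Arr C" "Y \<in> Obj D"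
    "Dom C f = Dom C g" "Cod C f = FO U Y" "Cod C g = FO U Y"
  shows "f = g"
proof -
  have *: "FA U (\<epsilon> Y \<cdot>\<^bsub>D\<^esub> FA F f) \<cdot>\<^bsub>C\<^esub> \<eta> (Dom C f) = f" if "f \<in> Arr C" "Cod C f = FO U Y" for f
  proof -
    have "FA U (\<epsilon> Y \<cdot>\<^bsub>D\<^esub> FA F f) \<cdot>\<^bsub>C\<^esub> \<eta> (Dom C f) = FA U (\<epsilon> Y) \<cdot>\<^bsub>C\<^esub> \<eta> (FO U Y) \<cdot>\<^bsub>C\<^esub> f"
      using that \<open>Y \<in> Obj D\<close> unit_natural[of f] by simp
    also have "\<dots> = f"
      using that \<open>Y \<in> Obj D\<close> unit.F.C.Cmp_prefix[OF triangle_right[of Y], of f] by simp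
    finally show ?thesis .
  qed
  show ?thesis using *[of f] *[of g] assms by simp
qed

end

locale monoidal_right_adjoint =
  strong_monoidal_functor C T D U F \<Phi> \<Phi>1 + R: adjunction C D F S \<eta> \<epsilon>
  for C :: "('x, 'y, 'z) cat_scheme" and T :: "('x, 'y) monoidal"
    and D :: "('p, 'b, 'w) cat_scheme" and U :: "('p, 'b) monoidal"
    and F :: "('x, 'y, 'p, 'b) ftr" and \<Phi> :: "'x \<Rightarrow> 'x \<Rightarrow> 'b" and \<Phi>1 :: 'b
    and S :: "('p, 'b, 'x, 'y) ftr" and \<eta> :: "'x \<Rightarrow> 'y" and \<epsilon> :: "'p \<Rightarrow> 'b"
begin

text \<open>In this notation \<open>\<otimes>\<close> acts on arrows and \<open>\<odot>\<close> on objects.\<close>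

abbreviation cmp_C (infixr "\<circ>\<^sub>C" 70) where "g \<circ>\<^sub>C f \<equiv> g \<cdot>\<^bsub>C\<^esub> f"
abbreviation cmp_D (infixr "\<circ>\<^sub>D" 70) where "g \<circ>\<^sub>D f \<equiv> g \<cdot>\<^bsub>D\<^esub> f"
abbreviation ten_C (infixr "\<otimes>\<^sub>C" 75) where "f \<otimes>\<^sub>C g \<equiv> f \<otimes>\<^sub>a\<^bsub>T\<^esub> g"
abbreviation ten_D (infixr "\<otimes>\<^sub>D" 75) where "f \<otimes>\<^sub>D g \<equiv> f \<otimes>\<^sub>a\<^bsub>U\<^esub> g"
abbreviation obj_C (infixr "\<odot>\<^sub>C" 75) where "X \<odot>\<^sub>C Y \<equiv> X \<otimes>\<^sub>o\<^bsub>T\<^esub> Y"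
abbreviation obj_D (infixr "\<odot>\<^sub>D" 75) where "X \<odot>\<^sub>D Y \<equiv> X \<otimes>\<^sub>o\<^bsub>U\<^esub> Y"
abbreviation "Fo \<equiv> FO F"
abbreviation "Fa \<equiv> FA F"
abbreviation "So \<equiv> FO S"
abbreviation "Sa \<equiv> FA S"
abbreviation "idC \<equiv> Ide C"
abbreviation "idD \<equiv> Ide D"

definition lax :: "'p \<Rightarrow> 'p \<Rightarrow> 'y" where
  "lax X Y = Sa ((\<epsilon> X \<otimes>\<^sub>D \<epsilon> Y) \<circ>\<^sub>D \<Phi> (So X) (So Y)) \<circ>\<^sub>C \<eta> (So X \<odot>\<^sub>C So Y)"

definition lax_unit :: 'y where
  "lax_unit = Sa \<Phi>1 \<circ>\<^sub>C \<eta> (Unit T)"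

lemma lax_simps [simp]:
  assumes "X \<in> Obj D" "Y \<in> Obj D"
  shows "lax X Y \<in> Arr C" "Dom C (lax X Y) = So X \<odot>\<^sub>C So Y" "Cod C (lax X Y) = So (X \<odot>\<^sub>D Y)"
  using assms by (simp_all add: lax_def)

lemma lax_unit_simps [simp]:
  "lax_unit \<in> Arr C" "Dom C lax_unit = Unit T" "Cod C lax_unit = So (Unit U)"
  by (simp_all add: lax_unit_def)

lemma transpose_lax:
  assumes "X \<in> Obj D" "Y \<in> Obj D"
  shows "\<epsilon> (X \<odot>\<^sub>D Y) \<circ>\<^sub>D Fa (lax X Y) = (\<epsilon> X \<otimes>\<^sub>D \<epsilon> Y) \<circ>\<^sub>D \<Phi> (So X) (So Y)"
  using R.transpose_cancel[of "(\<epsilon> X \<otimes>\<^sub>D \<epsilon> Y) \<circ>\<^sub>D \<Phi> (So X) (So Y)" "So X \<odot>\<^sub>C So Y"] assms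
  by (simp add: lax_def)

lemma transpose_lax_unit: "\<epsilon> (Unit U) \<circ>\<^sub>D Fa lax_unit = \<Phi>1"
  using R.transpose_cancel[of "\<Phi>1" "Unit T"] by (simp add: lax_unit_def)

text \<open>The laws of \<open>lax\<close> are equations between arrows into some \<open>S Z\<close>. This formula computes the
  transposes of both sides, where the laws become those of \<open>\<Phi>\<close>.\<close>

lemma transpose_lax_TA:
  assumes "f \<in> Arr C" "g \<in> Arr C" "Cod C f = So X" "Cod C g = So Y" "X \<in> Obj D" "Y \<in> Obj D"
  shows "\<epsilon> (X \<odot>\<^sub>D Y) \<circ>\<^sub>D Fa (lax X Y \<circ>\<^sub>C (f \<otimes>\<^sub>C g))
    = ((\<epsilon> X \<circ>\<^sub>D Fa f) \<otimes>\<^sub>D (\<epsilon> Y \<circ>\<^sub>D Fa g)) \<circ>\<^sub>D \<Phi> (Dom C f) (Dom C g)"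
proof -
  have "\<epsilon> (X \<odot>\<^sub>D Y) \<circ>\<^sub>D Fa (lax X Y \<circ>\<^sub>C (f \<otimes>\<^sub>C g))
      = (\<epsilon> (X \<odot>\<^sub>D Y) \<circ>\<^sub>D Fa (lax X Y)) \<circ>\<^sub>D Fa (f \<otimes>\<^sub>C g)"
    using assms by simp
  also have "\<dots> = ((\<epsilon> X \<otimes>\<^sub>D \<epsilon> Y) \<circ>\<^sub>D \<Phi> (So X) (So Y)) \<circ>\<^sub>D Fa (f \<otimes>\<^sub>C g)"
    using assms by (simp only: transpose_lax)
  also have "\<dots> = (\<epsilon> X \<otimes>\<^sub>D \<epsilon> Y) \<circ>\<^sub>D (Fa f \<otimes>\<^sub>D Fa g) \<circ>\<^sub>D \<Phi> (Dom C f) (Dom C g)"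
    using assms \<Phi>_natural_simp[of f g] by simp
  finally show ?thesis using assms by simp
qed

lemma transpose_Sa_Cmp:
  assumes "t \<in> Arr D" "f \<in> Arr C" "Cod C f = So (Dom D t)"
  shows "\<epsilon> (Cod D t) \<circ>\<^sub>D Fa (Sa t \<circ>\<^sub>C f) = t \<circ>\<^sub>D \<epsilon> (Dom D t) \<circ>\<^sub>D Fa f"
  using assms D.Cmp_prefix[OF R.counit_natural[of t], of "Fa f"] by simp

lemma lax_natural:
  assumes "f \<in> Arr D" "g \<in> Arr D"
  shows "lax (Cod D f) (Cod D g) \<circ>\<^sub>C (Sa f \<otimes>\<^sub>C Sa g) = Sa (f \<otimes>\<^sub>D g) \<circ>\<^sub>C lax (Dom D f) (Dom D g)"
proof (rule R.transpose_inject[where Y = "Cod D f \<odot>\<^sub>D Cod D g"])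
  have "\<epsilon> (Cod D f \<odot>\<^sub>D Cod D g) \<circ>\<^sub>D Fa (lax (Cod D f) (Cod D g) \<circ>\<^sub>C (Sa f \<otimes>\<^sub>C Sa g))
      = ((f \<circ>\<^sub>D \<epsilon> (Dom D f)) \<otimes>\<^sub>D (g \<circ>\<^sub>D \<epsilon> (Dom D g))) \<circ>\<^sub>D \<Phi> (So (Dom D f)) (So (Dom D g))"
    using assms transpose_lax_TA[of "Sa f" "Sa g" "Cod D f" "Cod D g"] R.counit_natural by simp
  also have "\<dots> = (f \<otimes>\<^sub>D g) \<circ>\<^sub>D \<epsilon> (Dom D f \<odot>\<^sub>D Dom D g) \<circ>\<^sub>D Fa (lax (Dom D f) (Dom D g))"
    using assms transpose_lax[of "Dom D f" "Dom D g"] by simp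
  also have "\<dots> = \<epsilon> (Cod D f \<odot>\<^sub>D Cod D g) \<circ>\<^sub>D Fa (Sa (f \<otimes>\<^sub>D g) \<circ>\<^sub>C lax (Dom D f) (Dom D g))"
    using assms transpose_Sa_Cmp[of "f \<otimes>\<^sub>D g" "lax (Dom D f) (Dom D g)"] by simp
  finally show "\<epsilon> (Cod D f \<odot>\<^sub>D Cod D g) \<circ>\<^sub>D Fa (lax (Cod D f) (Cod D g) \<circ>\<^sub>C (Sa f \<otimes>\<^sub>C Sa g))
      = \<epsilon> (Cod D f \<odot>\<^sub>D Cod D g) \<circ>\<^sub>D Fa (Sa (f \<otimes>\<^sub>D g) \<circ>\<^sub>C lax (Dom D f) (Dom D g))" .
qed (use assms in simp_all)

text \<open>Up to naturality of the associators, both sides transpose to \<open>\<epsilon> \<otimes> (\<epsilon> \<otimes> \<epsilon>)\<close> preceded by one side of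
  the associativity law of \<open>\<Phi>\<close>.\<close>

lemma lax_assoc:
  assumes X [simp]: "X \<in> Obj D" and Y [simp]: "Y \<in> Obj D" and Z [simp]: "Z \<in> Obj D"
  shows "Sa (Asc U X Y Z) \<circ>\<^sub>C lax (X \<odot>\<^sub>D Y) Z \<circ>\<^sub>C (lax X Y \<otimes>\<^sub>C idC (So Z))
    = lax X (Y \<odot>\<^sub>D Z) \<circ>\<^sub>C (idC (So X) \<otimes>\<^sub>C lax Y Z) \<circ>\<^sub>C Asc T (So X) (So Y) (So Z)"
    (is "?l = ?r")
proof (rule R.transpose_inject[where Y = "X \<odot>\<^sub>D Y \<odot>\<^sub>D Z"])
  let ?\<Phi> = "\<Phi> (So X) (So Y)" and ?\<Phi>' = "\<Phi> (So Y) (So Z)"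
  have "\<epsilon> (X \<odot>\<^sub>D Y \<odot>\<^sub>D Z) \<circ>\<^sub>D Fa ?l
      = Asc U X Y Z \<circ>\<^sub>D \<epsilon> ((X \<odot>\<^sub>D Y) \<odot>\<^sub>D Z) \<circ>\<^sub>D Fa (lax (X \<odot>\<^sub>D Y) Z \<circ>\<^sub>C (lax X Y \<otimes>\<^sub>C idC (So Z)))"
    using transpose_Sa_Cmp[of "Asc U X Y Z" "lax (X \<odot>\<^sub>D Y) Z \<circ>\<^sub>C (lax X Y \<otimes>\<^sub>C idC (So Z))"] by simp
  also have "\<dots> = Asc U X Y Z \<circ>\<^sub>D (((\<epsilon> X \<otimes>\<^sub>D \<epsilon> Y) \<circ>\<^sub>D ?\<Phi>) \<otimes>\<^sub>D \<epsilon> Z) \<circ>\<^sub>D \<Phi> (So X \<odot>\<^sub>C So Y) (So Z)"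
    using transpose_lax_TA[of "lax X Y" "idC (So Z)" "X \<odot>\<^sub>D Y" Z] transpose_lax[of X Y] by simp
  also have "\<dots> = (Asc U X Y Z \<circ>\<^sub>D ((\<epsilon> X \<otimes>\<^sub>D \<epsilon> Y) \<otimes>\<^sub>D \<epsilon> Z))
      \<circ>\<^sub>D (?\<Phi> \<otimes>\<^sub>D idD (Fo (So Z))) \<circ>\<^sub>D \<Phi> (So X \<odot>\<^sub>C So Y) (So Z)"
    by simp
  also have "\<dots> = (\<epsilon> X \<otimes>\<^sub>D \<epsilon> Y \<otimes>\<^sub>D \<epsilon> Z) \<circ>\<^sub>D Asc U (Fo (So X)) (Fo (So Y)) (Fo (So Z))
      \<circ>\<^sub>D (?\<Phi> \<otimes>\<^sub>D idD (Fo (So Z))) \<circ>\<^sub>D \<Phi> (So X \<odot>\<^sub>C So Y) (So Z)"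
    using D.Asc_natural_simp[of "\<epsilon> X" "\<epsilon> Y" "\<epsilon> Z"] by simp
  also have "\<dots> = (\<epsilon> X \<otimes>\<^sub>D \<epsilon> Y \<otimes>\<^sub>D \<epsilon> Z) \<circ>\<^sub>D (idD (Fo (So X)) \<otimes>\<^sub>D ?\<Phi>')
      \<circ>\<^sub>D \<Phi> (So X) (So Y \<odot>\<^sub>C So Z) \<circ>\<^sub>D Fa (Asc T (So X) (So Y) (So Z))"
    by (simp add: \<Phi>_assoc)
  also have "\<dots> = ((\<epsilon> X \<otimes>\<^sub>D ((\<epsilon> Y \<otimes>\<^sub>D \<epsilon> Z) \<circ>\<^sub>D ?\<Phi>')) \<circ>\<^sub>D \<Phi> (So X) (So Y \<odot>\<^sub>C So Z))
      \<circ>\<^sub>D Fa (Asc T (So X) (So Y) (So Z))"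
    by simp
  also have "\<dots> = (\<epsilon> (X \<odot>\<^sub>D Y \<odot>\<^sub>D Z) \<circ>\<^sub>D Fa (lax X (Y \<odot>\<^sub>D Z) \<circ>\<^sub>C (idC (So X) \<otimes>\<^sub>C lax Y Z)))
      \<circ>\<^sub>D Fa (Asc T (So X) (So Y) (So Z))"
    using transpose_lax_TA[of "idC (So X)" "lax Y Z" X "Y \<odot>\<^sub>D Z"] transpose_lax[of Y Z] by simp
  also have "\<dots> = \<epsilon> (X \<odot>\<^sub>D Y \<odot>\<^sub>D Z) \<circ>\<^sub>D Fa ?r" by simp
  finally show "\<epsilon> (X \<odot>\<^sub>D Y \<odot>\<^sub>D Z) \<circ>\<^sub>D Fa ?l = \<epsilon> (X \<odot>\<^sub>D Y \<odot>\<^sub>D Z) \<circ>\<^sub>D Fa ?r" .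
qed simp_all

lemma lax_unit_left:
  assumes [simp]: "X \<in> Obj D"
  shows "Sa (Lun U X) \<circ>\<^sub>C lax (Unit U) X \<circ>\<^sub>C (lax_unit \<otimes>\<^sub>C idC (So X)) = Lun T (So X)" (is "?l = _")
proof (rule R.transpose_inject[where Y = X])
  have "\<epsilon> X \<circ>\<^sub>D Fa ?l = Lun U X \<circ>\<^sub>D \<epsilon> (Unit U \<odot>\<^sub>D X) \<circ>\<^sub>D Fa (lax (Unit U) X \<circ>\<^sub>C (lax_unit \<otimes>\<^sub>C idC (So X)))"
    using transpose_Sa_Cmp[of "Lun U X" "lax (Unit U) X \<circ>\<^sub>C (lax_unit \<otimes>\<^sub>C idC (So X))"] by simp
  also have "\<dots> = Lun U X \<circ>\<^sub>D (\<Phi>1 \<otimes>\<^sub>D \<epsilon> X) \<circ>\<^sub>D \<Phi> (Unit T) (So X)"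
    using transpose_lax_TA[of lax_unit "idC (So X)" "Unit U" X] transpose_lax_unit by simp
  also have "\<dots> = (Lun U X \<circ>\<^sub>D (idD (Unit U) \<otimes>\<^sub>D \<epsilon> X)) \<circ>\<^sub>D (\<Phi>1 \<otimes>\<^sub>D idD (Fo (So X))) \<circ>\<^sub>D \<Phi> (Unit T) (So X)"
    by simp
  also have "\<dots> = \<epsilon> X \<circ>\<^sub>D Lun U (Fo (So X)) \<circ>\<^sub>D (\<Phi>1 \<otimes>\<^sub>D idD (Fo (So X))) \<circ>\<^sub>D \<Phi> (Unit T) (So X)"
    using D.Lun_natural_simp[of "\<epsilon> X"] by simp
  also have "\<dots> = \<epsilon> X \<circ>\<^sub>D Fa (Lun T (So X))" by (simp add: \<Phi>_unit_left)
  finally show "\<epsilon> X \<circ>\<^sub>D Fa ?l = \<epsilon> X \<circ>\<^sub>D Fa (Lun T (So X))" .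
qed simp_all

lemma lax_unit_right:
  assumes [simp]: "X \<in> Obj D"
  shows "Sa (Run U X) \<circ>\<^sub>C lax X (Unit U) \<circ>\<^sub>C (idC (So X) \<otimes>\<^sub>C lax_unit) = Run T (So X)" (is "?l = _")
proof (rule R.transpose_inject[where Y = X])
  have "\<epsilon> X \<circ>\<^sub>D Fa ?l = Run U X \<circ>\<^sub>D \<epsilon> (X \<odot>\<^sub>D Unit U) \<circ>\<^sub>D Fa (lax X (Unit U) \<circ>\<^sub>C (idC (So X) \<otimes>\<^sub>C lax_unit))"
    using transpose_Sa_Cmp[of "Run U X" "lax X (Unit U) \<circ>\<^sub>C (idC (So X) \<otimes>\<^sub>C lax_unit)"] by simp
  also have "\<dots> = Run U X \<circ>\<^sub>D (\<epsilon> X \<otimes>\<^sub>D \<Phi>1) \<circ>\<^sub>D \<Phi> (So X) (Unit T)"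
    using transpose_lax_TA[of "idC (So X)" lax_unit X "Unit U"] transpose_lax_unit by simp
  also have "\<dots> = (Run U X \<circ>\<^sub>D (\<epsilon> X \<otimes>\<^sub>D idD (Unit U))) \<circ>\<^sub>D (idD (Fo (So X)) \<otimes>\<^sub>D \<Phi>1) \<circ>\<^sub>D \<Phi> (So X) (Unit T)"
    by simp
  also have "\<dots> = \<epsilon> X \<circ>\<^sub>D Run U (Fo (So X)) \<circ>\<^sub>D (idD (Fo (So X)) \<otimes>\<^sub>D \<Phi>1) \<circ>\<^sub>D \<Phi> (So X) (Unit T)"
    using D.Run_natural_simp[of "\<epsilon> X"] by simp
  also have "\<dots> = \<epsilon> X \<circ>\<^sub>D Fa (Run T (So X))" by (simp add: \<Phi>_unit_right)
  finally show "\<epsilon> X \<circ>\<^sub>D Fa ?l = \<epsilon> X \<circ>\<^sub>D Fa (Run T (So X))" .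
qed simp_all

text \<open>Naturality of \<open>lax\<close> collects all occurrences of \<open>\<mu>\<close> and \<open>\<iota>\<close> inside \<open>S\<close>; each law of \<open>S B\<close> is then that of
  \<open>B\<close> combined with the law of the same name for \<open>lax\<close>.\<close>

theorem monoid_object_image:
  assumes "monoid_object D U B \<mu> \<iota>"
  shows "monoid_object C T (So B) (Sa \<mu> \<circ>\<^sub>C lax B B) (Sa \<iota> \<circ>\<^sub>C lax_unit)"
proof -
  interpret B: monoid_object D U B \<mu> \<iota> by (fact assms)
  have [simp]: "B \<in> Obj D" "\<mu> \<in> Arr D" "Dom D \<mu> = B \<odot>\<^sub>D B" "Cod D \<mu> = B"
    "\<iota> \<in> Arr D" "Dom D \<iota> = Unit U" "Cod D \<iota> = B"
    using B.A_closed B.\<mu>_closed B.\<iota>_closed by (auto simp: arrows_def)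
  let ?m = "Sa \<mu> \<circ>\<^sub>C lax B B" and ?u = "Sa \<iota> \<circ>\<^sub>C lax_unit" and ?id = "idC (So B)"
  show ?thesis
  proof
    have "?m \<circ>\<^sub>C (?m \<otimes>\<^sub>C ?id) = Sa \<mu> \<circ>\<^sub>C (lax B B \<circ>\<^sub>C (Sa \<mu> \<otimes>\<^sub>C Sa (idD B))) \<circ>\<^sub>C (lax B B \<otimes>\<^sub>C ?id)"
      by simp
    also have "\<dots> = Sa (\<mu> \<circ>\<^sub>D (\<mu> \<otimes>\<^sub>D idD B)) \<circ>\<^sub>C lax (B \<odot>\<^sub>D B) B \<circ>\<^sub>C (lax B B \<otimes>\<^sub>C ?id)"
      using lax_natural[of \<mu> "idD B"] by simp
    also have "\<dots> = Sa \<mu> \<circ>\<^sub>C Sa (idD B \<otimes>\<^sub>D \<mu>)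
        \<circ>\<^sub>C Sa (Asc U B B B) \<circ>\<^sub>C lax (B \<odot>\<^sub>D B) B \<circ>\<^sub>C (lax B B \<otimes>\<^sub>C ?id)"
      by (simp add: B.\<mu>_assoc)
    also have "\<dots> = Sa \<mu> \<circ>\<^sub>C (Sa (idD B \<otimes>\<^sub>D \<mu>) \<circ>\<^sub>C lax B (B \<odot>\<^sub>D B))
        \<circ>\<^sub>C (?id \<otimes>\<^sub>C lax B B) \<circ>\<^sub>C Asc T (So B) (So B) (So B)"
      by (simp add: lax_assoc)
    also have "\<dots> = Sa \<mu> \<circ>\<^sub>C (lax B B \<circ>\<^sub>C (?id \<otimes>\<^sub>C Sa \<mu>))
        \<circ>\<^sub>C (?id \<otimes>\<^sub>C lax B B) \<circ>\<^sub>C Asc T (So B) (So B) (So B)"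
      using lax_natural[of "idD B" \<mu>] by simp
    also have "\<dots> = ?m \<circ>\<^sub>C (?id \<otimes>\<^sub>C ?m) \<circ>\<^sub>C Asc T (So B) (So B) (So B)"
      by simp
    finally show "?m \<circ>\<^sub>C (?m \<otimes>\<^sub>C ?id) = ?m \<circ>\<^sub>C (?id \<otimes>\<^sub>C ?m) \<circ>\<^sub>C Asc T (So B) (So B) (So B)" .
  next
    have "?m \<circ>\<^sub>C (?u \<otimes>\<^sub>C ?id) = Sa \<mu> \<circ>\<^sub>C (lax B B \<circ>\<^sub>C (Sa \<iota> \<otimes>\<^sub>C Sa (idD B))) \<circ>\<^sub>C (lax_unit \<otimes>\<^sub>C ?id)"
      by simp
    also have "\<dots> = Sa (\<mu> \<circ>\<^sub>D (\<iota> \<otimes>\<^sub>D idD B)) \<circ>\<^sub>C lax (Unit U) B \<circ>\<^sub>C (lax_unit \<otimes>\<^sub>C ?id)"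
      using lax_natural[of \<iota> "idD B"] by simp
    finally show "?m \<circ>\<^sub>C (?u \<otimes>\<^sub>C ?id) = Lun T (So B)"
      by (simp add: B.\<mu>_unit_left lax_unit_left)
  next
    have "?m \<circ>\<^sub>C (?id \<otimes>\<^sub>C ?u) = Sa \<mu> \<circ>\<^sub>C (lax B B \<circ>\<^sub>C (Sa (idD B) \<otimes>\<^sub>C Sa \<iota>)) \<circ>\<^sub>C (?id \<otimes>\<^sub>C lax_unit)"
      by simp
    also have "\<dots> = Sa (\<mu> \<circ>\<^sub>D (idD B \<otimes>\<^sub>D \<iota>)) \<circ>\<^sub>C lax B (Unit U) \<circ>\<^sub>C (?id \<otimes>\<^sub>C lax_unit)"
      using lax_natural[of "idD B" \<iota>] by simp
    finally show "?m \<circ>\<^sub>C (?id \<otimes>\<^sub>C ?u) = Run T (So B)"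
      by (simp add: B.\<mu>_unit_right lax_unit_right)
  qed (simp_all add: arrows_def)
qed

text \<open>When \<open>F\<close> is braided, transposition carries the braiding of \<open>C\<close> past \<open>\<Phi>\<close> to that of \<open>D\<close>, so \<open>lax\<close>
  is a braided lax structure.\<close>

lemma commutative_monoid_image:
  assumes "commutative_monoid D U \<beta>D B \<mu> \<iota>"
    and "braided_monoidal_category C T \<beta>C" and "braided_monoidal_category D U \<beta>D"
    and braided: "\<And>X Y. X \<in> Obj C \<Longrightarrow> Y \<in> Obj C
      \<Longrightarrow> \<beta>D (Fo X) (Fo Y) \<circ>\<^sub>D \<Phi> X Y = \<Phi> Y X \<circ>\<^sub>D Fa (\<beta>C X Y)"
  shows "commutative_monoid C T \<beta>C (So B) (Sa \<mu> \<circ>\<^sub>C lax B B) (Sa \<iota> \<circ>\<^sub>C lax_unit)"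
proof -
  interpret B: monoid_object D U B \<mu> \<iota> using assms(1) by (simp add: commutative_monoid_def)
  have [simp]: "B \<in> Obj D" "\<mu> \<in> Arr D" "Dom D \<mu> = B \<odot>\<^sub>D B" "Cod D \<mu> = B"
    using B.A_closed B.\<mu>_closed by (auto simp: arrows_def)
  interpret \<beta>C: braided_monoidal_category C T \<beta>C by (fact assms)
  interpret \<beta>D: braided_monoidal_category D U \<beta>D by (fact assms)
  let ?b = "\<beta>C (So B) (So B)" and ?c = "\<beta>D B B"
  have [simp]: "?b \<in> Arr C" "Dom C ?b = So B \<odot>\<^sub>C So B" "Cod C ?b = So B \<odot>\<^sub>C So B"
    "?c \<in> Arr D" "Dom D ?c = B \<odot>\<^sub>D B" "Cod D ?c = B \<odot>\<^sub>D B"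
    "\<beta>D (Fo (So B)) (Fo (So B)) \<in> Arr D"
    "Dom D (\<beta>D (Fo (So B)) (Fo (So B))) = Fo (So B) \<odot>\<^sub>D Fo (So B)"
    "Cod D (\<beta>D (Fo (So B)) (Fo (So B))) = Fo (So B) \<odot>\<^sub>D Fo (So B)"
    using \<beta>C.\<beta>_closed[of "So B" "So B"] \<beta>D.\<beta>_closed[of B B]
      \<beta>D.\<beta>_closed[of "Fo (So B)" "Fo (So B)"] by (auto simp: arrows_def)
  have "lax B B \<circ>\<^sub>C ?b = Sa ?c \<circ>\<^sub>C lax B B"
  proof (rule R.transpose_inject[where Y = "B \<odot>\<^sub>D B"])
    have "\<epsilon> (B \<odot>\<^sub>D B) \<circ>\<^sub>D Fa (lax B B \<circ>\<^sub>C ?b) = (\<epsilon> (B \<odot>\<^sub>D B) \<circ>\<^sub>D Fa (lax B B)) \<circ>\<^sub>D Fa ?b"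
      by simp
    also have "\<dots> = (\<epsilon> B \<otimes>\<^sub>D \<epsilon> B) \<circ>\<^sub>D \<Phi> (So B) (So B) \<circ>\<^sub>D Fa ?b"
      by (simp only: transpose_lax \<open>B \<in> Obj D\<close>) simp
    also have "\<dots> = ((\<epsilon> B \<otimes>\<^sub>D \<epsilon> B) \<circ>\<^sub>D \<beta>D (Fo (So B)) (Fo (So B))) \<circ>\<^sub>D \<Phi> (So B) (So B)"
      by (simp flip: braided)
    also have "\<dots> = ?c \<circ>\<^sub>D (\<epsilon> B \<otimes>\<^sub>D \<epsilon> B) \<circ>\<^sub>D \<Phi> (So B) (So B)"
      using \<beta>D.\<beta>_natural[of "\<epsilon> B" "Fo (So B)" B "\<epsilon> B" "Fo (So B)" B] by (simp add: arrows_def flip: \<beta>D.\<beta>_natural)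
    also have "\<dots> = \<epsilon> (B \<odot>\<^sub>D B) \<circ>\<^sub>D Fa (Sa ?c \<circ>\<^sub>C lax B B)"
      using transpose_Sa_Cmp[of ?c "lax B B"] transpose_lax[of B B] by simp
    finally show "\<epsilon> (B \<odot>\<^sub>D B) \<circ>\<^sub>D Fa (lax B B \<circ>\<^sub>C ?b) = \<epsilon> (B \<odot>\<^sub>D B) \<circ>\<^sub>D Fa (Sa ?c \<circ>\<^sub>C lax B B)" .
  qed simp_all
  hence "(Sa \<mu> \<circ>\<^sub>C lax B B) \<circ>\<^sub>C ?b = Sa (\<mu> \<circ>\<^sub>D ?c) \<circ>\<^sub>C lax B B" by simp
  with assms(1) monoid_object_image show ?thesis
    by (auto simp: commutative_monoid_def)
qed

end


section \<open>Duality\<close>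

definition op_cat :: "('o, 'a, 'z) cat_scheme \<Rightarrow> ('o, 'a) cat" where
  "op_cat C = \<lparr>Obj = Obj C, Arr = Arr C, Dom = Cod C, Cod = Dom C, Ide = Ide C,
     Cmp = \<lambda>g f. f \<cdot>\<^bsub>C\<^esub> g\<rparr>"

text \<open>The tensor product keeps its order; the constraints are inverted, as they have to point the
  other way in the opposite category.\<close>

definition op_monoidal :: "('x, 'y, 'z) cat_scheme \<Rightarrow> ('x, 'y) monoidal \<Rightarrow> ('x, 'y) monoidal" where
  "op_monoidal C T = \<lparr>TO = TO T, TA = TA T, Unit = Unit T,
     Asc = \<lambda>X Y Z. inv_arr C (Asc T X Y Z), Lun = \<lambda>X. inv_arr C (Lun T X),
     Run = \<lambda>X. inv_arr C (Run T X)\<rparr>"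

lemma op_cat_simps [simp]:
  "Obj (op_cat C) = Obj C" "Arr (op_cat C) = Arr C" "Dom (op_cat C) = Cod C" "Cod (op_cat C) = Dom C"
  "Ide (op_cat C) = Ide C" "g \<cdot>\<^bsub>op_cat C\<^esub> f = f \<cdot>\<^bsub>C\<^esub> g"
  by (simp_all add: op_cat_def)

lemma op_monoidal_simps [simp]:
  "X \<otimes>\<^sub>o\<^bsub>op_monoidal C T\<^esub> Y = X \<otimes>\<^sub>o\<^bsub>T\<^esub> Y" "f \<otimes>\<^sub>a\<^bsub>op_monoidal C T\<^esub> g = f \<otimes>\<^sub>a\<^bsub>T\<^esub> g"
  "Unit (op_monoidal C T) = Unit T" "Asc (op_monoidal C T) X Y Z = inv_arr C (Asc T X Y Z)"
  "Lun (op_monoidal C T) X = inv_arr C (Lun T X)" "Run (op_monoidal C T) X = inv_arr C (Run T X)"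
  by (simp_all add: op_monoidal_def)

lemma arrows_op [simp]: "arrows (op_cat C) X Y = arrows C Y X"
  by (auto simp: arrows_def)

lemma inverse_arrows_op [simp]: "inverse_arrows (op_cat C) f g = inverse_arrows C f g"
  by (auto simp: inverse_arrows_def arrows_def)

lemma iso_arrow_op [simp]: "iso_arrow (op_cat C) f = iso_arrow C f"
  by (simp add: iso_arrow_def)

lemma inv_arr_op [simp]: "inv_arr (op_cat C) f = inv_arr C f"
  by (simp add: inv_arr_def)

lemma (in category) category_op: "category (op_cat C)"
  by unfold_locales (auto simp: arrows_def)

lemma (in cat_functor) cat_functor_op: "cat_functor (op_cat C) (op_cat D) F"
  by (intro cat_functor.intro cat_functor_axioms.intro C.category_op D.category_op)
    (auto simp: arrows_def)

lemma (in natural_transformation) natural_transformation_op: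
  "natural_transformation (op_cat C) (op_cat D) G F \<alpha>"
  by (intro natural_transformation.intro natural_transformation_axioms.intro
      F.cat_functor_op G.cat_functor_op) (auto simp: component naturality)

lemma (in adjunction) adjunction_op: "adjunction (op_cat D) (op_cat C) U F \<epsilon> \<eta>"
  by (intro adjunction.intro adjunction_axioms.intro unit.natural_transformation_op
      counit.natural_transformation_op left.cat_functor_op right.cat_functor_op)
    (auto simp: triangle_left triangle_right)

context monoidal_category
begin

text \<open>Pentagon and triangle of the opposite category are the inverses of the original equations.\<close>

lemma monoidal_category_op: "monoidal_category (op_cat C) (op_monoidal C T)"
proof (intro monoidal_category.intro monoidal_category_axioms.intro category_op)
  fix f X X' g Y Y' h Z Z'
  assume *: "f \<in> arrows (op_cat C) X X'" "g \<in> arrows (op_cat C) Y Y'" "h \<in> arrows (op_cat C) Z Z'"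
  show "Asc (op_monoidal C T) X' Y' Z' \<cdot>\<^bsub>op_cat C\<^esub> (f \<otimes>\<^sub>a\<^bsub>op_monoidal C T\<^esub> g) \<otimes>\<^sub>a\<^bsub>op_monoidal C T\<^esub> h
    = (f \<otimes>\<^sub>a\<^bsub>op_monoidal C T\<^esub> g \<otimes>\<^sub>a\<^bsub>op_monoidal C T\<^esub> h) \<cdot>\<^bsub>op_cat C\<^esub> Asc (op_monoidal C T) X Y Z"
    using * inv_square[OF Asc_natural_simp[of f g h]] by (auto simp: arrows_def)
next
  fix f X X' assume *: "f \<in> arrows (op_cat C) X X'"
  show "Lun (op_monoidal C T) X' \<cdot>\<^bsub>op_cat C\<^esub> Ide (op_cat C) (Unit (op_monoidal C T)) \<otimes>\<^sub>a\<^bsub>op_monoidal C T\<^esub> f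
    = f \<cdot>\<^bsub>op_cat C\<^esub> Lun (op_monoidal C T) X"
    using * inv_square[OF Lun_natural_simp[of f]] by (auto simp: arrows_def)
  show "Run (op_monoidal C T) X' \<cdot>\<^bsub>op_cat C\<^esub> f \<otimes>\<^sub>a\<^bsub>op_monoidal C T\<^esub> Ide (op_cat C) (Unit (op_monoidal C T))
    = f \<cdot>\<^bsub>op_cat C\<^esub> Run (op_monoidal C T) X"
    using * inv_square[OF Run_natural_simp[of f]] by (auto simp: arrows_def)
next
  fix W X Y Z assume "W \<in> Obj (op_cat C)" "X \<in> Obj (op_cat C)" "Y \<in> Obj (op_cat C)" "Z \<in> Obj (op_cat C)"
  thus "Asc (op_monoidal C T) W X (Y \<otimes>\<^sub>o\<^bsub>op_monoidal C T\<^esub> Z)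
      \<cdot>\<^bsub>op_cat C\<^esub> Asc (op_monoidal C T) (W \<otimes>\<^sub>o\<^bsub>op_monoidal C T\<^esub> X) Y Z
    = (Ide (op_cat C) W \<otimes>\<^sub>a\<^bsub>op_monoidal C T\<^esub> Asc (op_monoidal C T) X Y Z)
      \<cdot>\<^bsub>op_cat C\<^esub> Asc (op_monoidal C T) W (X \<otimes>\<^sub>o\<^bsub>op_monoidal C T\<^esub> Y) Z
      \<cdot>\<^bsub>op_cat C\<^esub> (Asc (op_monoidal C T) W X Y \<otimes>\<^sub>a\<^bsub>op_monoidal C T\<^esub> Ide (op_cat C) Z)"
    using arg_cong[OF pentagon[of W X Y Z], of "inv_arr C"] by simp
next
  fix X Y assume "X \<in> Obj (op_cat C)" "Y \<in> Obj (op_cat C)"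
  thus "(Ide (op_cat C) X \<otimes>\<^sub>a\<^bsub>op_monoidal C T\<^esub> Lun (op_monoidal C T) Y)
      \<cdot>\<^bsub>op_cat C\<^esub> Asc (op_monoidal C T) X (Unit (op_monoidal C T)) Y
    = Run (op_monoidal C T) X \<otimes>\<^sub>a\<^bsub>op_monoidal C T\<^esub> Ide (op_cat C) Y"
    using arg_cong[OF triangle[of X Y], of "inv_arr C"] by simp
qed (auto simp: arrows_def)

lemma monoid_object_op:
  "monoid_object (op_cat C) (op_monoidal C T) A \<delta> \<epsilon> \<longleftrightarrow> comonoid_object C T A \<delta> \<epsilon>"
    (is "?m \<longleftrightarrow> ?c")
proof
  assume ?m
  then interpret m: monoid_object "op_cat C" "op_monoidal C T" A \<delta> \<epsilon> .
  have [simp]: "A \<in> Obj C" "\<delta> \<in> Arr C" "Dom C \<delta> = A" "Cod C \<delta> = A \<otimes>\<^sub>o\<^bsub>T\<^esub> A"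
    "\<epsilon> \<in> Arr C" "Dom C \<epsilon> = A" "Cod C \<epsilon> = Unit T"
    using m.A_closed m.\<mu>_closed m.\<iota>_closed by (auto simp: arrows_def)
  show ?c
  proof (intro comonoid_object.intro comonoid_object_axioms.intro)
    show "monoidal_category C T" ..
    show "Asc T A A A \<cdot>\<^bsub>C\<^esub> (\<delta> \<otimes>\<^sub>a\<^bsub>T\<^esub> Ide C A) \<cdot>\<^bsub>C\<^esub> \<delta> = (Ide C A \<otimes>\<^sub>a\<^bsub>T\<^esub> \<delta>) \<cdot>\<^bsub>C\<^esub> \<delta>"
      using m.\<mu>_assoc by simp
    show "Lun T A \<cdot>\<^bsub>C\<^esub> (\<epsilon> \<otimes>\<^sub>a\<^bsub>T\<^esub> Ide C A) \<cdot>\<^bsub>C\<^esub> \<delta> = Ide C A"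
      using m.\<mu>_unit_left by simp
    show "Run T A \<cdot>\<^bsub>C\<^esub> (Ide C A \<otimes>\<^sub>a\<^bsub>T\<^esub> \<epsilon>) \<cdot>\<^bsub>C\<^esub> \<delta> = Ide C A"
      using m.\<mu>_unit_right by simp
  qed (simp_all add: arrows_def)
next
  assume ?c
  then interpret c: comonoid_object C T A \<delta> \<epsilon> .
  have [simp]: "A \<in> Obj C" "\<delta> \<in> Arr C" "Dom C \<delta> = A" "Cod C \<delta> = A \<otimes>\<^sub>o\<^bsub>T\<^esub> A"
    "\<epsilon> \<in> Arr C" "Dom C \<epsilon> = A" "Cod C \<epsilon> = Unit T"
    using c.A_closed c.\<delta>_closed c.\<epsilon>_closed by (auto simp: arrows_def)
  have "(\<delta> \<otimes>\<^sub>a\<^bsub>T\<^esub> Ide C A) \<cdot>\<^bsub>C\<^esub> \<delta>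
      = inv_arr C (Asc T A A A) \<cdot>\<^bsub>C\<^esub> Asc T A A A \<cdot>\<^bsub>C\<^esub> (\<delta> \<otimes>\<^sub>a\<^bsub>T\<^esub> Ide C A) \<cdot>\<^bsub>C\<^esub> \<delta>"
    by simp
  hence assoc: "(\<delta> \<otimes>\<^sub>a\<^bsub>T\<^esub> Ide C A) \<cdot>\<^bsub>C\<^esub> \<delta> = inv_arr C (Asc T A A A) \<cdot>\<^bsub>C\<^esub> (Ide C A \<otimes>\<^sub>a\<^bsub>T\<^esub> \<delta>) \<cdot>\<^bsub>C\<^esub> \<delta>"
    by (simp only: c.\<delta>_assoc)
  have "(\<epsilon> \<otimes>\<^sub>a\<^bsub>T\<^esub> Ide C A) \<cdot>\<^bsub>C\<^esub> \<delta>
      = inv_arr C (Lun T A) \<cdot>\<^bsub>C\<^esub> Lun T A \<cdot>\<^bsub>C\<^esub> (\<epsilon> \<otimes>\<^sub>a\<^bsub>T\<^esub> Ide C A) \<cdot>\<^bsub>C\<^esub> \<delta>"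
    by simp
  hence left: "(\<epsilon> \<otimes>\<^sub>a\<^bsub>T\<^esub> Ide C A) \<cdot>\<^bsub>C\<^esub> \<delta> = inv_arr C (Lun T A)"
    by (simp only: c.\<delta>_counit_left) simp
  have "(Ide C A \<otimes>\<^sub>a\<^bsub>T\<^esub> \<epsilon>) \<cdot>\<^bsub>C\<^esub> \<delta>
      = inv_arr C (Run T A) \<cdot>\<^bsub>C\<^esub> Run T A \<cdot>\<^bsub>C\<^esub> (Ide C A \<otimes>\<^sub>a\<^bsub>T\<^esub> \<epsilon>) \<cdot>\<^bsub>C\<^esub> \<delta>"
    by simp
  hence right: "(Ide C A \<otimes>\<^sub>a\<^bsub>T\<^esub> \<epsilon>) \<cdot>\<^bsub>C\<^esub> \<delta> = inv_arr C (Run T A)"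
    by (simp only: c.\<delta>_counit_right) simp
  show ?m
    by (intro monoid_object.intro monoid_object_axioms.intro monoidal_category_op)
      (simp_all add: arrows_def assoc left right)
qed

text \<open>The comonoid is the unit monoid of the opposite category. Both Frobenius composites are the identity
  of \<open>1 \<otimes> 1\<close>, by the triangle and the equality of the two unitors at \<open>1\<close>.\<close>

lemma special_frobenius_object_Unit:
  "special_frobenius_object C T (Unit T) (Lun T (Unit T)) (Ide C (Unit T))
     (inv_arr C (Lun T (Unit T))) (Ide C (Unit T))"
proof -
  let ?I = "Unit T"
  interpret op: monoidal_category "op_cat C" "op_monoidal C T" by (rule monoidal_category_op)
  have comonoid: "comonoid_object C T ?I (inv_arr C (Lun T ?I)) (Ide C ?I)"
    using op.monoid_object_Unit by (simp flip: monoid_object_op)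
  have tri: "(Ide C ?I \<otimes>\<^sub>a\<^bsub>T\<^esub> Lun T ?I) \<cdot>\<^bsub>C\<^esub> Asc T ?I ?I ?I = Lun T ?I \<otimes>\<^sub>a\<^bsub>T\<^esub> Ide C ?I"
    using triangle[of ?I ?I] by (simp only: Lun_Unit_eq_Run_Unit Unit_simp)
  have *: "(Ide C ?I \<otimes>\<^sub>a\<^bsub>T\<^esub> Lun T ?I) \<cdot>\<^bsub>C\<^esub> Asc T ?I ?I ?I \<cdot>\<^bsub>C\<^esub> (inv_arr C (Lun T ?I) \<otimes>\<^sub>a\<^bsub>T\<^esub> Ide C ?I)
      = Ide C (?I \<otimes>\<^sub>o\<^bsub>T\<^esub> ?I)"
    by (simp add: Cmp_prefix[OF tri])
  have "(Ide C ?I \<otimes>\<^sub>a\<^bsub>T\<^esub> inv_arr C (Lun T ?I)) = Asc T ?I ?I ?I \<cdot>\<^bsub>C\<^esub> (inv_arr C (Lun T ?I) \<otimes>\<^sub>a\<^bsub>T\<^esub> Ide C ?I)"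
  proof (rule iso_cancel_left)
    show "(Ide C ?I \<otimes>\<^sub>a\<^bsub>T\<^esub> Lun T ?I) \<cdot>\<^bsub>C\<^esub> (Ide C ?I \<otimes>\<^sub>a\<^bsub>T\<^esub> inv_arr C (Lun T ?I))
      = (Ide C ?I \<otimes>\<^sub>a\<^bsub>T\<^esub> Lun T ?I) \<cdot>\<^bsub>C\<^esub> Asc T ?I ?I ?I \<cdot>\<^bsub>C\<^esub> (inv_arr C (Lun T ?I) \<otimes>\<^sub>a\<^bsub>T\<^esub> Ide C ?I)"
      by (simp only: *) simp
  qed simp_all
  hence **: "(Lun T ?I \<otimes>\<^sub>a\<^bsub>T\<^esub> Ide C ?I) \<cdot>\<^bsub>C\<^esub> inv_arr C (Asc T ?I ?I ?I) \<cdot>\<^bsub>C\<^esub> (Ide C ?I \<otimes>\<^sub>a\<^bsub>T\<^esub> inv_arr C (Lun T ?I))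
      = Ide C (?I \<otimes>\<^sub>o\<^bsub>T\<^esub> ?I)"
    by simp
  show ?thesis
    by (intro special_frobenius_object.intro special_frobenius_object_axioms.intro
        frobenius_object.intro frobenius_object_axioms.intro monoid_object_Unit comonoid)
      (simp_all add: * **)
qed

end

text \<open>The two Frobenius laws say that \<open>\<delta>\<close> is a bimodule map, and speciality that it is a section.\<close>

lemma (in special_frobenius_object) separable: "separable_monoid C T A \<mu> \<iota>"
  unfolding separable_monoid_def
proof (intro conjI bexI[of _ \<delta>])
  have [simp]: "\<delta> \<in> Arr C" "Dom C \<delta> = A" "Cod C \<delta> = A \<otimes>\<^sub>o\<^bsub>T\<^esub> A" "A \<in> Obj C"
    "\<mu> \<in> Arr C" "Dom C \<mu> = A \<otimes>\<^sub>o\<^bsub>T\<^esub> A" "Cod C \<mu> = A"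
    using A_closed \<delta>_closed \<mu>_closed by (auto simp: arrows_def)
  show "left_linear C T A \<mu> ((\<mu> \<otimes>\<^sub>a\<^bsub>T\<^esub> Ide C A) \<cdot>\<^bsub>C\<^esub> inv_arr C (Asc T A A A)) \<delta>"
    using frobenius_right by (simp add: left_linear_def)
  show "right_linear C T A \<mu> ((Ide C A \<otimes>\<^sub>a\<^bsub>T\<^esub> \<mu>) \<cdot>\<^bsub>C\<^esub> Asc T A A A) \<delta>"
    using frobenius_left by (simp add: right_linear_def)
qed (use special \<delta>_closed in \<open>simp_all add: monoid_object_axioms\<close>)

lemma (in strong_monoidal_functor) strong_monoidal_functor_op:
  "strong_monoidal_functor (op_cat C) (op_monoidal C T) (op_cat D) (op_monoidal D U) F
     (\<lambda>X Y. inv_arr D (\<Phi> X Y)) (inv_arr D \<Phi>1)"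
proof (intro strong_monoidal_functor.intro strong_monoidal_functor_axioms.intro
    cat_functor_op C.monoidal_category_op D.monoidal_category_op)
  fix f X X' g Y Y' assume *: "f \<in> arrows (op_cat C) X X'" "g \<in> arrows (op_cat C) Y Y'"
  show "inv_arr D (\<Phi> X' Y') \<cdot>\<^bsub>op_cat D\<^esub> FA F (f \<otimes>\<^sub>a\<^bsub>op_monoidal C T\<^esub> g)
    = (FA F f \<otimes>\<^sub>a\<^bsub>op_monoidal D U\<^esub> FA F g) \<cdot>\<^bsub>op_cat D\<^esub> inv_arr D (\<Phi> X Y)"
    using * D.inv_square[OF \<Phi>_natural_simp[of f g]] by (auto simp: arrows_def)
next
  fix X Y Z assume "X \<in> Obj (op_cat C)" "Y \<in> Obj (op_cat C)" "Z \<in> Obj (op_cat C)"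
  thus "Asc (op_monoidal D U) (FO F X) (FO F Y) (FO F Z)
      \<cdot>\<^bsub>op_cat D\<^esub> (inv_arr D (\<Phi> X Y) \<otimes>\<^sub>a\<^bsub>op_monoidal D U\<^esub> Ide (op_cat D) (FO F Z))
      \<cdot>\<^bsub>op_cat D\<^esub> inv_arr D (\<Phi> (X \<otimes>\<^sub>o\<^bsub>op_monoidal C T\<^esub> Y) Z)
    = (Ide (op_cat D) (FO F X) \<otimes>\<^sub>a\<^bsub>op_monoidal D U\<^esub> inv_arr D (\<Phi> Y Z))
      \<cdot>\<^bsub>op_cat D\<^esub> inv_arr D (\<Phi> X (Y \<otimes>\<^sub>o\<^bsub>op_monoidal C T\<^esub> Z))
      \<cdot>\<^bsub>op_cat D\<^esub> FA F (Asc (op_monoidal C T) X Y Z)"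
    using arg_cong[OF \<Phi>_assoc[of X Y Z], of "inv_arr D"] by (simp add: FA_inv)
next
  fix X assume "X \<in> Obj (op_cat C)"
  thus "Lun (op_monoidal D U) (FO F X)
      \<cdot>\<^bsub>op_cat D\<^esub> (inv_arr D \<Phi>1 \<otimes>\<^sub>a\<^bsub>op_monoidal D U\<^esub> Ide (op_cat D) (FO F X))
      \<cdot>\<^bsub>op_cat D\<^esub> inv_arr D (\<Phi> (Unit (op_monoidal C T)) X)
    = FA F (Lun (op_monoidal C T) X)"
    and "Run (op_monoidal D U) (FO F X)
      \<cdot>\<^bsub>op_cat D\<^esub> (Ide (op_cat D) (FO F X) \<otimes>\<^sub>a\<^bsub>op_monoidal D U\<^esub> inv_arr D \<Phi>1)
      \<cdot>\<^bsub>op_cat D\<^esub> inv_arr D (\<Phi> X (Unit (op_monoidal C T)))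
    = FA F (Run (op_monoidal C T) X)"
    using arg_cong[OF \<Phi>_unit_left[of X], of "inv_arr D"]
      arg_cong[OF \<Phi>_unit_right[of X], of "inv_arr D"] by (simp_all add: FA_inv)
qed (auto simp: arrows_def)


section \<open>Ambidextrous adjunctions with a projection formula\<close>

text \<open>This isolates what is used of a restriction functor \<open>F = i\<^sup>*\<close>, with \<open>S = i\<^sub>! = i\<^sub>*\<close>. The condition is
  self-dual, which is what makes the passage to opposite categories work.\<close>

locale ambidextrous_monoidal_functor =
  monoidal_right_adjoint C T D U F \<Phi> \<Phi>1 S \<eta> \<epsilon> + L: adjunction D C S F \<eta>' \<epsilon>'
  for C :: "('x, 'y, 'z) cat_scheme" and T :: "('x, 'y) monoidal"
    and D :: "('p, 'b, 'w) cat_scheme" and U :: "('p, 'b) monoidal"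
    and F :: "('x, 'y, 'p, 'b) ftr" and \<Phi> :: "'x \<Rightarrow> 'x \<Rightarrow> 'b" and \<Phi>1 :: 'b
    and S :: "('p, 'b, 'x, 'y) ftr" and \<eta> :: "'x \<Rightarrow> 'y" and \<epsilon> :: "'p \<Rightarrow> 'b"
    and \<eta>' :: "'p \<Rightarrow> 'b" and \<epsilon>' :: "'x \<Rightarrow> 'y" +
  assumes special: "Y \<in> Obj D \<Longrightarrow> \<epsilon> Y \<circ>\<^sub>D \<eta>' Y = idD Y"
    and projection_formula: "X \<in> Obj C \<Longrightarrow> Y \<in> Obj D \<Longrightarrow> inverse_arrows C
      (Sa ((idD (Fo X) \<otimes>\<^sub>D \<epsilon> Y) \<circ>\<^sub>D \<Phi> X (So Y)) \<circ>\<^sub>C \<eta> (X \<odot>\<^sub>C So Y))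
      (\<epsilon>' (X \<odot>\<^sub>C So Y) \<circ>\<^sub>C Sa (inv_arr D (\<Phi> X (So Y)) \<circ>\<^sub>D (idD (Fo X) \<otimes>\<^sub>D \<eta>' Y)))"
begin

definition proj :: "'x \<Rightarrow> 'p \<Rightarrow> 'y" where
  "proj X Y = Sa ((idD (Fo X) \<otimes>\<^sub>D \<epsilon> Y) \<circ>\<^sub>D \<Phi> X (So Y)) \<circ>\<^sub>C \<eta> (X \<odot>\<^sub>C So Y)"

definition colax :: "'p \<Rightarrow> 'p \<Rightarrow> 'y" where
  "colax X Y = \<epsilon>' (So X \<odot>\<^sub>C So Y) \<circ>\<^sub>C Sa (inv_arr D (\<Phi> (So X) (So Y)) \<circ>\<^sub>D (\<eta>' X \<otimes>\<^sub>D \<eta>' Y))"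

definition colax_unit :: 'y where
  "colax_unit = \<epsilon>' (Unit T) \<circ>\<^sub>C Sa (inv_arr D \<Phi>1)"

lemma colax_simps [simp]:
  assumes "X \<in> Obj D" "Y \<in> Obj D"
  shows "colax X Y \<in> Arr C" "Dom C (colax X Y) = So (X \<odot>\<^sub>D Y)" "Cod C (colax X Y) = So X \<odot>\<^sub>C So Y"
  using assms by (simp_all add: colax_def)

lemma proj_simps [simp]:
  assumes "X \<in> Obj C" "Y \<in> Obj D"
  shows "proj X Y \<in> Arr C" "Dom C (proj X Y) = X \<odot>\<^sub>C So Y" "Cod C (proj X Y) = So (Fo X \<odot>\<^sub>D Y)"
    "iso_arrow C (proj X Y)"
  using assms projection_formula[OF assms] by (auto simp: proj_def iso_arrow_def)

lemma inv_proj: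
  assumes "X \<in> Obj C" "Y \<in> Obj D"
  shows "inv_arr C (proj X Y)
    = \<epsilon>' (X \<odot>\<^sub>C So Y) \<circ>\<^sub>C Sa (inv_arr D (\<Phi> X (So Y)) \<circ>\<^sub>D (idD (Fo X) \<otimes>\<^sub>D \<eta>' Y))"
  unfolding proj_def by (rule C.inv_arr_eqI[OF projection_formula[OF assms]])

lemma lax_eq_proj:
  assumes [simp]: "X \<in> Obj D" "Y \<in> Obj D"
  shows "lax X Y = Sa (\<epsilon> X \<otimes>\<^sub>D idD Y) \<circ>\<^sub>C proj (So X) Y"
proof -
  have "lax X Y = Sa ((\<epsilon> X \<otimes>\<^sub>D idD Y) \<circ>\<^sub>D (idD (Fo (So X)) \<otimes>\<^sub>D \<epsilon> Y) \<circ>\<^sub>D \<Phi> (So X) (So Y))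
      \<circ>\<^sub>C \<eta> (So X \<odot>\<^sub>C So Y)"
    by (simp add: lax_def)
  thus ?thesis by (simp add: proj_def del: D.TA_Cmp_simp D.TA_Cmp_prefix)
qed

lemma colax_eq_inv_proj:
  assumes [simp]: "X \<in> Obj D" "Y \<in> Obj D"
  shows "colax X Y = inv_arr C (proj (So X) Y) \<circ>\<^sub>C Sa (\<eta>' X \<otimes>\<^sub>D idD Y)"
proof -
  have "colax X Y = \<epsilon>' (So X \<odot>\<^sub>C So Y)
      \<circ>\<^sub>C Sa (inv_arr D (\<Phi> (So X) (So Y)) \<circ>\<^sub>D (idD (Fo (So X)) \<otimes>\<^sub>D \<eta>' Y) \<circ>\<^sub>D (\<eta>' X \<otimes>\<^sub>D idD Y))"
    by (simp add: colax_def)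
  thus ?thesis by (simp add: inv_proj del: D.TA_Cmp_simp D.TA_Cmp_prefix)
qed

text \<open>The projection maps cancel, which leaves the image under \<open>S\<close> of \<open>\<epsilon> \<eta>' = 1\<close>.\<close>

lemma lax_colax:
  assumes [simp]: "X \<in> Obj D" "Y \<in> Obj D"
  shows "lax X Y \<circ>\<^sub>C colax X Y = idC (So (X \<odot>\<^sub>D Y))"
proof -
  have "lax X Y \<circ>\<^sub>C colax X Y = Sa ((\<epsilon> X \<otimes>\<^sub>D idD Y) \<circ>\<^sub>D (\<eta>' X \<otimes>\<^sub>D idD Y))"
    by (simp add: lax_eq_proj colax_eq_inv_proj del: D.TA_Cmp_simp)
  thus ?thesis by (simp add: special)
qed

text \<open>This identity, in which \<open>X\<close> is arbitrary in \<open>C\<close>, lets \<open>proj\<close> inherit the associativity of \<open>lax\<close>.\<close>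

lemma proj_eq_lax:
  assumes [simp]: "X \<in> Obj C" "Y \<in> Obj D"
  shows "proj X Y = lax (Fo X) Y \<circ>\<^sub>C (\<eta> X \<otimes>\<^sub>C idC (So Y))"
proof (rule R.transpose_inject[where Y = "Fo X \<odot>\<^sub>D Y"])
  have "\<epsilon> (Fo X \<odot>\<^sub>D Y) \<circ>\<^sub>D Fa (proj X Y) = (idD (Fo X) \<otimes>\<^sub>D \<epsilon> Y) \<circ>\<^sub>D \<Phi> X (So Y)"
    using R.transpose_cancel[of "(idD (Fo X) \<otimes>\<^sub>D \<epsilon> Y) \<circ>\<^sub>D \<Phi> X (So Y)" "X \<odot>\<^sub>C So Y"]
    by (simp add: proj_def)
  also have "\<dots> = \<epsilon> (Fo X \<odot>\<^sub>D Y) \<circ>\<^sub>D Fa (lax (Fo X) Y \<circ>\<^sub>C (\<eta> X \<otimes>\<^sub>C idC (So Y)))"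
    using transpose_lax_TA[of "\<eta> X" "idC (So Y)" "Fo X" Y] R.triangle_left[of X] by simp
  finally show "\<epsilon> (Fo X \<odot>\<^sub>D Y) \<circ>\<^sub>D Fa (proj X Y)
      = \<epsilon> (Fo X \<odot>\<^sub>D Y) \<circ>\<^sub>D Fa (lax (Fo X) Y \<circ>\<^sub>C (\<eta> X \<otimes>\<^sub>C idC (So Y)))" .
qed simp_all

lemma proj_assoc:
  assumes [simp]: "W \<in> Obj C" "Y \<in> Obj D" "Z \<in> Obj D"
  shows "proj W (Y \<odot>\<^sub>D Z) \<circ>\<^sub>C (idC W \<otimes>\<^sub>C lax Y Z) \<circ>\<^sub>C Asc T W (So Y) (So Z)
    = Sa (Asc U (Fo W) Y Z) \<circ>\<^sub>C lax (Fo W \<odot>\<^sub>D Y) Z \<circ>\<^sub>C (proj W Y \<otimes>\<^sub>C idC (So Z))"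
proof -
  let ?S = "So (Fo W)"
  have "proj W (Y \<odot>\<^sub>D Z) \<circ>\<^sub>C (idC W \<otimes>\<^sub>C lax Y Z) \<circ>\<^sub>C Asc T W (So Y) (So Z)
      = lax (Fo W) (Y \<odot>\<^sub>D Z) \<circ>\<^sub>C (idC ?S \<otimes>\<^sub>C lax Y Z)
        \<circ>\<^sub>C (\<eta> W \<otimes>\<^sub>C idC (So Y) \<otimes>\<^sub>C idC (So Z)) \<circ>\<^sub>C Asc T W (So Y) (So Z)"
    by (simp add: proj_eq_lax)
  also have "\<dots> = (lax (Fo W) (Y \<odot>\<^sub>D Z) \<circ>\<^sub>C (idC ?S \<otimes>\<^sub>C lax Y Z) \<circ>\<^sub>C Asc T ?S (So Y) (So Z))
        \<circ>\<^sub>C ((\<eta> W \<otimes>\<^sub>C idC (So Y)) \<otimes>\<^sub>C idC (So Z))"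
    using C.Asc_natural_simp[of "\<eta> W" "idC (So Y)" "idC (So Z)"] by simp
  also have "\<dots> = (Sa (Asc U (Fo W) Y Z) \<circ>\<^sub>C lax (Fo W \<odot>\<^sub>D Y) Z \<circ>\<^sub>C (lax (Fo W) Y \<otimes>\<^sub>C idC (So Z)))
        \<circ>\<^sub>C ((\<eta> W \<otimes>\<^sub>C idC (So Y)) \<otimes>\<^sub>C idC (So Z))"
    by (simp only: lax_assoc FO_simp assms)
  also have "\<dots> = Sa (Asc U (Fo W) Y Z) \<circ>\<^sub>C lax (Fo W \<odot>\<^sub>D Y) Z \<circ>\<^sub>C (proj W Y \<otimes>\<^sub>C idC (So Z))"
    by (simp add: proj_eq_lax)
  finally show ?thesis .
qed

text \<open>After composition with an invertible projection map the \<open>colax\<close> on the right side turns into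
  \<open>S (\<eta>' \<otimes> 1)\<close>. On the left side \<open>proj_assoc\<close> moves the projection map next to the other \<open>colax\<close>, which
  turns into \<open>S (\<eta>' \<otimes> 1)\<close> too, and naturality of \<open>lax\<close> brings both into the same place.\<close>

lemma lax_colax_frobenius:
  assumes [simp]: "X \<in> Obj D" "Y \<in> Obj D" "Z \<in> Obj D"
  shows "(idC (So X) \<otimes>\<^sub>C lax Y Z) \<circ>\<^sub>C Asc T (So X) (So Y) (So Z) \<circ>\<^sub>C (colax X Y \<otimes>\<^sub>C idC (So Z))
    = colax X (Y \<odot>\<^sub>D Z) \<circ>\<^sub>C Sa (Asc U X Y Z) \<circ>\<^sub>C lax (X \<odot>\<^sub>D Y) Z" (is "?l = ?r")
proof (rule C.iso_cancel_left)
  let ?F = "Fo (So X)" and ?P = "proj (So X) (Y \<odot>\<^sub>D Z)"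
  have "?P \<circ>\<^sub>C ?l = (?P \<circ>\<^sub>C (idC (So X) \<otimes>\<^sub>C lax Y Z) \<circ>\<^sub>C Asc T (So X) (So Y) (So Z))
      \<circ>\<^sub>C (colax X Y \<otimes>\<^sub>C idC (So Z))"
    by simp
  also have "\<dots> = (Sa (Asc U ?F Y Z) \<circ>\<^sub>C lax (?F \<odot>\<^sub>D Y) Z \<circ>\<^sub>C (proj (So X) Y \<otimes>\<^sub>C idC (So Z)))
      \<circ>\<^sub>C (colax X Y \<otimes>\<^sub>C idC (So Z))"
    by (simp only: proj_assoc R.right.FO_simp assms)
  also have "\<dots> = Sa (Asc U ?F Y Z) \<circ>\<^sub>C lax (?F \<odot>\<^sub>D Y) Z \<circ>\<^sub>C (Sa (\<eta>' X \<otimes>\<^sub>D idD Y) \<otimes>\<^sub>C Sa (idD Z))"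
    by (simp add: colax_eq_inv_proj)
  also have "\<dots> = Sa (Asc U ?F Y Z \<circ>\<^sub>D ((\<eta>' X \<otimes>\<^sub>D idD Y) \<otimes>\<^sub>D idD Z)) \<circ>\<^sub>C lax (X \<odot>\<^sub>D Y) Z"
    using lax_natural[of "\<eta>' X \<otimes>\<^sub>D idD Y" "idD Z"] by simp
  also have "\<dots> = Sa (\<eta>' X \<otimes>\<^sub>D idD (Y \<odot>\<^sub>D Z)) \<circ>\<^sub>C Sa (Asc U X Y Z) \<circ>\<^sub>C lax (X \<odot>\<^sub>D Y) Z"
    using D.Asc_natural_simp[of "\<eta>' X" "idD Y" "idD Z"] by simp
  also have "\<dots> = ?P \<circ>\<^sub>C ?r"
    by (simp add: colax_eq_inv_proj)
  finally show "?P \<circ>\<^sub>C ?l = ?P \<circ>\<^sub>C ?r" .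
qed simp_all

lemma ambidextrous_op:
  "ambidextrous_monoidal_functor (op_cat C) (op_monoidal C T) (op_cat D) (op_monoidal D U)
     F (\<lambda>X Y. inv_arr D (\<Phi> X Y)) (inv_arr D \<Phi>1) S \<epsilon>' \<eta>' \<epsilon> \<eta>"
proof (intro ambidextrous_monoidal_functor.intro ambidextrous_monoidal_functor_axioms.intro
    monoidal_right_adjoint.intro strong_monoidal_functor_op L.adjunction_op R.adjunction_op)
  fix X Y assume "X \<in> Obj (op_cat C)" "Y \<in> Obj (op_cat D)"
  thus "inverse_arrows (op_cat C)
      (Sa ((Ide (op_cat D) (Fo X) \<otimes>\<^sub>a\<^bsub>op_monoidal D U\<^esub> \<eta>' Y) \<cdot>\<^bsub>op_cat D\<^esub> inv_arr D (\<Phi> X (So Y)))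
        \<cdot>\<^bsub>op_cat C\<^esub> \<epsilon>' (X \<otimes>\<^sub>o\<^bsub>op_monoidal C T\<^esub> So Y))
      (\<eta> (X \<otimes>\<^sub>o\<^bsub>op_monoidal C T\<^esub> So Y) \<cdot>\<^bsub>op_cat C\<^esub> Sa (inv_arr (op_cat D) (inv_arr D (\<Phi> X (So Y)))
        \<cdot>\<^bsub>op_cat D\<^esub> (Ide (op_cat D) (Fo X) \<otimes>\<^sub>a\<^bsub>op_monoidal D U\<^esub> \<epsilon> Y)))"
    using C.inverse_arrows_sym[OF projection_formula[of X Y]] by simp
qed (auto simp: special)

interpretation op: ambidextrous_monoidal_functor "op_cat C" "op_monoidal C T" "op_cat D" "op_monoidal D U"
  F "\<lambda>X Y. inv_arr D (\<Phi> X Y)" "inv_arr D \<Phi>1" S \<epsilon>' \<eta>' \<epsilon> \<eta>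
  by (rule ambidextrous_op)

lemma op_lax [simp]: "op.lax = colax"
  by (intro ext) (simp add: op.lax_def colax_def)

lemma op_lax_unit [simp]: "op.lax_unit = colax_unit"
  by (simp add: op.lax_unit_def colax_unit_def)

lemma op_colax [simp]: "X \<in> Obj D \<Longrightarrow> Y \<in> Obj D \<Longrightarrow> op.colax X Y = lax X Y"
  by (simp add: op.colax_def lax_def)

lemma colax_natural:
  assumes "f \<in> Arr D" "g \<in> Arr D"
  shows "colax (Cod D f) (Cod D g) \<circ>\<^sub>C Sa (f \<otimes>\<^sub>D g) = (Sa f \<otimes>\<^sub>C Sa g) \<circ>\<^sub>C colax (Dom D f) (Dom D g)"
  using op.lax_natural[of f g] assms by simp

text \<open>The lemma speaks of bare arrows \<open>\<mu>\<close> and \<open>\<delta>\<close> so that it can be read in the opposite category with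
  the two exchanged, where it concerns the other Frobenius law.\<close>

lemma frobenius_left_image:
  assumes [simp]: "B \<in> Obj D" and \<mu>: "\<mu> \<in> arrows D (B \<odot>\<^sub>D B) B" and \<delta>: "\<delta> \<in> arrows D B (B \<odot>\<^sub>D B)"
    and frob: "(idD B \<otimes>\<^sub>D \<mu>) \<circ>\<^sub>D Asc U B B B \<circ>\<^sub>D (\<delta> \<otimes>\<^sub>D idD B) = \<delta> \<circ>\<^sub>D \<mu>"
  defines "m \<equiv> Sa \<mu> \<circ>\<^sub>C lax B B" and "d \<equiv> colax B B \<circ>\<^sub>C Sa \<delta>"
  shows "(idC (So B) \<otimes>\<^sub>C m) \<circ>\<^sub>C Asc T (So B) (So B) (So B) \<circ>\<^sub>C (d \<otimes>\<^sub>C idC (So B)) = d \<circ>\<^sub>C m"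
proof -
  let ?id = "idC (So B)" and ?a = "Asc T (So B) (So B) (So B)"
  have [simp]: "\<mu> \<in> Arr D" "Dom D \<mu> = B \<odot>\<^sub>D B" "Cod D \<mu> = B" "\<delta> \<in> Arr D" "Dom D \<delta> = B" "Cod D \<delta> = B \<odot>\<^sub>D B"
    using \<mu> \<delta> by (auto simp: arrows_def)
  have natural: "(?id \<otimes>\<^sub>C Sa \<mu>) \<circ>\<^sub>C colax B (B \<odot>\<^sub>D B) = colax B B \<circ>\<^sub>C Sa (idD B \<otimes>\<^sub>D \<mu>)"
    "lax (B \<odot>\<^sub>D B) B \<circ>\<^sub>C (Sa \<delta> \<otimes>\<^sub>C Sa (idD B)) = Sa (\<delta> \<otimes>\<^sub>D idD B) \<circ>\<^sub>C lax B B"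
    using colax_natural[of "idD B" \<mu>] lax_natural[of \<delta> "idD B"] by simp_all
  have "(?id \<otimes>\<^sub>C m) \<circ>\<^sub>C ?a \<circ>\<^sub>C (d \<otimes>\<^sub>C ?id)
      = (?id \<otimes>\<^sub>C Sa \<mu>) \<circ>\<^sub>C ((?id \<otimes>\<^sub>C lax B B) \<circ>\<^sub>C ?a \<circ>\<^sub>C (colax B B \<otimes>\<^sub>C ?id)) \<circ>\<^sub>C (Sa \<delta> \<otimes>\<^sub>C Sa (idD B))"
    by (simp add: m_def d_def)
  also have "\<dots> = ((?id \<otimes>\<^sub>C Sa \<mu>) \<circ>\<^sub>C colax B (B \<odot>\<^sub>D B)) \<circ>\<^sub>C Sa (Asc U B B B)
      \<circ>\<^sub>C (lax (B \<odot>\<^sub>D B) B \<circ>\<^sub>C (Sa \<delta> \<otimes>\<^sub>C Sa (idD B)))"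
    by (subst lax_colax_frobenius) simp_all
  also have "\<dots> = (colax B B \<circ>\<^sub>C Sa (idD B \<otimes>\<^sub>D \<mu>)) \<circ>\<^sub>C Sa (Asc U B B B) \<circ>\<^sub>C (Sa (\<delta> \<otimes>\<^sub>D idD B) \<circ>\<^sub>C lax B B)"
    by (simp only: natural)
  also have "\<dots> = colax B B \<circ>\<^sub>C Sa ((idD B \<otimes>\<^sub>D \<mu>) \<circ>\<^sub>D Asc U B B B \<circ>\<^sub>D (\<delta> \<otimes>\<^sub>D idD B)) \<circ>\<^sub>C lax B B"
    by simp
  also have "\<dots> = d \<circ>\<^sub>C m"
    by (simp only: frob) (simp add: m_def d_def)
  finally show ?thesis .
qed

text \<open>The comonoid laws and the second Frobenius law are the monoid laws and the first Frobenius law for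
  the opposite categories.\<close>

theorem frobenius_object_image:
  assumes "frobenius_object D U B \<mu> \<iota> \<delta> \<gamma>"
  shows "frobenius_object C T (So B) (Sa \<mu> \<circ>\<^sub>C lax B B) (Sa \<iota> \<circ>\<^sub>C lax_unit)
    (colax B B \<circ>\<^sub>C Sa \<delta>) (colax_unit \<circ>\<^sub>C Sa \<gamma>)"
proof -
  interpret B: frobenius_object D U B \<mu> \<iota> \<delta> \<gamma> by (fact assms)
  have B [simp]: "B \<in> Obj D" "\<mu> \<in> Arr D" "Dom D \<mu> = B \<odot>\<^sub>D B" "Cod D \<mu> = B"
    "\<delta> \<in> Arr D" "Dom D \<delta> = B" "Cod D \<delta> = B \<odot>\<^sub>D B"
    using B.A_closed B.\<mu>_closed B.\<delta>_closed by (auto simp: arrows_def)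
  have "monoid_object (op_cat D) (op_monoidal D U) B \<delta> \<gamma>"
    by (simp add: D.monoid_object_op B.comonoid_object_axioms)
  from op.monoid_object_image[OF this]
  have "comonoid_object C T (So B) (colax B B \<circ>\<^sub>C Sa \<delta>) (colax_unit \<circ>\<^sub>C Sa \<gamma>)"
    by (simp add: C.monoid_object_op)
  moreover have "(idC (So B) \<otimes>\<^sub>C (Sa \<mu> \<circ>\<^sub>C lax B B)) \<circ>\<^sub>C Asc T (So B) (So B) (So B)
      \<circ>\<^sub>C ((colax B B \<circ>\<^sub>C Sa \<delta>) \<otimes>\<^sub>C idC (So B)) = (colax B B \<circ>\<^sub>C Sa \<delta>) \<circ>\<^sub>C (Sa \<mu> \<circ>\<^sub>C lax B B)"
    by (intro frobenius_left_image B.A_closed B.\<mu>_closed B.\<delta>_closed B.frobenius_left)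
  moreover have "(colax B B \<circ>\<^sub>C Sa \<delta>) \<circ>\<^sub>C (Sa \<mu> \<circ>\<^sub>C lax B B) = ((Sa \<mu> \<circ>\<^sub>C lax B B) \<otimes>\<^sub>C idC (So B))
      \<circ>\<^sub>C inv_arr C (Asc T (So B) (So B) (So B)) \<circ>\<^sub>C (idC (So B) \<otimes>\<^sub>C (colax B B \<circ>\<^sub>C Sa \<delta>))"
    using ambidextrous_monoidal_functor.frobenius_left_image[OF ambidextrous_op, of B \<delta> \<mu>] B.frobenius_right
    by (simp add: arrows_def)
  ultimately show ?thesis
    using monoid_object_image[OF B.monoid_object_axioms]
    by (intro frobenius_object.intro frobenius_object_axioms.intro)
qed

theorem special_frobenius_object_image:
  assumes "special_frobenius_object D U B \<mu> \<iota> \<delta> \<gamma>"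
  shows "special_frobenius_object C T (So B) (Sa \<mu> \<circ>\<^sub>C lax B B) (Sa \<iota> \<circ>\<^sub>C lax_unit)
    (colax B B \<circ>\<^sub>C Sa \<delta>) (colax_unit \<circ>\<^sub>C Sa \<gamma>)"
proof -
  interpret B: special_frobenius_object D U B \<mu> \<iota> \<delta> \<gamma> by (fact assms)
  have [simp]: "B \<in> Obj D" "\<mu> \<in> Arr D" "Dom D \<mu> = B \<odot>\<^sub>D B" "Cod D \<mu> = B"
    "\<delta> \<in> Arr D" "Dom D \<delta> = B" "Cod D \<delta> = B \<odot>\<^sub>D B"
    using B.A_closed B.\<mu>_closed B.\<delta>_closed by (auto simp: arrows_def)
  have "(Sa \<mu> \<circ>\<^sub>C lax B B) \<circ>\<^sub>C (colax B B \<circ>\<^sub>C Sa \<delta>) = Sa \<mu> \<circ>\<^sub>C (lax B B \<circ>\<^sub>C colax B B) \<circ>\<^sub>C Sa \<delta>"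
    by simp
  also have "\<dots> = Sa (\<mu> \<circ>\<^sub>D \<delta>)" by (simp add: lax_colax)
  finally have "(Sa \<mu> \<circ>\<^sub>C lax B B) \<circ>\<^sub>C (colax B B \<circ>\<^sub>C Sa \<delta>) = idC (So B)"
    by (simp only: B.special) simp
  thus ?thesis
    using frobenius_object_image[OF B.frobenius_object_axioms]
    by (intro special_frobenius_object.intro special_frobenius_object_axioms.intro)
qed

end

section \<open>Restriction functors of a Green 2-functor\<close>

text \<open>The chosen functors \<open>i\<^sub>!\<close> and \<open>i\<^sub>*\<close> agree only on the objects and arrows of their source, so \<open>i\<^sub>*\<close> has
  to be shown to inherit the adjunction of \<open>i\<^sub>!\<close>.\<close>

lemma adjunction_ftr_eq:
  assumes "adjunction C D F U \<eta> \<epsilon>" and "cat_functor C D F'" and "ftr_eq C F F'"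
  shows "adjunction C D F' U \<eta> \<epsilon>"
proof -
  interpret adjunction C D F U \<eta> \<epsilon> by (fact assms)
  interpret F': cat_functor C D F' by (fact assms)
  have FO [simp]: "\<And>X. X \<in> Obj C \<Longrightarrow> FO F X = FO F' X" and FA [simp]: "\<And>f. f \<in> Arr C \<Longrightarrow> FA F f = FA F' f"
    using assms(3) by (auto simp: ftr_eq_def)
  have id: "cat_functor C C id_ftr" "cat_functor D D id_ftr"
    by (rule unit.F.cat_functor_axioms counit.G.cat_functor_axioms)+
  have UF: "cat_functor C C (comp_ftr U F')"
    by (intro cat_functor.intro cat_functor_axioms.intro cat_functor.axioms(1)[OF assms(2)])
      (auto simp: comp_ftr_def arrows_def)
  have FU: "cat_functor D D (comp_ftr F' U)"
    by (intro cat_functor.intro cat_functor_axioms.intro cat_functor.axioms(2)[OF assms(2)])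
      (auto simp: comp_ftr_def arrows_def)
  show ?thesis
  proof (intro adjunction.intro adjunction_axioms.intro natural_transformation.intro
      natural_transformation_axioms.intro id UF FU left.cat_functor_axioms
      right.cat_functor_axioms F'.cat_functor_axioms)
    show "\<And>X. X \<in> Obj C \<Longrightarrow> \<eta> X \<in> arrows C (FO id_ftr X) (FO (comp_ftr U F') X)"
      by (simp add: arrows_def id_ftr_def comp_ftr_def)
    show "\<And>f X Y. f \<in> arrows C X Y \<Longrightarrow> \<eta> Y \<cdot>\<^bsub>C\<^esub> FA id_ftr f = FA (comp_ftr U F') f \<cdot>\<^bsub>C\<^esub> \<eta> X"
      using unit_natural by (auto simp: arrows_def id_ftr_def comp_ftr_def)
    show "\<And>X. X \<in> Obj D \<Longrightarrow> \<epsilon> X \<in> arrows D (FO (comp_ftr F' U) X) (FO id_ftr X)"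
      by (simp add: arrows_def id_ftr_def comp_ftr_def)
    show "\<And>f X Y. f \<in> arrows D X Y \<Longrightarrow> \<epsilon> Y \<cdot>\<^bsub>D\<^esub> FA (comp_ftr F' U) f = FA id_ftr f \<cdot>\<^bsub>D\<^esub> \<epsilon> X"
      using counit_natural by (auto simp: arrows_def id_ftr_def comp_ftr_def)
    show "\<And>X. X \<in> Obj C \<Longrightarrow> \<epsilon> (FO F' X) \<cdot>\<^bsub>D\<^esub> FA F' (\<eta> X) = Ide D (FO F' X)"
      using triangle_left by simp
    show "\<And>Y. Y \<in> Obj D \<Longrightarrow> FA U (\<epsilon> Y) \<cdot>\<^bsub>C\<^esub> \<eta> (FO U Y) = Ide C (FO U Y)"
      by (rule triangle_right)
  qed
qed

lemma (in green_two_functor) ambidextrous_restriction: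
  assumes i: "i \<in> J" "i \<in> cells1 B H G"
  shows "ambidextrous_monoidal_functor (MC M G) (Mon M G) (MC M H) (Mon M H) (Pull M i) (PullT M i) (PullU M i)
    (RSt M i) (r\<eta> M i) (r\<epsilon> M i) (l\<eta> M i) (l\<epsilon> M i)"
proof -
  have s: "Src B i = H" "Trg B i = G" using i by (auto simp: cells1_def)
  have F: "strong_monoidal_functor (MC M G) (Mon M G) (MC M H) (Mon M H) (Pull M i) (PullT M i) (PullU M i)"
    by (rule Pull_monoidal[OF i(2)])
  have R: "adjunction (MC M G) (MC M H) (Pull M i) (RSt M i) (r\<eta> M i) (r\<epsilon> M i)"
    using right_adjunction[OF i(1)] unfolding s .
  have Rr: "cat_functor (MC M H) (MC M G) (RSt M i)" using R by (rule adjunction.axioms)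
  have L: "adjunction (MC M H) (MC M G) (RSt M i) (Pull M i) (l\<eta> M i) (l\<epsilon> M i)"
    using adjunction_ftr_eq[OF left_adjunction[OF i(1)] _ LSh_eq_RSt[OF i(1)]] Rr unfolding s .
  interpret F: strong_monoidal_functor "MC M G" "Mon M G" "MC M H" "Mon M H" "Pull M i" "PullT M i" "PullU M i"
    by (rule F)
  interpret R: adjunction "MC M G" "MC M H" "Pull M i" "RSt M i" "r\<eta> M i" "r\<epsilon> M i"
    by (rule R)
  interpret L: adjunction "MC M H" "MC M G" "RSt M i" "Pull M i" "l\<eta> M i" "l\<epsilon> M i"
    by (rule L)
  have LSh: "\<And>X. X \<in> Obj (MC M H) \<Longrightarrow> FO (LSh M i) X = FO (RSt M i) X"
    "\<And>f. f \<in> Arr (MC M H) \<Longrightarrow> FA (LSh M i) f = FA (RSt M i) f"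
    using LSh_eq_RSt[OF i(1)] unfolding s ftr_eq_def by blast+
  show ?thesis
  proof (intro ambidextrous_monoidal_functor.intro ambidextrous_monoidal_functor_axioms.intro
      monoidal_right_adjoint.intro F R L)
    show "\<And>Y. Y \<in> Obj (MC M H) \<Longrightarrow> r\<epsilon> M i Y \<cdot>\<^bsub>MC M H\<^esub> l\<eta> M i Y = Ide (MC M H) Y"
      using special_adjunctions[OF i(1)] unfolding s .
    fix X Y assume [simp]: "X \<in> Obj (MC M G)" "Y \<in> Obj (MC M H)"
    have "Rp1 B M i X Y = FA (RSt M i) ((Ide (MC M H) (FO (Pull M i) X) \<otimes>\<^sub>a\<^bsub>Mon M H\<^esub> r\<epsilon> M i Y) \<cdot>\<^bsub>MC M H\<^esub> PullT M i X (FO (RSt M i) Y))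
        \<cdot>\<^bsub>MC M G\<^esub> r\<eta> M i (X \<otimes>\<^sub>o\<^bsub>Mon M G\<^esub> FO (RSt M i) Y)"
      by (simp add: Rp1_def Let_def s)
    moreover have "Lp1 B M i X Y = l\<epsilon> M i (X \<otimes>\<^sub>o\<^bsub>Mon M G\<^esub> FO (RSt M i) Y)
        \<cdot>\<^bsub>MC M G\<^esub> FA (RSt M i) (inv_arr (MC M H) (PullT M i X (FO (RSt M i) Y))
        \<cdot>\<^bsub>MC M H\<^esub> (Ide (MC M H) (FO (Pull M i) X) \<otimes>\<^sub>a\<^bsub>Mon M H\<^esub> l\<eta> M i Y))"
      by (simp add: Lp1_def Let_def s LSh)
    ultimately show "inverse_arrows (MC M G)
      (FA (RSt M i) ((Ide (MC M H) (FO (Pull M i) X) \<otimes>\<^sub>a\<^bsub>Mon M H\<^esub> r\<epsilon> M i Y) \<cdot>\<^bsub>MC M H\<^esub> PullT M i X (FO (RSt M i) Y))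
        \<cdot>\<^bsub>MC M G\<^esub> r\<eta> M i (X \<otimes>\<^sub>o\<^bsub>Mon M G\<^esub> FO (RSt M i) Y))
      (l\<epsilon> M i (X \<otimes>\<^sub>o\<^bsub>Mon M G\<^esub> FO (RSt M i) Y) \<cdot>\<^bsub>MC M G\<^esub> FA (RSt M i) (inv_arr (MC M H) (PullT M i X (FO (RSt M i) Y))
        \<cdot>\<^bsub>MC M H\<^esub> (Ide (MC M H) (FO (Pull M i) X) \<otimes>\<^sub>a\<^bsub>Mon M H\<^esub> l\<eta> M i Y)))"
      using projection1[OF i(1), of X Y] unfolding s by simp
  qed
qed

theorem theorem7p9:
  fixes k :: "('k, 'r) ring_scheme"
    and ic :: bool
    and \<G> :: "('o, 'f, 't, 'z) two_cat_scheme"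
    and J :: "'f set"
    and M :: "('k, 'o, 'f, 't, 'x, 'y, 'm) green_scheme"
    and i :: 'f and H G :: 'o
    and A :: 'x and \<mu> \<iota> \<delta> \<epsilon> :: 'y
  assumes "green_two_functor k ic \<G> J M"
    and "i \<in> J" and "i \<in> cells1 \<G> H G"
    and "A = can_obj \<G> M i"
    and "\<mu> = can_mult \<G> M i" and "\<iota> = can_unit \<G> M i"
    and "\<delta> = can_comult \<G> M i" and "\<epsilon> = can_counit \<G> M i"
  shows "special_frobenius_object (MC M G) (Mon M G) A \<mu> \<iota> \<delta> \<epsilon>
    \<and> (\<forall>\<beta>. braided_green_two_functor k ic \<G> J M \<beta>
         \<longrightarrow> commutative_monoid (MC M G) (Mon M G) (\<beta> G) A \<mu> \<iota>)
    \<and> separable_monoid (MC M G) (Mon M G) A \<mu> \<iota>"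
proof -
  interpret green_two_functor k ic \<G> J M by (fact assms(1))
  note i = assms(2,3)
  have s: "Src \<G> i = H" "Trg \<G> i = G" using i by (auto simp: cells1_def)
  have amb: "ambidextrous_monoidal_functor (MC M G) (Mon M G) (MC M H) (Mon M H) (Pull M i) (PullT M i)
      (PullU M i) (RSt M i) (r\<eta> M i) (r\<epsilon> M i) (l\<eta> M i) (l\<epsilon> M i)"
    by (rule ambidextrous_restriction[OF i])
  interpret S: ambidextrous_monoidal_functor "MC M G" "Mon M G" "MC M H" "Mon M H" "Pull M i" "PullT M i"
    "PullU M i" "RSt M i" "r\<eta> M i" "r\<epsilon> M i" "l\<eta> M i" "l\<epsilon> M i"
    by (rule amb)
  have LSh: "\<And>X. X \<in> Obj (MC M H) \<Longrightarrow> FO (LSh M i) X = FO (RSt M i) X"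
    "\<And>f. f \<in> Arr (MC M H) \<Longrightarrow> FA (LSh M i) f = FA (RSt M i) f"
    using LSh_eq_RSt[OF i(1)] unfolding s ftr_eq_def by blast+
  let ?I = "Unit (Mon M H)"
  \<comment> \<open>The canonical structure on \<open>A\<close> is the image of the structure on the unit object, whose own unit and
    counit are identities.\<close>
  have A: "A = FO (RSt M i) ?I"
    unfolding assms(4) can_obj_def s by (rule LSh(1)[OF S.D.Unit_simp])
  have \<mu>: "\<mu> = FA (RSt M i) (Lun (Mon M H) ?I) \<cdot>\<^bsub>MC M G\<^esub> S.lax ?I ?I"
    unfolding assms(5) can_mult_def star_lax_def S.lax_def Let_def s by simp
  have \<iota>: "\<iota> = FA (RSt M i) (Ide (MC M H) ?I) \<cdot>\<^bsub>MC M G\<^esub> S.lax_unit"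
    unfolding assms(6) can_unit_def S.lax_unit_def s by simp
  have \<delta>: "\<delta> = S.colax ?I ?I \<cdot>\<^bsub>MC M G\<^esub> FA (RSt M i) (inv_arr (MC M H) (Lun (Mon M H) ?I))"
    unfolding assms(7) can_comult_def shriek_colax_def S.colax_def Let_def s by (simp add: LSh)
  have \<epsilon>: "\<epsilon> = S.colax_unit \<cdot>\<^bsub>MC M G\<^esub> FA (RSt M i) (Ide (MC M H) ?I)"
    unfolding assms(8) can_counit_def S.colax_unit_def s by (simp add: LSh)
  have special: "special_frobenius_object (MC M G) (Mon M G) A \<mu> \<iota> \<delta> \<epsilon>"
    unfolding A \<mu> \<iota> \<delta> \<epsilon>
    by (rule S.special_frobenius_object_image[OF S.D.special_frobenius_object_Unit])
  moreover have "commutative_monoid (MC M G) (Mon M G) (\<beta> G) A \<mu> \<iota>"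
    if "braided_green_two_functor k ic \<G> J M \<beta>" for \<beta>
  proof -
    note braided = braided_green_two_functor.Mon_braided[OF that] braided_green_two_functor.Pull_braided[OF that]
    have GH: "G \<in> Ob0 \<G>" "H \<in> Ob0 \<G>"
      using i Src_closed[of i] Trg_closed[of i] by (auto simp: cells1_def)
    show ?thesis
      unfolding A \<mu> \<iota>
      by (rule S.commutative_monoid_image[OF
            braided_monoidal_category.commutative_monoid_Unit[OF braided(1)[OF GH(2)]]
            braided(1)[OF GH(1)] braided(1)[OF GH(2)] braided(2)[OF i(2)]])
  qed
  ultimately show ?thesis
    using special_frobenius_object.separable[OF special] by blast
qed

end
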